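(* Let $\nu$ be a continuous (i.e. atomless) probability measure on $[0,2\pi]$. Then $\nu$ is the radial projection of the harmonic measure of a strictly star-shaped domain, i.e. $\nu=\widehat\omega_\Omega$ for some strictly star-shaped domain $\Omega$, if and only if $\nu\in\mathcal A[0,2\pi]$.
   Context: A domain $\Omega\subset\mathbb C$ is strictly star-shaped if it has the form $$\Omega=\{re^{i\theta}:\ 0\le r<r_\Omega(\theta),\ 0\le\theta\le2\pi\}$$ with $r_\Omega$ a positive continuous function on $[0,2\pi]$ with $r_\Omega(0)=r_\Omega(2\pi)$. For a bounded Jordan domain $\Omega$ containing the origin and a set $E\subset\partial\Omega$, $\omega(z,E,\Omega)$ denotes the harmonic measure of $E$ at $z\in\Omega$ (the solution of the Dirichlet problem in $\Omega$ with boundary data $1$ on $E$ and $0$ on $\partial\Omega\setminus E$). The radial projection of the harmonic measure of $\Omega$ (at $0$) is the measure on $[0,2\pi]$ defined by $$\widehat\omega_\Omega(F)=\omega(0,\{\zeta\in\partial\Omega:\arg\zeta\in F\},\Omega)$$ for each Borel set $F\subset[0,2\pi]$. The class $\mathcal A[a,b]$: let $\nu$ be a probability measure on a segment $[a,b]\subset\mathbb R$, identified with its distribution function $\nu(t)=\nu([a,t])$. Suppose $\nu(t)$ is strictly increasing and continuous on $[a,b]$, and let $\mu$ be its inverse function (defined on $[0,1]$), extended to the whole real axis by $\mu(t)=a$ for $t<0$ and $\mu(t)=b$ for $t>1$. Then $\nu\in\mathcal A[a,b]$ means that $$\lim_{\delta\to0}\ \sup_{x\in\mathbb R}\int_0^\delta\frac{\mu(x+t)-\mu(x-t)}{t}\,dt=0.$$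 (In particular membership in $\mathcal A[a,b]$ includes strict monotonicity and continuity of the distribution function.) *)

theory Defs
  imports "HOL-Probability.Probability" "HOL-Complex_Analysis.Complex_Analysis"
begin

definition strictly_star_shaped :: "complex set \<Rightarrow> bool" where
  "strictly_star_shaped \<Omega> \<longleftrightarrow>
     (\<exists>R :: real \<Rightarrow> real.
        continuous_on {0..2*pi} R \<and> (\<forall>\<theta>\<in>{0..2*pi}. R \<theta> > 0) \<and> R 0 = R (2*pi) \<and>
        \<Omega> = {of_real \<rho> * cis \<theta> | \<rho> \<theta>. 0 \<le> \<rho> \<and> \<rho> < R \<theta> \<and> \<theta> \<in> {0..2*pi}})"

definition subharmonic_on :: "complex set \<Rightarrow> (complex \<Rightarrow> real) \<Rightarrow> bool" where
  "subharmonic_on \<Omega> v \<longleftrightarrow>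
     continuous_on \<Omega> v \<and>
     (\<forall>z r. 0 < r \<and> cball z r \<subseteq> \<Omega> \<longrightarrow>
        v z \<le> 1 / (2*pi) * integral {0..2*pi} (\<lambda>t. v (z + of_real r * cis t)))"

text \<open>
  The Dirichlet problem with discontinuous bounded boundary data \<open>f\<close> is solved in the sense of
  Perron: the solution is the upper envelope of the subharmonic functions whose boundary
  upper limits do not exceed \<open>f\<close>.  For the indicator of a Borel subset of the boundary of a bounded
  Jordan domain the data are resolutive, so that the upper Perron solution gives the same function.
\<close>

definition perron_family :: "complex set \<Rightarrow> (complex \<Rightarrow> real) \<Rightarrow> (complex \<Rightarrow> real) set" where
  "perron_family \<Omega> f =
     {v. subharmonic_on \<Omega> v \<and>
         (\<forall>\<zeta>\<in>frontier \<Omega>. Limsup (at \<zeta> within \<Omega>) (\<lambda>w. ereal (v w)) \<le> ereal (f \<zeta>))}"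

definition dirichlet_solution :: "complex set \<Rightarrow> (complex \<Rightarrow> real) \<Rightarrow> complex \<Rightarrow> real" where
  "dirichlet_solution \<Omega> f z = (SUP v\<in>perron_family \<Omega> f. v z)"

definition harmonic_measure :: "complex \<Rightarrow> complex set \<Rightarrow> complex set \<Rightarrow> real" where
  "harmonic_measure z E \<Omega> = dirichlet_solution \<Omega> (indicator E) z"

text \<open>
  \<open>Arg2pi\<close> takes values in \<open>[0, 2\<pi>)\<close>, so the boundary point on the positive real axis is
  assigned to \<open>0\<close> and not to \<open>2\<pi>\<close>; single boundary points have zero harmonic measure, so this
  choice is immaterial.
\<close>

definition radial_projection :: "complex set \<Rightarrow> real set \<Rightarrow> real" where
  "radial_projection \<Omega> F = harmonic_measure 0 {\<zeta> \<in> frontier \<Omega>. Arg2pi \<zeta> \<in> F} \<Omega>"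

definition prob_on_segment :: "real \<Rightarrow> real \<Rightarrow> real measure \<Rightarrow> bool" where
  "prob_on_segment a b \<nu> \<longleftrightarrow>
     prob_space \<nu> \<and> sets \<nu> = sets (restrict_space borel {a..b})"

definition distr_fun :: "real \<Rightarrow> real measure \<Rightarrow> real \<Rightarrow> real" where
  "distr_fun a \<nu> t = measure \<nu> {a..t}"

definition inverse_distr :: "real \<Rightarrow> real \<Rightarrow> real measure \<Rightarrow> real \<Rightarrow> real" where
  "inverse_distr a b \<nu> s =
     (if s < 0 then a else if s > 1 then b else the_inv_into {a..b} (distr_fun a \<nu>) s)"

text \<open>
  The condition \<open>distr_fun a \<nu> a = 0\<close> (no atom at the left end point) is what makes the inverse
  function defined on all of \<open>[0, 1]\<close>.  The inverse is nondecreasing, so the integrand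
  is nonnegative and \<open>ennreal\<close> truncates nothing; the integral and the supremum may be infinite.
\<close>

definition class_A :: "real \<Rightarrow> real \<Rightarrow> real measure set" where
  "class_A a b =
     {\<nu>. prob_on_segment a b \<nu> \<and>
         strict_mono_on {a..b} (distr_fun a \<nu>) \<and>
         continuous_on {a..b} (distr_fun a \<nu>) \<and> distr_fun a \<nu> a = 0 \<and>
         ((\<lambda>\<delta>. SUP x::real. \<integral>\<^sup>+t\<in>{0<..<\<delta>}.
              ennreal ((inverse_distr a b \<nu> (x + t) - inverse_distr a b \<nu> (x - t)) / t) \<partial>lborel)
            \<longlongrightarrow> 0) (at_right 0)}"

end

theory Submission
  imports Defs
begin

text \<open>
  Let \<open>f z = z * exp (h z)\<close> be the Riemann map of the unit disc onto \<open>\<Omega>\<close> and put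
  \<open>\<theta> t = t + Im (h (cis t))\<close>, the argument of \<open>f (cis t)\<close>.  The radial projection is the image of the
  normalised length on the circle under \<open>\<theta>\<close>, so that \<open>s \<mapsto> \<theta> (2 * pi * s)\<close> is the inverse of its distribution
  function.  The real part of \<open>h\<close> is recovered from \<open>\<theta>\<close> by the conjugate Poisson kernel
  \<open>Q r s = r * sin s / (1 - 2 * r * cos s + r\<^sup>2)\<close>, which increases with \<open>r\<close> to \<open>cot (s/2) / 2\<close>, applied to the
  symmetric increments \<open>\<theta> (x + s) - \<theta> (x - s) - 2 * s\<close>.  As \<open>\<theta>\<close> is nondecreasing, \<open>Re h\<close> extends continuously
  to the closed disc if and only if \<open>\<theta>\<close> satisfies the integral condition defining the class.

  If \<open>\<Omega>\<close> is star-shaped, then \<open>\<theta>\<close> is nondecreasing on every circle by the Schwarz lemma; since \<open>Re h\<close> is bounded,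
  \<open>\<theta>\<close> has a logarithmic modulus of continuity, uniformly on all circles, so \<open>Im h\<close> extends to the closed disc, and
  so does \<open>Re h\<close>, its boundary values being prescribed by the radius of \<open>\<Omega>\<close>.  Conversely, the integral condition
  yields \<open>h\<close> from \<open>\<theta>\<close>, and \<open>z * exp (h z)\<close> maps the disc conformally onto the star-shaped domain whose radius in
  the direction \<open>\<theta> t\<close> is \<open>exp (Re (h (cis t)))\<close>.
\<close>

section \<open>Schwarz integrals\<close>

text \<open>No general theory of Jordan domains is used for the boundary behaviour. Nonnegativity of
  the increments of \<open>\<theta>\<close> does the work instead: an integral of nonnegative terms
  can be localised, so a bound on \<open>Re h\<close> at a single interior point already bounds the
  increments of \<open>\<theta>\<close> at the matching scale. The argument has to be extended
  before the modulus, because the radius of the domain can be evaluated only along directions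
  already known to be continuous. In the converse direction the candidate map is not known to be
  injective; it is compared with the Riemann map of the target domain rather than by counting
  preimages. The two qualitative properties of the distribution function have different sources. A
  gap of \<nu> would be a jump of \<open>\<theta>\<close>, excluded by boundedness of
  \<open>Re h\<close>; an atom would be an interval of constancy of \<open>\<theta>\<close>,
  excluded by hypothesis. The inverse distribution function is continued by constants whereas
  \<open>\<theta>\<close> is quasi-periodic, so the two are related by clipping in one direction and
  by summing translates in the other.\<close>

lemma absolutely_integrable_on_continuous_subset:
  fixes f :: "real \<Rightarrow> 'a::euclidean_space"
  assumes "continuous_on {a..b} f" "T \<in> sets lebesgue" "T \<subseteq> {a..b}"
  shows "f absolutely_integrable_on T"
  using absolutely_integrable_continuous_real[OF assms(1)] assms(2,3)
  by (rule set_integrable_subset)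

lemma circle_cauchy:
  fixes F :: "complex \<Rightarrow> complex"
  assumes "continuous_on (cball 0 1) F" "F holomorphic_on ball 0 1" "norm z < 1"
  shows "((\<lambda>t. F (cis t) * cis t / (cis t - z)) has_integral 2 * pi * F z) {0..2*pi}"
proof -
  have "((\<lambda>u. F u / (u - z)) has_contour_integral (2 * of_real pi * \<i> * F z)) (part_circlepath 0 1 0 (2*pi))"
    using Cauchy_integral_circlepath[of 0 1 F z] assms by (simp add: circlepath_def)
  then have "((\<lambda>t. F (cis t) / (cis t - z) * \<i> * cis t) has_integral (2 * of_real pi * \<i> * F z)) {0..2*pi}"
    by (simp add: has_contour_integral_part_circlepath_iff)
  from has_integral_mult_right[OF this, of "-\<i>"] show ?thesis
    by (simp add: mult_ac divide_inverse)
qed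

lemma holomorphic_circle_mean:
  fixes F :: "complex \<Rightarrow> complex"
  assumes "F holomorphic_on S" "open S" "cball z r \<subseteq> S" "r > 0"
  shows "((\<lambda>t. F (z + of_real r * cis t)) has_integral 2 * pi * F z) {0..2*pi}"
proof -
  have "F holomorphic_on cball z r" using assms holomorphic_on_subset by blast
  then have "((\<lambda>u. F u / (u - z)) has_contour_integral (2 * of_real pi * \<i> * F z)) (part_circlepath z r 0 (2*pi))"
    using Cauchy_integral_circlepath_simple[of F z r z] assms by (simp add: circlepath_def)
  then have "((\<lambda>t. F (z + r * cis t) / (r * cis t) * r * \<i> * cis t) has_integral (2 * of_real pi * \<i> * F z)) {0..2*pi}"
    by (simp add: has_contour_integral_part_circlepath_iff)
  then have "((\<lambda>t. F (z + r * cis t) * \<i>) has_integral (2 * of_real pi * \<i> * F z)) {0..2*pi}"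
    using assms by (simp add: field_simps)
  from has_integral_mult_right[OF this, of "-\<i>"] show ?thesis
    by (simp add: mult_ac)
qed

text \<open>The set \<open>T\<close> is kept as a parameter for two purposes: over the whole circle
  the integral rebuilds a holomorphic function from boundary data \<open>g\<close>, and with
  \<open>g = 1\<close> its real part is the harmonic measure in the disc of the boundary set with
  parameters in \<open>T\<close>.\<close>

definition schwarz_integral :: "real set \<Rightarrow> (complex \<Rightarrow> real) \<Rightarrow> complex \<Rightarrow> complex" where
  "schwarz_integral T g z =
     integral T (\<lambda>t. of_real (g (cis t)) * ((cis t + z) / (cis t - z))) / (2 * pi)"

lemma cis_neq: "norm z < 1 \<Longrightarrow> cis t \<noteq> z"
  by (metis norm_cis less_irrefl)

lemma continuous_on_circle_comp:
  "continuous_on (sphere 0 1) g \<Longrightarrow> continuous_on A (\<lambda>t. g (cis (c t)))" if "continuous_on A c"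
  by (rule continuous_on_compose2[of "sphere 0 1" g A "\<lambda>t. cis (c t)"])
     (use that in \<open>auto intro!: continuous_intros\<close>)

lemma schwarz_integrand_integrable:
  assumes "continuous_on (sphere 0 1) g" "T \<in> sets lebesgue" "T \<subseteq> {0..2*pi}" "norm z < 1"
  shows "(\<lambda>t. of_real (g (cis t)) * ((cis t + z) / (cis t - z))) absolutely_integrable_on T"
  using assms
  by (intro absolutely_integrable_on_continuous_subset[of 0 "2*pi"])
     (auto intro!: continuous_intros continuous_on_circle_comp simp: cis_neq)

text \<open>Differentiation under the integral sign by an exact formula for the second-order
  remainder of \<open>1 / (cis t - w)\<close>, which is bounded uniformly in \<open>t\<close> and
  therefore integrates over any measurable \<open>T\<close>.\<close>

lemma cauchy_transform_holomorphic:
  fixes b :: "real \<Rightarrow> complex"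
  assumes b: "continuous_on {0..2*pi} b" and T: "T \<in> sets lebesgue" "T \<subseteq> {0..2*pi}"
  shows "(\<lambda>z. integral T (\<lambda>t. b t / (cis t - z))) holomorphic_on ball 0 1"
proof (rule holomorphic_onI)
  fix z :: complex assume "z \<in> ball 0 1"
  then have z: "norm z < 1" by simp
  have int: "(\<lambda>t. b t / (cis t - w)) integrable_on T" "(\<lambda>t. b t / (cis t - w)^2) integrable_on T"
    if "norm w < 1" for w
    using b T that
    by (auto intro!: set_lebesgue_integral_eq_integral(1) absolutely_integrable_on_continuous_subset[of 0 "2*pi"]
        continuous_intros simp: cis_neq)
  define D where "D = integral T (\<lambda>t. b t / (cis t - z)^2)"
  obtain B where B: "\<And>t. t \<in> {0..2*pi} \<Longrightarrow> norm (b t) \<le> B"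
    using compact_imp_bounded[OF compact_continuous_image[OF b]] by (auto simp: bounded_iff simp del: atLeastAtMost_iff)
  have B0: "B \<ge> 0" using B[of 0] norm_ge_zero[of "b 0"] by (meson atLeastAtMost_iff order_refl order_trans pi_ge_zero mult_nonneg_nonneg zero_le_numeral)
  \<comment> \<open>Half the distance from \<open>z\<close> to the circle: every \<open>w\<close>
    within \<open>d\<close> of \<open>z\<close> still has distance at least \<open>d\<close> from
    all \<open>cis t\<close>, so the three factors in the denominator of the remainder contribute
    \<open>d^3\<close>.\<close>
  define d where "d = (1 - norm z)/2"
  have d: "d > 0" using z by (simp add: d_def)
  define K where "K = B / d^3 * (2*pi)"
  have est: "norm ((\<lambda>z. integral T (\<lambda>t. b t / (cis t - z))) w - (integral T (\<lambda>t. b t / (cis t - z)) + (w - z) * D)) \<le> K * norm (w - z)^2"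
    if w: "norm (w - z) < d" for w
  proof -
    have nw: "norm w \<le> 1 - d" using w norm_triangle_ineq2[of w z] by (simp add: d_def field_simps)
    have w1: "norm w < 1" using nw d by simp
    have eq: "b t / (cis t - w) - (b t / (cis t - z) + (w - z) * (b t / (cis t - z)^2))
       = b t * (w - z)^2 / ((cis t - w) * (cis t - z)^2)" for t
      using cis_neq[OF z, of t] cis_neq[OF w1, of t]
      by (simp add: divide_simps) (simp add: power2_eq_square algebra_simps)
    have "integral T (\<lambda>t. b t / (cis t - w)) - (integral T (\<lambda>t. b t / (cis t - z)) + (w - z) * D)
       = integral T (\<lambda>t. b t / (cis t - w) - (b t / (cis t - z) + (w - z) * (b t / (cis t - z)^2)))"
      unfolding D_def
      by (subst integral_diff; (subst integral_add)?; (subst integral_mult_right)?)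
         (use int z w1 in \<open>auto intro!: integrable_add integrable_on_mult_right simp del: times_divide_eq_right\<close>)
    also have "norm \<dots> \<le> integral T (\<lambda>t. B / d^3 * norm (w - z)^2)"
    proof (rule integral_norm_bound_integral)
      show "(\<lambda>t. b t / (cis t - w) - (b t / (cis t - z) + (w - z) * (b t / (cis t - z)^2))) integrable_on T"
        using int z w1 by (auto intro!: integrable_diff integrable_add integrable_on_mult_right simp del: times_divide_eq_right)
      show "(\<lambda>t. B / d^3 * norm (w - z)^2) integrable_on T"
        using T by (auto intro!: set_lebesgue_integral_eq_integral(1) absolutely_integrable_on_continuous_subset[of 0 "2*pi"] continuous_intros)
      fix t assume t: "t \<in> T"
      have 1: "d \<le> norm (cis t - w)" "d \<le> norm (cis t - z)"
        using norm_triangle_ineq2[of "cis t" w] norm_triangle_ineq2[of "cis t" z] nw d by (auto simp: d_def field_simps)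
      have 2: "d * d\<^sup>2 \<le> norm (cis t - w) * norm (cis t - z)^2"
        using 1 d by (intro mult_mono power_mono) auto
      have "norm (b t * (w - z)^2 / ((cis t - w) * (cis t - z)^2)) \<le> B * norm (w - z)^2 / (d * d^2)"
        unfolding norm_divide norm_mult norm_power using d B[of t] t T B0
        by (intro frac_le[OF _ _ _ 2] mult_right_mono) auto
      then show "norm (b t / (cis t - w) - (b t / (cis t - z) + (w - z) * (b t / (cis t - z)^2))) \<le> B / d^3 * norm (w - z)^2"
        unfolding eq by (simp add: power3_eq_cube power2_eq_square)
    qed
    also have "\<dots> \<le> integral {0..2*pi} (\<lambda>t. B / d^3 * norm (w - z)^2)"
      using T d B0
      by (intro integral_subset_le) (auto intro!: set_lebesgue_integral_eq_integral(1) absolutely_integrable_on_continuous_subset[of 0 "2*pi"] continuous_intros)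
    also have "\<dots> = K * norm (w - z)^2" by (simp add: K_def)
    finally show ?thesis .
  qed
  have "((\<lambda>z. integral T (\<lambda>t. b t / (cis t - z))) has_field_derivative D) (at z)"
    unfolding DERIV_def
  proof (rule LIM_zero_cancel, rule Lim_null_comparison)
    show "\<forall>\<^sub>F h in at 0. norm ((integral T (\<lambda>t. b t / (cis t - (z + h))) - integral T (\<lambda>t. b t / (cis t - z))) / h - D) \<le> K * norm h"
      unfolding eventually_at
    proof (intro exI[of _ d] conjI ballI impI)
      fix h :: complex assume h: "h \<noteq> 0 \<and> dist h 0 < d"
      have e: "norm (integral T (\<lambda>t. b t / (cis t - (z + h))) - (integral T (\<lambda>t. b t / (cis t - z)) + h * D)) \<le> K * norm h ^ 2"
        using est[of "z + h"] h by simp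
      have "(integral T (\<lambda>t. b t / (cis t - (z + h))) - integral T (\<lambda>t. b t / (cis t - z))) / h - D
         = (integral T (\<lambda>t. b t / (cis t - (z + h))) - (integral T (\<lambda>t. b t / (cis t - z)) + h * D)) / h"
        using h by (simp add: field_simps)
      also have "norm \<dots> \<le> K * norm h ^ 2 / norm h"
        unfolding norm_divide using e by (intro divide_right_mono) auto
      finally show "norm ((integral T (\<lambda>t. b t / (cis t - (z + h))) - integral T (\<lambda>t. b t / (cis t - z))) / h - D) \<le> K * norm h"
        using h by (simp add: power2_eq_square)
    qed (use d in auto)
    show "(\<lambda>h. K * norm h) \<midarrow>0\<rightarrow> 0" by (auto intro!: tendsto_eq_intros)
  qed
  then show "(\<lambda>z. integral T (\<lambda>t. b t / (cis t - z))) field_differentiable at z within ball 0 1"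
    using field_differentiable_def field_differentiable_at_within by blast
qed

text \<open>The Herglotz kernel equals \<open>2 * cis t / (cis t - z) - 1\<close>, so the integral
  is a Cauchy transform minus a constant.\<close>

lemma schwarz_integral_holomorphic:
  assumes "continuous_on (sphere 0 1) g" "T \<in> sets lebesgue" "T \<subseteq> {0..2*pi}"
  shows "schwarz_integral T g holomorphic_on ball 0 1"
proof -
  let ?b = "\<lambda>t. 2 * of_real (g (cis t)) * cis t"
  have cb: "continuous_on {0..2*pi} ?b" using assms(1)
    by (intro continuous_intros continuous_on_circle_comp) auto
  have "schwarz_integral T g z = (integral T (\<lambda>t. ?b t / (cis t - z)) - integral T (\<lambda>t. of_real (g (cis t)))) / (2*pi)"
    if z: "z \<in> ball 0 1" for z
  proof -
    have "(\<lambda>t. ?b t / (cis t - z)) integrable_on T" "(\<lambda>t. of_real (g (cis t)) :: complex) integrable_on T"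
      using assms z cb by (auto intro!: set_lebesgue_integral_eq_integral(1) absolutely_integrable_on_continuous_subset[of 0 "2*pi"]
        continuous_intros continuous_on_circle_comp simp: cis_neq)
    moreover have "of_real (g (cis t)) * ((cis t + z) / (cis t - z)) = ?b t / (cis t - z) - of_real (g (cis t))" for t
      using z cis_neq[of z t] by (simp add: divide_simps) (simp add: algebra_simps)
    ultimately show ?thesis unfolding schwarz_integral_def by (simp only: integral_diff)
  qed
  moreover have "(\<lambda>z. (integral T (\<lambda>t. ?b t / (cis t - z)) - integral T (\<lambda>t. of_real (g (cis t)))) / (2*pi)) holomorphic_on ball 0 1"
    by (intro holomorphic_intros cauchy_transform_holomorphic cb assms) auto
  ultimately show ?thesis by (metis (no_types, lifting) holomorphic_transform)
qed

text \<open>Both \<open>h\<close> and its conjugate can be integrated against the Herglotz kernel: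
  the first by Cauchy's formula, the second by the mean value property of a reflected function.
  Their difference divided by \<open>2 * \<i>\<close> isolates the imaginary part, and only
  \<open>Re (h 0)\<close> survives as a constant.\<close>

theorem herglotz_representation:
  assumes ch: "continuous_on (cball 0 1) h" and hh: "h holomorphic_on ball 0 1" and z: "norm z < 1"
  shows "h z = \<i> * schwarz_integral {0..2*pi} (\<lambda>\<zeta>. Im (h \<zeta>)) z + Re (h 0)"
proof -
  let ?k = "\<lambda>t. (cis t + z) / (cis t - z)"
  have c0: "((\<lambda>t. h (cis t)) has_integral 2 * pi * h 0) {0..2*pi}"
    using circle_cauchy[OF ch hh, of 0] by simp
  have "((\<lambda>t. 2 * (h (cis t) * cis t / (cis t - z)) - h (cis t)) has_integral 2 * (2 * pi * h z) - 2 * pi * h 0) {0..2*pi}"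
    by (intro has_integral_diff has_integral_mult_right circle_cauchy ch hh z c0)
  moreover have "2 * (h (cis t) * cis t / (cis t - z)) - h (cis t) = h (cis t) * ?k t" for t
    using cis_neq[OF z, of t] by (simp add: divide_simps) (simp add: algebra_simps)
  ultimately have 1: "((\<lambda>t. h (cis t) * ?k t) has_integral 2 * (2 * pi * h z) - 2 * pi * h 0) {0..2*pi}"
    by simp
  \<comment> \<open>On the circle \<open>cnj w = 1 / w\<close>, so conjugating the second factor
    gives the Herglotz kernel at \<open>z\<close>. The factor itself is holomorphic in the disc, its
    pole being the reflection of \<open>z\<close> outside, and it equals 1 at the origin.\<close>
  let ?H = "\<lambda>w. h w * (1 + cnj z * w) / (1 - cnj z * w)"
  have nz: "1 - cnj z * w \<noteq> 0" if "norm w \<le> 1" for w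
  proof
    assume "1 - cnj z * w = 0"
    then have "norm (cnj z * w) = 1" by (metis eq_iff_diff_eq_0 norm_one)
    moreover have "norm (cnj z * w) \<le> norm z * 1" unfolding norm_mult using that by (intro mult_mono) auto
    ultimately show False using z by simp
  qed
  have "((\<lambda>t. ?H (cis t) * cis t / (cis t - 0)) has_integral 2 * pi * ?H 0) {0..2*pi}"
    using nz by (intro circle_cauchy) (auto intro!: continuous_intros holomorphic_intros ch hh simp: less_imp_le)
  then have "((\<lambda>t. ?H (cis t)) has_integral 2 * pi * h 0) {0..2*pi}" by simp
  then have "((\<lambda>t. cnj (?H (cis t))) has_integral cnj (2 * pi * h 0)) {0..2*pi}"
    using has_integral_linear[OF _ bounded_linear_cnj] by (force simp: o_def)
  moreover have "cnj (?H (cis t)) = cnj (h (cis t)) * ?k t" for t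
  proof -
    have "cis t * (1 + z * cnj (cis t)) = cis t + z" "cis t * (1 - z * cnj (cis t)) = cis t - z"
      using complex_norm_square[of "cis t"] by (auto simp: algebra_simps)
    then have "?k t = (cis t * (1 + z * cnj (cis t))) / (cis t * (1 - z * cnj (cis t)))" by simp
    also have "\<dots> = (1 + z * cnj (cis t)) / (1 - z * cnj (cis t))"
      by (rule mult_divide_mult_cancel_left) simp
    finally show ?thesis by simp
  qed
  ultimately have 2: "((\<lambda>t. cnj (h (cis t)) * ?k t) has_integral 2 * pi * cnj (h 0)) {0..2*pi}" by simp
  have "((\<lambda>t. (h (cis t) * ?k t - cnj (h (cis t)) * ?k t) / (2*\<i>)) has_integral
      ((2 * (2 * pi * h z) - 2 * pi * h 0) - 2 * pi * cnj (h 0)) / (2*\<i>)) {0..2*pi}"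
    by (intro has_integral_divide has_integral_diff 1 2)
  moreover have "(w * k - cnj w * k) / (2*\<i>) = of_real (Im w) * k" for w k
    by (simp add: left_diff_distrib[symmetric] complex_diff_cnj complex_eq_iff)
  then have "(\<lambda>t. (h (cis t) * ?k t - cnj (h (cis t)) * ?k t) / (2*\<i>)) = (\<lambda>t. of_real (Im (h (cis t))) * ?k t)"
    by presburger
  ultimately have "((\<lambda>t. of_real (Im (h (cis t))) * ?k t) has_integral
      ((2 * (2 * pi * h z) - 2 * pi * h 0) - 2 * pi * cnj (h 0)) / (2*\<i>)) {0..2*pi}" by (simp only:)
  then have "schwarz_integral {0..2*pi} (\<lambda>\<zeta>. Im (h \<zeta>)) z = ((2 * (2 * pi * h z) - 2 * pi * h 0) - 2 * pi * cnj (h 0)) / (2*\<i>) / (2*pi)"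
    unfolding schwarz_integral_def by (simp add: integral_unique)
  also have "\<dots> = (h z - (h 0 + cnj (h 0)) / 2) / \<i>" by (simp add: field_simps)
  also have "h 0 + cnj (h 0) = 2 * Re (h 0)" by (simp add: complex_add_cnj)
  finally show ?thesis by simp
qed

section \<open>Poisson and conjugate Poisson kernels in polar coordinates\<close>

lemma integral_circle_rotate:
  fixes G :: "complex \<Rightarrow> 'a::euclidean_space"
  assumes G: "continuous_on (sphere 0 1) G"
  shows "integral {0..2*pi} (\<lambda>t. G (cis (x + t))) = integral {0..2*pi} (\<lambda>t. G (cis t))"
proof -
  \<comment> \<open>With the representative of the angle in \<open>[0, 2\<pi>)\<close> the shifted
    interval crosses \<open>2 * pi\<close> only once, so a single cut and translation
    suffices.\<close>
  define y where "y = Arg2pi (cis x)"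
  have y: "0 \<le> y" "y \<le> 2*pi" "cis y = cis x"
    using Arg2pi[of "cis x"] Arg2pi_eq[of "cis x"] by (auto simp: y_def cis_conv_exp less_imp_le)
  have xy: "cis (x + t) = cis (y + t)" for t
    using y(3) by (simp flip: cis_mult)
  have per: "cis (t + 2*pi) = cis t" for t by (simp flip: cis_mult)
  have int: "(\<lambda>t. G (cis t)) integrable_on {a..b}" for a b
    using G by (intro integrable_continuous_real continuous_on_circle_comp continuous_intros)
  have "integral {0..2*pi} (\<lambda>t. G (cis (y + t))) = integral {y..y+2*pi} (\<lambda>t. G (cis t))"
    using integral_shift_real_ivl[of y y "y+2*pi" "\<lambda>t. G (cis t)"] by (simp add: add.commute)
  also have "\<dots> = integral {y..2*pi} (\<lambda>t. G (cis t)) + integral {2*pi..y+2*pi} (\<lambda>t. G (cis t))"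
    using y int by (intro Henstock_Kurzweil_Integration.integral_combine[symmetric]) auto
  also have "integral {2*pi..y+2*pi} (\<lambda>t. G (cis t)) = integral {0..y} (\<lambda>t. G (cis (t + 2*pi)))"
    using integral_shift_real_ivl[of "2*pi" "2*pi" "y+2*pi" "\<lambda>t. G (cis t)"] by simp
  also have "\<dots> = integral {0..y} (\<lambda>t. G (cis t))" by (simp only: per)
  also have "integral {y..2*pi} (\<lambda>t. G (cis t)) + integral {0..y} (\<lambda>t. G (cis t)) = integral {0..2*pi} (\<lambda>t. G (cis t))"
    using y int Henstock_Kurzweil_Integration.integral_combine[of 0 y "2*pi" "\<lambda>t. G (cis t)"] by (simp add: add.commute)
  finally show ?thesis by (simp only: xy)
qed

lemma schwarz_integral_rotate:
  assumes g: "continuous_on (sphere 0 1) g" and r: "0 \<le> r" "r < 1"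
  shows "schwarz_integral {0..2*pi} g (of_real r * cis x) =
     integral {0..2*pi} (\<lambda>t. of_real (g (cis (x + t))) * ((cis t + of_real r) / (cis t - of_real r))) / (2*pi)"
proof -
  let ?z = "of_real r * cis x"
  have z: "norm ?z < 1" using r by (simp add: norm_mult)
  have "schwarz_integral {0..2*pi} g ?z = integral {0..2*pi} (\<lambda>t. (\<lambda>w. of_real (g w) * ((w + ?z) / (w - ?z))) (cis t)) / (2*pi)"
    by (simp add: schwarz_integral_def)
  also have "integral {0..2*pi} (\<lambda>t. (\<lambda>w. of_real (g w) * ((w + ?z) / (w - ?z))) (cis t))
     = integral {0..2*pi} (\<lambda>t. (\<lambda>w. of_real (g w) * ((w + ?z) / (w - ?z))) (cis (x + t)))"
    using z by (intro integral_circle_rotate[symmetric] continuous_intros g) auto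
  also have "\<dots> = integral {0..2*pi} (\<lambda>t. of_real (g (cis (x + t))) * ((cis t + of_real r) / (cis t - of_real r)))"
  proof -
    have "(cis (x + t) + ?z) / (cis (x + t) - ?z) = (cis t + of_real r) / (cis t - of_real r)" for t
    proof -
      have "cis (x + t) + ?z = cis x * (cis t + of_real r)" "cis (x + t) - ?z = cis x * (cis t - of_real r)"
        by (auto simp: algebra_simps simp flip: cis_mult)
      then show ?thesis by simp
    qed
    then show ?thesis by simp
  qed
  finally show ?thesis .
qed

definition poisson :: "real \<Rightarrow> real \<Rightarrow> real" where
  "poisson r t = (1 - r\<^sup>2) / (1 - 2 * r * cos t + r\<^sup>2)"

text \<open>Half of the usual conjugate Poisson kernel; with this normalisation it is bounded by
  \<open>1 / s\<close> on \<open>(0, \<pi>]\<close>, the weight in the integral condition.\<close>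

definition conj_poisson :: "real \<Rightarrow> real \<Rightarrow> real" where
  "conj_poisson r t = r * sin t / (1 - 2 * r * cos t + r\<^sup>2)"

text \<open>The half-angle form shows positivity and the two competing scales \<open>1 - r\<close>
  and \<open>t\<close> on which every kernel estimate depends.\<close>

lemma poisson_denom:
  fixes r t :: real
  shows "1 - 2 * r * cos t + r\<^sup>2 = (1 - r)\<^sup>2 + 4 * r * (sin (t/2))\<^sup>2"
proof -
  have "cos t = 1 - 2 * (sin (t/2))\<^sup>2" using cos_double_sin[of "t/2"] by simp
  then show ?thesis by (simp only:) (simp add: power2_eq_square algebra_simps)
qed

lemma poisson_denom_pos: "0 \<le> (r::real) \<Longrightarrow> r < 1 \<Longrightarrow> 0 < 1 - 2 * r * cos t + r\<^sup>2"
  unfolding poisson_denom by (intro add_pos_nonneg) auto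

lemma herglotz_kernel_real:
  assumes "0 \<le> r" "r < 1"
  shows "Re ((cis t + of_real r) / (cis t - of_real r)) = poisson r t"
    and "Im ((cis t + of_real r) / (cis t - of_real r)) = - 2 * conj_poisson r t"
proof -
  have s: "sin t * sin t = 1 - cos t * cos t" using sin_squared_eq[of t] by (simp add: power2_eq_square)
  have 1: "(cos t - r)\<^sup>2 + (sin t)\<^sup>2 = 1 - 2 * r * cos t + r\<^sup>2"
    using sin_squared_eq[of t] by (simp add: power2_eq_square algebra_simps)
  show "Re ((cis t + of_real r) / (cis t - of_real r)) = poisson r t"
    using 1 s by (simp add: Re_divide poisson_def power2_eq_square algebra_simps)
  show "Im ((cis t + of_real r) / (cis t - of_real r)) = - 2 * conj_poisson r t"
    using 1 s by (simp add: Im_divide conj_poisson_def power2_eq_square algebra_simps)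
qed

lemma continuous_on_poisson [continuous_intros]:
  assumes "0 \<le> r" "r < 1"
  shows "continuous_on A (poisson r)" "continuous_on A (conj_poisson r)"
  using poisson_denom_pos[OF assms] unfolding poisson_def conj_poisson_def
  by (auto intro!: continuous_intros simp: less_imp_neq[symmetric])

lemma Re_of_real_mult: "Re (of_real a * w) = a * Re w"
  and Im_of_real_mult: "Im (of_real a * w) = a * Im w"
  by simp_all

lemma schwarz_integral_Re:
  assumes g: "continuous_on (sphere 0 1) g" and r: "0 \<le> r" "r < 1"
  shows "Re (schwarz_integral {0..2*pi} g (of_real r * cis x)) =
     integral {0..2*pi} (\<lambda>t. g (cis (x + t)) * poisson r t) / (2*pi)"
proof -
  let ?f = "\<lambda>t. of_real (g (cis (x + t))) * ((cis t + of_real r) / (cis t - of_real r)) :: complex"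
  have int: "?f integrable_on {0..2*pi}"
    using r cis_neq[of "of_real r"]
    by (intro integrable_continuous_real continuous_intros continuous_on_circle_comp g) auto
  have "Re (integral {0..2*pi} ?f) = integral {0..2*pi} (\<lambda>t. Re (?f t))"
    using integral_linear[OF int bounded_linear_Re] by (simp add: o_def)
  then show ?thesis unfolding schwarz_integral_rotate[OF assms] Re_divide_of_real
    by (simp only: Re_of_real_mult herglotz_kernel_real(1)[OF r])
qed

text \<open>The conjugate kernel is odd and periodic, so the half circle from \<open>pi\<close> to
  \<open>2 * pi\<close> folds back by \<open>s \<mapsto> 2 * pi - s\<close> with a change of sign.
  This is the origin of the symmetric increments.\<close>

lemma schwarz_integral_Im:
  assumes g: "continuous_on (sphere 0 1) g" and r: "0 \<le> r" "r < 1"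
  shows "Im (schwarz_integral {0..2*pi} g (of_real r * cis x)) =
     - integral {0..pi} (\<lambda>s. conj_poisson r s * (g (cis (x + s)) - g (cis (x - s)))) / pi"
proof -
  let ?f = "\<lambda>t. of_real (g (cis (x + t))) * ((cis t + of_real r) / (cis t - of_real r)) :: complex"
  let ?p = "\<lambda>t. conj_poisson r t * g (cis (x + t))"
  have int: "?f integrable_on {0..2*pi}"
    using r cis_neq[of "of_real r"]
    by (intro integrable_continuous_real continuous_intros continuous_on_circle_comp g) auto
  have "Im (integral {0..2*pi} ?f) = integral {0..2*pi} (\<lambda>t. Im (?f t))"
    using integral_linear[OF int bounded_linear_Im] by (simp add: o_def)
  also have "\<dots> = integral {0..2*pi} (\<lambda>t. -2 * ?p t)"
  proof -
    have "Im (?f t) = -2 * ?p t" for t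
      unfolding Im_of_real_mult herglotz_kernel_real(2)[OF r] by simp
    then show ?thesis by presburger
  qed
  also have "\<dots> = -2 * integral {0..2*pi} ?p" by (rule integral_mult_right)
  finally have "Im (schwarz_integral {0..2*pi} g (of_real r * cis x)) = - integral {0..2*pi} ?p / pi"
    unfolding schwarz_integral_rotate[OF assms] Im_divide_of_real by simp
  also have "integral {0..2*pi} ?p = integral {0..pi} ?p + integral {pi..2*pi} ?p"
    by (intro Henstock_Kurzweil_Integration.integral_combine[symmetric] integrable_continuous_real continuous_intros continuous_on_circle_comp g r) auto
  also have "integral {pi..2*pi} ?p = integral {-(2*pi)..-pi} (\<lambda>s. ?p (-s))"
    using Henstock_Kurzweil_Integration.integral_reflect_real[where a=pi and b="2*pi" and f="?p"] by (simp only:)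
  also have "\<dots> = integral {0..pi} (\<lambda>s. ?p (-(s - 2*pi)))"
    using integral_shift_real_ivl[of "-(2*pi)" "-(2*pi)" "-pi" "\<lambda>s. ?p (-s)"] by simp
  also have "\<dots> = integral {0..pi} (\<lambda>s. - (conj_poisson r s * g (cis (x - s))))"
  proof -
    have "cis (x + -(s - 2*pi)) = cis (x - s)" for s
      by (simp add: cis_mult[symmetric] cis_divide[symmetric] diff_conv_add_uminus del: add_uminus_conv_diff)
    moreover have "conj_poisson r (-(s - 2*pi)) = - conj_poisson r s" for s
      by (simp add: conj_poisson_def sin_diff cos_diff)
    ultimately show ?thesis by simp
  qed
  also have "integral {0..pi} ?p + integral {0..pi} (\<lambda>s. - (conj_poisson r s * g (cis (x - s)))) =
     integral {0..pi} (\<lambda>s. ?p s + - (conj_poisson r s * g (cis (x - s))))"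
    by (intro integral_add[symmetric] integrable_continuous_real continuous_intros continuous_on_circle_comp g r)
  finally show ?thesis by (simp add: algebra_simps)
qed

lemma integral_poisson:
  assumes r: "0 \<le> r" "r < 1"
  shows "(poisson r has_integral 2*pi) {0..2*pi}"
proof -
  \<comment> \<open>The total mass is read off from the representation of the constant function
    \<open>\<i>\<close>, whose imaginary part is 1.\<close>
  have "schwarz_integral {0..2*pi} (\<lambda>_. 1) (of_real r * cis 0) = 1"
    using herglotz_representation[of "\<lambda>_. \<i>" "of_real r"] r by simp
  then have "integral {0..2*pi} (poisson r) = 2*pi"
    using schwarz_integral_Re[of "\<lambda>_. 1" r 0] r by (simp add: field_simps)
  moreover have "poisson r integrable_on {0..2*pi}"
    by (intro integrable_continuous_real continuous_intros r)
  ultimately show ?thesis by (simp add: has_integral_iff)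
qed

lemma poisson_nonneg: "0 \<le> r \<Longrightarrow> r < 1 \<Longrightarrow> 0 \<le> poisson r t"
  unfolding poisson_def using poisson_denom_pos[of r t] by (simp add: power_le_one)

section \<open>Perron solutions and conformal maps\<close>

text \<open>The mean value property of \<open>Re F\<close> is an equality, so the sub-mean value
  inequality survives the sum. A member of the Perron family is later compared with a harmonic
  function by applying the maximum principle to such a sum.\<close>

lemma subharmonic_on_add_holomorphic:
  assumes v: "subharmonic_on S v" and F: "F holomorphic_on S" and S: "open S"
  shows "subharmonic_on S (\<lambda>z. v z + Re (F z))"
  unfolding subharmonic_on_def
proof (intro conjI allI impI)
  have cv: "continuous_on S v" using v by (simp add: subharmonic_on_def)
  show "continuous_on S (\<lambda>z. v z + Re (F z))"
    using cv F by (intro continuous_intros holomorphic_on_imp_continuous_on)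
  fix z r assume "0 < r \<and> cball z r \<subseteq> S"
  then have r: "0 < r" "cball z r \<subseteq> S" by auto
  have m: "((\<lambda>t. Re (F (z + of_real r * cis t))) has_integral 2 * pi * Re (F z)) {0..2*pi}"
    using has_integral_linear[OF holomorphic_circle_mean[OF F S r(2,1)] bounded_linear_Re] by (simp add: o_def)
  have "(\<lambda>t. v (z + of_real r * cis t)) integrable_on {0..2*pi}"
    using r by (intro integrable_continuous_real continuous_on_compose2[OF cv] continuous_intros)
      (auto simp: dist_norm norm_mult)
  then have "integral {0..2*pi} (\<lambda>t. v (z + of_real r * cis t) + Re (F (z + of_real r * cis t))) =
    integral {0..2*pi} (\<lambda>t. v (z + of_real r * cis t)) + 2 * pi * Re (F z)"
    using m by (subst integral_add) (auto simp: has_integral_iff)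
  moreover have "v z \<le> 1 / (2*pi) * integral {0..2*pi} (\<lambda>t. v (z + of_real r * cis t))"
    using v r by (simp add: subharmonic_on_def)
  ultimately show "v z + Re (F z) \<le> 1 / (2*pi) * integral {0..2*pi} (\<lambda>t. v (z + of_real r * cis t) + Re (F (z + of_real r * cis t)))"
    by (simp add: field_simps)
qed

lemma subharmonic_on_const: "subharmonic_on S (\<lambda>_. c)"
  by (simp add: subharmonic_on_def)

text \<open>At the rightmost maximum point the sub-mean value inequality forces a maximum further right.\<close>

lemma subharmonic_maximum:
  assumes v: "subharmonic_on S v" and S: "open S" "bounded S"
    and bd: "\<And>\<zeta> e. \<zeta> \<in> frontier S \<Longrightarrow> e > 0 \<Longrightarrow> \<forall>\<^sub>F w in at \<zeta> within S. v w < M + e"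
    and z: "z \<in> S"
  shows "v z \<le> M"
proof (rule ccontr)
  assume "\<not> v z \<le> M"
  then have vz: "v z > M" by simp
  have cv: "continuous_on S v" using v by (simp add: subharmonic_on_def)
  \<comment> \<open>Since \<open>v z > M\<close>, the boundary condition keeps this superlevel set
    away from the frontier, so it is compact and the maximum is attained inside
    \<open>S\<close>.\<close>
  define A where "A = {w \<in> S. v w \<ge> v z}"
  have zA: "z \<in> A" using z by (simp add: A_def)
  have "closed A"
    unfolding closed_sequential_limits
  proof (intro allI impI)
    fix x l assume x: "(\<forall>n. x n \<in> A) \<and> x \<longlonglongrightarrow> l"
    show "l \<in> A"
    proof (cases "l \<in> S")
      case True
      then have "(\<lambda>n. v (x n)) \<longlonglongrightarrow> v l"
        using x cv by (intro continuous_on_tendsto_compose[OF cv]) (auto simp: A_def)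
      then have "v l \<ge> v z"
        using x by (intro LIMSEQ_le_const) (auto simp: A_def)
      then show ?thesis using True by (simp add: A_def)
    next
      case False
      then have fr: "l \<in> frontier S" using x S
        unfolding frontier_def interior_open[OF S(1)]
        by (auto simp: A_def closure_sequential)
      have xl: "filterlim x (at l within S) sequentially"
        using x False by (auto simp: filterlim_at A_def intro!: always_eventually)
      then have "\<forall>\<^sub>F n in sequentially. v (x n) < M + (v z - M)"
        using eventually_compose_filterlim[OF bd[OF fr, of "v z - M"] xl] vz by simp
      then obtain n where "v (x n) < v z" by (auto simp: eventually_sequentially)
      then show ?thesis using x by (auto simp: A_def not_le[symmetric])
    qed
  qed
  moreover have "bounded A" using S bounded_subset by (force simp: A_def)
  ultimately have cA: "compact A" by (simp add: compact_eq_bounded_closed)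
  have "continuous_on A v" using cv continuous_on_subset by (force simp: A_def)
  then obtain m where m: "m \<in> A" "\<And>w. w \<in> A \<Longrightarrow> v w \<le> v m"
    using continuous_attains_sup[OF cA] zA by (metis empty_iff)
  have vm: "v w \<le> v m" if "w \<in> S" for w
    using m that by (cases "w \<in> A") (fastforce simp: A_def)+
  define B where "B = {w \<in> A. v w = v m}"
  have "B = A \<inter> v -` {v m}" by (auto simp: B_def)
  then have "closed B"
    using continuous_closed_preimage[OF \<open>continuous_on A v\<close> \<open>closed A\<close>, of "{v m}"] by simp
  moreover have "A \<inter> B = B" by (auto simp: B_def)
  ultimately have "compact B" using compact_Int_closed[OF cA, of B] by simp
  moreover have "B \<noteq> {}" using m by (auto simp: B_def)
  ultimately obtain b where b: "b \<in> B" "\<And>w. w \<in> B \<Longrightarrow> Re w \<le> Re b"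
    using continuous_attains_sup[of B Re] continuous_on_Re[OF continuous_on_id] by blast
  have bS: "b \<in> S" "v b = v m" using b by (auto simp: B_def A_def)
  then obtain r where r: "r > 0" "cball b r \<subseteq> S" using S open_contains_cball by blast
  let ?f = "\<lambda>t. v m - v (b + of_real r * cis t)"
  have inS: "b + of_real r * cis t \<in> S" for t using r by (auto simp: dist_norm norm_mult subset_iff)
  have ci: "continuous_on {0..2*pi} (\<lambda>t. v (b + of_real r * cis t))"
    using inS by (intro continuous_on_compose2[OF cv] continuous_intros) auto
  have "v m \<le> 1 / (2*pi) * integral {0..2*pi} (\<lambda>t. v (b + of_real r * cis t))"
    using v r bS unfolding subharmonic_on_def by metis
  then have "integral {0..2*pi} ?f \<le> 0"
    using integrable_continuous_real[OF ci]
    by (subst integral_diff) (auto simp: field_simps)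
  moreover have "integral {0..2*pi} ?f \<ge> 0"
    using vm inS by (intro integral_nonneg integrable_continuous_real continuous_intros ci) auto
  ultimately have "integral {0..2*pi} ?f = 0" by simp
  moreover have "?f integrable_on {0..2*pi}" "continuous_on {0..2*pi} ?f" 
    by (intro integrable_continuous_real continuous_intros ci)+
  ultimately have "(?f has_integral 0) (cbox 0 (2*pi))" "continuous_on (cbox 0 (2*pi)) ?f"
    by (auto simp: has_integral_iff)
  then have "?f 0 = 0"
    using has_integral_0_cbox_imp_0[of 0 "2*pi" ?f 0] vm inS pi_gt_zero by (simp add: box_real)
  then have "b + of_real r \<in> B" using inS[of 0] m bS by (auto simp: B_def A_def)
  then show False using b(2) r by force
qed

lemma eventually_Limsup_ereal_less:
  fixes f :: "'a \<Rightarrow> real"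
  assumes "Limsup F (\<lambda>w. ereal (f w)) \<le> ereal c" "e > 0"
  shows "\<forall>\<^sub>F w in F. f w < c + e"
  using Limsup_lessD[of F "\<lambda>w. ereal (f w)" "ereal (c + e)"] assms
  by (auto simp: le_less_trans)

text \<open>The lower functions belong to the Perron family themselves. The upper ones approximate
  the harmonic measure of the complement, and the maximum principle gives
  \<open>v + Re F \<le> 1\<close> for every competitor \<open>v\<close>. Convergence to 0 is
  demanded only off \<open>E\<close>, respectively only on \<open>E\<close>, because elsewhere the
  bound by 1 suffices; the slack \<open>e\<close> leaves room for replacing \<open>E\<close> by
  compact subsets.\<close>

lemma harmonic_measure_eqI:
  assumes S: "open S" "bounded S" and z: "z \<in> S"
    and lower: "\<And>e. e > 0 \<Longrightarrow> \<exists>F. F holomorphic_on S \<and> (\<forall>w\<in>S. 0 \<le> Re (F w) \<and> Re (F w) \<le> 1) \<and>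
        (\<forall>\<zeta>\<in>frontier S - E. ((\<lambda>w. Re (F w)) \<longlongrightarrow> 0) (at \<zeta> within S)) \<and> c - e \<le> Re (F z)"
    and upper: "\<And>e. e > 0 \<Longrightarrow> \<exists>F. F holomorphic_on S \<and> (\<forall>w\<in>S. 0 \<le> Re (F w) \<and> Re (F w) \<le> 1) \<and>
        (\<forall>\<zeta>\<in>frontier S \<inter> E. ((\<lambda>w. Re (F w)) \<longlongrightarrow> 0) (at \<zeta> within S)) \<and> 1 - c - e \<le> Re (F z)"
  shows "harmonic_measure z E S = c"
proof -
  let ?P = "perron_family S (indicator E)"
  have le: "v z \<le> c" if v: "v \<in> ?P" for v
  proof (rule field_le_epsilon)
    fix e :: real assume "e > 0"
    from upper[OF this] obtain F where F: "F holomorphic_on S" "\<And>w. w \<in> S \<Longrightarrow> Re (F w) \<le> 1"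
      "\<And>\<zeta>. \<zeta> \<in> frontier S \<Longrightarrow> \<zeta> \<in> E \<Longrightarrow> ((\<lambda>w. Re (F w)) \<longlongrightarrow> 0) (at \<zeta> within S)" "1 - c - e \<le> Re (F z)"
      by blast
    have sv: "subharmonic_on S v" and bv: "\<And>\<zeta>. \<zeta> \<in> frontier S \<Longrightarrow> Limsup (at \<zeta> within S) (\<lambda>w. ereal (v w)) \<le> ereal (indicator E \<zeta>)"
      using v by (auto simp: perron_family_def)
    have "v z + Re (F z) \<le> 1"
    proof (rule subharmonic_maximum[OF subharmonic_on_add_holomorphic[OF sv F(1) S(1)] S _ z])
      fix \<zeta> and e :: real assume fr: "\<zeta> \<in> frontier S" and e: "e > 0"
      have inS: "\<forall>\<^sub>F w in at \<zeta> within S. w \<in> S" by (simp add: eventually_at_filter)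
      show "\<forall>\<^sub>F w in at \<zeta> within S. v w + Re (F w) < 1 + e"
      proof (cases "\<zeta> \<in> E")
        case True
        have "\<forall>\<^sub>F w in at \<zeta> within S. Re (F w) < e/2"
          using F(3)[OF fr True] e by (intro order_tendstoD) auto
        moreover have "\<forall>\<^sub>F w in at \<zeta> within S. v w < 1 + e/2"
          using bv[OF fr] True e by (intro eventually_Limsup_ereal_less) auto
        ultimately show ?thesis by eventually_elim auto
      next
        case False
        have "\<forall>\<^sub>F w in at \<zeta> within S. v w < 0 + e"
          using bv[OF fr] False e by (intro eventually_Limsup_ereal_less) auto
        then show ?thesis using inS by eventually_elim (use F(2) in fastforce)
      qed
    qed
    then show "v z \<le> c + e" using F(4) by simp
  qed
  have ge: "\<exists>v\<in>?P. c - e \<le> v z" if e: "e > 0" for e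
  proof -
    from lower[OF e] obtain F where F: "F holomorphic_on S" "\<And>w. w \<in> S \<Longrightarrow> Re (F w) \<le> 1"
      "\<And>\<zeta>. \<zeta> \<in> frontier S \<Longrightarrow> \<zeta> \<notin> E \<Longrightarrow> ((\<lambda>w. Re (F w)) \<longlongrightarrow> 0) (at \<zeta> within S)" "c - e \<le> Re (F z)"
      by blast
    have "Limsup (at \<zeta> within S) (\<lambda>w. ereal (Re (F w))) \<le> ereal (indicator E \<zeta>)" if fr: "\<zeta> \<in> frontier S" for \<zeta>
    proof (cases "\<zeta> \<in> E")
      case True
      have "\<forall>\<^sub>F w in at \<zeta> within S. w \<in> S" by (simp add: eventually_at_filter)
      then have "\<forall>\<^sub>F w in at \<zeta> within S. ereal (Re (F w)) \<le> 1"
        by eventually_elim (use F(2) in auto)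
      then show ?thesis using True by (intro Limsup_bounded) (simp add: one_ereal_def)
    next
      case False
      have "\<not> trivial_limit (at \<zeta> within S)"
        using fr S(1) by (auto simp: trivial_limit_within frontier_def interior_open closure_def)
      moreover have "((\<lambda>w. ereal (Re (F w))) \<longlongrightarrow> ereal 0) (at \<zeta> within S)"
        using F(3)[OF fr False] by simp
      ultimately have "Limsup (at \<zeta> within S) (\<lambda>w. ereal (Re (F w))) = ereal 0"
        by (rule lim_imp_Limsup)
      then show ?thesis using False by simp
    qed
    moreover have "subharmonic_on S (\<lambda>w. Re (F w))"
      using subharmonic_on_add_holomorphic[OF subharmonic_on_const F(1) S(1), of 0] by simp
    ultimately show ?thesis using F(4) by (intro bexI[of _ "\<lambda>w. Re (F w)"]) (auto simp: perron_family_def)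
  qed
  have ne: "?P \<noteq> {}" using ge[of 1] by auto
  have bdd: "bdd_above ((\<lambda>v. v z) ` ?P)" using le by (auto simp: bdd_above_def)
  have "(SUP v\<in>?P. v z) \<le> c" using ne le by (rule cSUP_least)
  moreover have "c \<le> (SUP v\<in>?P. v z)"
  proof (rule field_le_epsilon)
    fix e :: real assume "e > 0"
    then obtain v where "v \<in> ?P" "c - e \<le> v z" using ge by blast
    then show "c \<le> (SUP v\<in>?P. v z) + e" using cSUP_upper[OF _ bdd, of v] by fastforce
  qed
  ultimately show ?thesis by (simp add: harmonic_measure_def dirichlet_solution_def)
qed

section \<open>Harmonic measure as the length of a boundary preimage\<close>

lemma poisson_kernel_Re:
  assumes "norm z < 1"
  shows "Re ((cis t + z) / (cis t - z)) = (1 - (norm z)\<^sup>2) / (norm (cis t - z))\<^sup>2"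
proof -
  have "Re ((cis t + z) / (cis t - z)) = Re ((cis t + z) * cnj (cis t - z)) / (norm (cis t - z))\<^sup>2"
    by (subst complex_div_cnj) (simp add: Re_divide_of_real flip: of_real_power)
  also have "Re ((cis t + z) * cnj (cis t - z)) = (cos t)\<^sup>2 + (sin t)\<^sup>2 - (norm z)\<^sup>2"
    by (simp add: cmod_power2) (simp add: power2_eq_square algebra_simps)
  finally show ?thesis by simp
qed

lemma schwarz_integral_one:
  assumes T: "T \<in> sets lebesgue" "T \<subseteq> {0..2*pi}" and z: "norm z < 1"
  defines "p \<equiv> \<lambda>t. (1 - (norm z)\<^sup>2) / (norm (cis t - z))\<^sup>2"
  shows "p integrable_on T" "Re (schwarz_integral T (\<lambda>_. 1) z) = integral T p / (2*pi)"
    "0 \<le> Re (schwarz_integral T (\<lambda>_. 1) z)" "Re (schwarz_integral T (\<lambda>_. 1) z) \<le> 1"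
proof -
  let ?k = "\<lambda>t. (cis t + z) / (cis t - z)"
  have p: "p t = Re (?k t)" for t using poisson_kernel_Re[OF z] by (simp add: p_def)
  have pf: "p = (\<lambda>t. Re (?k t))" using p by blast
  have z2: "(norm z)\<^sup>2 \<le> 1" using z by (simp add: power_le_one)
  have main: "p integrable_on U \<and> Re (schwarz_integral U (\<lambda>_. 1) z) = integral U p / (2*pi)"
    if "U \<in> sets lebesgue" "U \<subseteq> {0..2*pi}" for U
  proof -
    have "?k integrable_on U"
      using schwarz_integrand_integrable[of "\<lambda>_. 1" U z] that z set_lebesgue_integral_eq_integral(1) by fastforce
    from integrable_linear[OF this bounded_linear_Re] integral_linear[OF this bounded_linear_Re]
    show ?thesis by (simp add: pf schwarz_integral_def o_def Re_divide_of_real[of _ "2*pi", simplified])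
  qed
  show "p integrable_on T" and eq: "Re (schwarz_integral T (\<lambda>_. 1) z) = integral T p / (2*pi)"
    using main T by auto
  have p0: "0 \<le> p t" for t using z2 by (simp add: p_def)
  show "0 \<le> Re (schwarz_integral T (\<lambda>_. 1) z)"
    unfolding eq using p0 main[OF T] by (auto intro!: divide_nonneg_pos integral_nonneg)
  have "schwarz_integral {0..2*pi} (\<lambda>_. 1) z = 1"
    using herglotz_representation[of "\<lambda>_. \<i>" z] z by simp
  then have "integral {0..2*pi} p = 2*pi" using main[of "{0..2*pi}"] by (simp add: field_simps)
  moreover have "integral T p \<le> integral {0..2*pi} p"
    using main p0 T by (intro integral_subset_le) auto
  ultimately show "Re (schwarz_integral T (\<lambda>_. 1) z) \<le> 1"
    unfolding eq by (simp add: field_simps)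
qed

lemma schwarz_integral_0:
  assumes T: "T \<in> sets lebesgue" "T \<subseteq> {0..2*pi}"
  shows "Re (schwarz_integral T (\<lambda>_. 1) 0) = measure lebesgue T / (2*pi)"
proof -
  have "T \<in> lmeasurable" using T bounded_set_imp_lmeasurable bounded_closed_interval bounded_subset by blast
  then show ?thesis using schwarz_integral_one(2)[OF T, of 0] by (simp add: lmeasure_integral)
qed

text \<open>Properness: the image of a smaller closed disc is a compact subset of \<open>S\<close>
  and hence misses a neighbourhood of the frontier point.\<close>

lemma conformal_inverse_boundary:
  fixes f \<phi> :: "complex \<Rightarrow> complex"
  assumes f: "continuous_on (ball 0 1) f"
    and f\<phi>: "\<And>z. norm z < 1 \<Longrightarrow> f z \<in> S" "\<And>w. w \<in> S \<Longrightarrow> norm (\<phi> w) < 1 \<and> f (\<phi> w) = w"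
    and S: "open S" and \<zeta>: "\<zeta> \<in> frontier S"
  shows "((\<lambda>w. norm (\<phi> w)) \<longlongrightarrow> 1) (at \<zeta> within S)"
proof (rule order_tendstoI)
  have ev: "\<forall>\<^sub>F w in at \<zeta> within S. w \<in> S" by (simp add: eventually_at_filter)
  show "\<forall>\<^sub>F w in at \<zeta> within S. norm (\<phi> w) < a" if "1 < a" for a
    using ev by eventually_elim (use f\<phi>(2) that in force)
  show "\<forall>\<^sub>F w in at \<zeta> within S. a < norm (\<phi> w)" if a: "a < 1" for a
  proof -
    have "cball 0 a \<subseteq> ball (0::complex) 1" using a by auto
    then have "compact (f ` cball 0 a)"
      using f continuous_on_subset by (intro compact_continuous_image) auto
    then have "open (- (f ` cball 0 a))" using compact_imp_closed by blast
    moreover have "\<zeta> \<notin> S" using \<zeta> S by (simp add: frontier_def interior_open)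
    then have "\<zeta> \<in> - (f ` cball 0 a)" using f\<phi>(1) a by auto
    ultimately have "\<forall>\<^sub>F w in nhds \<zeta>. w \<in> - (f ` cball 0 a)" by (rule eventually_nhds_in_open)
    then have "\<forall>\<^sub>F w in at \<zeta> within S. w \<in> - (f ` cball 0 a)"
      by (auto simp: eventually_at_filter elim: eventually_mono)
    then show ?thesis using ev
      by eventually_elim (use f\<phi>(2) in \<open>force simp: not_less[symmetric]\<close>)
  qed
qed

lemma closed_boundary_preimage:
  fixes f :: "complex \<Rightarrow> 'a::t2_space"
  assumes "continuous_on (cball 0 1) f" "closed K"
  shows "closed {t \<in> {a..b}. f (cis t) \<in> K}"
proof -
  have "continuous_on {a..b} (\<lambda>t. f (cis t))"
    by (intro continuous_on_compose2[OF assms(1)] continuous_intros) auto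
  then have "closed ({a..b} \<inter> (\<lambda>t. f (cis t)) -` K)"
    by (rule continuous_closed_preimage[OF _ _ assms(2)]) simp
  moreover have "{a..b} \<inter> (\<lambda>t. f (cis t)) -` K = {t \<in> {a..b}. f (cis t) \<in> K}" by blast
  ultimately show ?thesis by metis
qed

text \<open>The point \<open>\<phi> w\<close> need not converge as \<open>w\<close> approaches
  \<zeta>. It is enough that uniform continuity of \<open>f\<close> keeps it at distance at least
  \<open>\<eta>\<close> from every boundary point mapped into \<open>K\<close>, while its modulus
  tends to 1; the Poisson kernel then tends to 0 uniformly on \<open>T\<close>.\<close>

lemma poisson_boundary_layer:
  fixes f \<phi> :: "complex \<Rightarrow> complex"
  assumes f: "continuous_on (cball 0 1) f"
    and f\<phi>: "\<And>z. norm z < 1 \<Longrightarrow> f z \<in> S" "\<And>w. w \<in> S \<Longrightarrow> norm (\<phi> w) < 1 \<and> f (\<phi> w) = w"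
    and S: "open S" and K: "closed K" and \<zeta>: "\<zeta> \<in> frontier S" "\<zeta> \<notin> K"
  defines "T \<equiv> {t \<in> {0..2*pi}. f (cis t) \<in> K}"
  shows "T \<in> sets lebesgue"
    and "((\<lambda>w. Re (schwarz_integral T (\<lambda>_. 1) (\<phi> w))) \<longlongrightarrow> 0) (at \<zeta> within S)"
proof -
  have "closed T" unfolding T_def by (rule closed_boundary_preimage[OF f K])
  then show T: "T \<in> sets lebesgue" by auto
  have T2: "T \<subseteq> {0..2*pi}" by (auto simp: T_def)
  obtain d where d: "d > 0" "ball \<zeta> d \<subseteq> - K"
    using K \<zeta>(2) open_contains_ball[of "- K"] by auto
  have uc: "uniformly_continuous_on (cball 0 1) f" by (rule compact_uniformly_continuous[OF f compact_cball])
  then obtain \<eta> where \<eta>: "\<eta> > 0" "\<And>x y. x \<in> cball 0 1 \<Longrightarrow> y \<in> cball 0 1 \<Longrightarrow> dist y x < \<eta> \<Longrightarrow> dist (f y) (f x) < d/2"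
    using uniformly_continuous_onE[OF uc half_gt_zero[OF d(1)]] by blast
  have ev: "\<forall>\<^sub>F w in at \<zeta> within S. w \<in> S \<and> dist w \<zeta> < d/2"
    using d by (auto simp: eventually_at intro!: exI[of _ "d/2"])
  have lim: "((\<lambda>w. (1 - (norm (\<phi> w))\<^sup>2) / \<eta>\<^sup>2) \<longlongrightarrow> (1 - 1\<^sup>2) / \<eta>\<^sup>2) (at \<zeta> within S)"
    using \<eta>(1) continuous_on_subset[OF f, of "ball 0 1"] f\<phi> S \<zeta>
    by (intro tendsto_intros conformal_inverse_boundary[of f]) auto
  show "((\<lambda>w. Re (schwarz_integral T (\<lambda>_. 1) (\<phi> w))) \<longlongrightarrow> 0) (at \<zeta> within S)"
  proof (rule real_tendsto_sandwich[OF _ _ tendsto_const])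
    show "((\<lambda>w. (1 - (norm (\<phi> w))\<^sup>2) / \<eta>\<^sup>2) \<longlongrightarrow> 0) (at \<zeta> within S)" using lim by simp
    show "\<forall>\<^sub>F w in at \<zeta> within S. 0 \<le> Re (schwarz_integral T (\<lambda>_. 1) (\<phi> w))"
      using ev by eventually_elim (use schwarz_integral_one(3)[OF T T2] f\<phi>(2) in auto)
    show "\<forall>\<^sub>F w in at \<zeta> within S. Re (schwarz_integral T (\<lambda>_. 1) (\<phi> w)) \<le> (1 - (norm (\<phi> w))\<^sup>2) / \<eta>\<^sup>2"
      using ev
    proof eventually_elim
      case (elim w)
      let ?z = "\<phi> w"
      have z: "norm ?z < 1" "f ?z = w" using f\<phi>(2) elim by auto
      have z2: "(norm ?z)\<^sup>2 \<le> 1" using z by (simp add: power_le_one)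
      have int: "(\<lambda>t. (1 - (norm ?z)\<^sup>2) / \<eta>\<^sup>2) integrable_on U" if "U \<in> sets lebesgue" "U \<subseteq> {0..2*pi}" for U
        using that by (auto intro!: set_lebesgue_integral_eq_integral(1) absolutely_integrable_on_continuous_subset[of 0 "2*pi"] continuous_intros)
      have "integral T (\<lambda>t. (1 - (norm ?z)\<^sup>2) / (norm (cis t - ?z))\<^sup>2) \<le> integral T (\<lambda>t. (1 - (norm ?z)\<^sup>2) / \<eta>\<^sup>2)"
      proof (rule integral_le)
        fix t assume "t \<in> T"
        then have "f (cis t) \<in> K" by (simp add: T_def)
        then have "dist \<zeta> (f (cis t)) \<ge> d" using d by (auto simp: subset_iff not_less[symmetric])
        then have "dist (f (cis t)) (f ?z) \<ge> d/2"
          using elim z dist_triangle[of \<zeta> "f (cis t)" w] by (simp add: dist_commute)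
        then have "\<not> dist (cis t) ?z < \<eta>" using \<eta>(2)[of ?z "cis t"] z by auto
        then have "\<eta> \<le> norm (cis t - ?z)" by (simp add: dist_norm)
        then show "(1 - (norm ?z)\<^sup>2) / (norm (cis t - ?z))\<^sup>2 \<le> (1 - (norm ?z)\<^sup>2) / \<eta>\<^sup>2"
          using z2 \<eta>(1) by (intro divide_left_mono power_mono mult_pos_pos) auto
      qed (use schwarz_integral_one(1)[OF T T2 z(1)] int[OF T T2] in auto)
      also have "\<dots> \<le> integral {0..2*pi} (\<lambda>t. (1 - (norm ?z)\<^sup>2) / \<eta>\<^sup>2)"
        using int[OF T T2] T2 z2 by (intro integral_subset_le) auto
      also have "\<dots> = 2 * pi * ((1 - (norm ?z)\<^sup>2) / \<eta>\<^sup>2)" by simp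
      finally show ?case unfolding schwarz_integral_one(2)[OF T T2 z(1)] by (simp add: field_simps)
    qed
  qed
qed

text \<open>Compact subsets of the boundary suffice by inner regularity, and the Poisson integral of their indicator is
  upper semicontinuous up to the boundary.\<close>

theorem harmonic_measure_conformal:
  fixes f \<phi> :: "complex \<Rightarrow> complex"
  assumes f: "continuous_on (cball 0 1) f"
    and f\<phi>: "\<And>z. norm z < 1 \<Longrightarrow> f z \<in> S" "\<And>w. w \<in> S \<Longrightarrow> norm (\<phi> w) < 1 \<and> f (\<phi> w) = w"
    and \<phi>: "\<phi> holomorphic_on S" and \<phi>0: "\<phi> (f 0) = 0"
    and S: "open S" "bounded S"
    and E: "{t \<in> {0..2*pi}. f (cis t) \<in> E} \<in> sets lebesgue"
  shows "harmonic_measure (f 0) E S = measure lebesgue {t \<in> {0..2*pi}. f (cis t) \<in> E} / (2*pi)"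
proof -
  define T where "T E = {t \<in> {0..2*pi}. f (cis t) \<in> E}" for E
  have lm: "U \<in> lmeasurable" if "U \<in> sets lebesgue" "U \<subseteq> {0..2*pi}" for U
    using that bounded_set_imp_lmeasurable bounded_closed_interval bounded_subset by blast
  have main: "\<exists>F. F holomorphic_on S \<and> (\<forall>w\<in>S. 0 \<le> Re (F w) \<and> Re (F w) \<le> 1) \<and>
        (\<forall>\<zeta>\<in>frontier S - E. ((\<lambda>w. Re (F w)) \<longlongrightarrow> 0) (at \<zeta> within S)) \<and>
        measure lebesgue (T E) / (2*pi) - e \<le> Re (F (f 0))"
    if ET: "T E \<in> sets lebesgue" and e: "e > 0" for E and e :: real
  proof -
    \<comment> \<open>Inner regularity is applied on the parameter side and the compact set is then
      pushed forward to \<open>K\<close>. As \<open>f\<close> need not be injective on the circle,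
      \<open>T K\<close> may be larger than \<open>L\<close>, but \<open>K\<close> stays inside
      \<open>E\<close>.\<close>
    obtain L where L: "closed L" "L \<subseteq> T E" "T E - L \<in> lmeasurable" "emeasure lebesgue (T E - L) < ennreal e"
      using sets_lebesgue_inner_closed[OF ET e] by blast
    have L2: "L \<subseteq> {0..2*pi}" using L(2) by (auto simp: T_def)
    have cf: "continuous_on L (\<lambda>t. f (cis t))"
      by (intro continuous_on_compose2[OF f] continuous_intros) auto
    define K where "K = (\<lambda>t. f (cis t)) ` L"
    have "compact L" using L(1) L2 by (meson bounded_closed_interval bounded_subset compact_eq_bounded_closed)
    then have "closed K" unfolding K_def using cf compact_continuous_image compact_imp_closed by blast
    have KE: "K \<subseteq> E" using L(2) by (auto simp: K_def T_def)
    have LT: "L \<subseteq> T K" using L2 by (auto simp: T_def K_def)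
    have "closed (T K)" unfolding T_def by (rule closed_boundary_preimage[OF f \<open>closed K\<close>])
    then have TK: "T K \<in> sets lebesgue" by auto
    have TK2: "T K \<subseteq> {0..2*pi}" by (auto simp: T_def)
    let ?F = "\<lambda>w. schwarz_integral (T K) (\<lambda>_. 1) (\<phi> w)"
    have "?F holomorphic_on S"
    proof -
      have "\<phi> ` S \<subseteq> ball 0 1" using f\<phi>(2) by auto
      then show ?thesis
        using holomorphic_on_compose_gen[OF \<phi> schwarz_integral_holomorphic[OF continuous_on_const TK TK2], of 1]
        by (simp add: o_def)
    qed
    moreover have "\<forall>w\<in>S. 0 \<le> Re (?F w) \<and> Re (?F w) \<le> 1"
      using schwarz_integral_one(3,4)[OF TK TK2] f\<phi>(2) by blast
    moreover have "((\<lambda>w. Re (?F w)) \<longlongrightarrow> 0) (at \<zeta> within S)" if "\<zeta> \<in> frontier S - E" for \<zeta>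
      using poisson_boundary_layer(2)[OF f f\<phi> S(1) \<open>closed K\<close>, of \<zeta>] that KE unfolding T_def by blast
    moreover have "measure lebesgue (T E) / (2*pi) - e \<le> Re (?F (f 0))"
    proof -
      have "T E \<in> lmeasurable" by (rule lm[OF ET]) (auto simp: T_def)
      then have "measure lebesgue (T E - L) = measure lebesgue (T E) - measure lebesgue L"
        using L by (intro measurable_measure_Diff) auto
      moreover have "measure lebesgue (T E - L) \<le> e"
        using L(3,4) e by (simp add: emeasure_eq_measure2 ennreal_less_iff less_imp_le)
      moreover have "measure lebesgue L \<le> measure lebesgue (T K)"
        using L LT lm[OF TK TK2] by (intro measure_mono_fmeasurable) auto
      ultimately have "measure lebesgue (T E) - e \<le> measure lebesgue (T K)" by linarith
      then have "(measure lebesgue (T E) - e) / (2*pi) \<le> Re (?F (f 0))"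
        unfolding \<phi>0 schwarz_integral_0[OF TK TK2] by (intro divide_right_mono) auto
      moreover have "e / (2*pi) \<le> e" using e pi_gt3 by (simp add: field_simps) 
      ultimately show ?thesis by (simp add: diff_divide_distrib)
    qed
    ultimately show ?thesis by (intro exI[of _ ?F]) blast
  qed
  have E1: "T E \<in> sets lebesgue" using E by (simp add: T_def)
  \<comment> \<open>The upper half of the criterion is the lower construction for the complement of
    \<open>E\<close>, because the two parameter sets partition the interval.\<close>
  have c: "T (-E) = {0..2*pi} - T E" by (auto simp: T_def)
  then have E2: "T (-E) \<in> sets lebesgue" using E1 by auto
  have "T E \<in> lmeasurable" by (rule lm[OF E1]) (auto simp: T_def)
  then have mc: "measure lebesgue (T (-E)) = 2*pi - measure lebesgue (T E)"
    unfolding c by (subst measurable_measure_Diff) (auto simp: T_def)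
  have "harmonic_measure (f 0) E S = measure lebesgue (T E) / (2*pi)"
  proof (rule harmonic_measure_eqI[OF S])
    show "f 0 \<in> S" using f\<phi>(1) by simp
    fix e :: real assume e: "e > 0"
    show "\<exists>F. F holomorphic_on S \<and> (\<forall>w\<in>S. 0 \<le> Re (F w) \<and> Re (F w) \<le> 1) \<and>
        (\<forall>\<zeta>\<in>frontier S - E. ((\<lambda>w. Re (F w)) \<longlongrightarrow> 0) (at \<zeta> within S)) \<and>
        measure lebesgue (T E) / (2*pi) - e \<le> Re (F (f 0))" by (rule main[OF E1 e])
    have "measure lebesgue (T (-E)) / (2*pi) = 1 - measure lebesgue (T E) / (2*pi)"
      unfolding mc by (simp add: field_simps)
    then show "\<exists>F. F holomorphic_on S \<and> (\<forall>w\<in>S. 0 \<le> Re (F w) \<and> Re (F w) \<le> 1) \<and>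
        (\<forall>\<zeta>\<in>frontier S \<inter> E. ((\<lambda>w. Re (F w)) \<longlongrightarrow> 0) (at \<zeta> within S)) \<and>
        1 - measure lebesgue (T E) / (2*pi) - e \<le> Re (F (f 0))"
      using main[OF E2 e] by (simp add: Diff_eq)
  qed
  then show ?thesis by (simp add: T_def)
qed

section \<open>Conjugate Poisson kernels and boundary extension\<close>

lemma jordan_sin_ge:
  fixes x :: real
  assumes "0 \<le> x" "x \<le> pi/2"
  shows "2 * x / pi \<le> sin x"
proof -
  have c: "concave_on {0..pi/2} sin"
  proof (rule f''_le0_imp_concave)
    show "(sin has_real_derivative cos x) (at x)" for x :: real by (rule DERIV_sin)
    show "(cos has_real_derivative - sin x) (at x)" for x :: real by (rule DERIV_cos)
    show "- sin x \<le> 0" if "x \<in> {0..pi/2}" for x :: real using that by (simp add: sin_ge_zero)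
  qed simp
  have "(1 - 2*x/pi) * sin 0 + (2*x/pi) * sin (pi/2) \<le> sin ((1 - 2*x/pi) *\<^sub>R 0 + (2*x/pi) *\<^sub>R (pi/2))"
    using assms by (intro concave_onD[OF c]) (auto simp: field_simps)
  then show ?thesis by simp
qed

lemma mult_cos_le_sin:
  fixes x :: real
  assumes "0 \<le> x" "x \<le> pi/2"
  shows "x * cos x \<le> sin x"
proof (cases "x = pi/2")
  case True
  then show ?thesis unfolding True by simp
next
  case False
  then have x: "x < pi/2" using assms by simp
  have "x \<le> tan x" using abs_tan_ge[of x] assms x tan_gt_zero[of x] by (cases "x = 0") auto
  moreover have "cos x > 0" using assms x by (intro cos_gt_zero_pi) auto
  ultimately show ?thesis by (simp add: tan_def field_simps)
qed

text \<open>The bound \<open>1/2 \<le> r\<close> keeps the coefficient \<open>4 * r\<close> of the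
  half-angle form at least 2; the rest is Jordan's inequality at \<open>s/2\<close>.\<close>

lemma poisson_denom_ge:
  fixes r s :: real
  assumes "1/2 \<le> r" "r < 1" "0 \<le> s" "s \<le> pi"
  shows "2 * s\<^sup>2 / pi\<^sup>2 \<le> 1 - 2 * r * cos s + r\<^sup>2"
proof -
  have "2 * (s/2) / pi \<le> sin (s/2)" using assms by (intro jordan_sin_ge) auto
  then have "(s / pi)\<^sup>2 \<le> (sin (s/2))\<^sup>2" using assms by (intro power_mono) auto
  then have "2 * (s/pi)\<^sup>2 \<le> 4 * r * (sin (s/2))\<^sup>2" using assms by (intro mult_mono) auto
  also have "\<dots> \<le> 1 - 2 * r * cos s + r\<^sup>2" unfolding poisson_denom by simp
  finally show ?thesis by (simp add: power_divide)
qed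

lemma poisson_denom_le:
  fixes r s :: real
  assumes "0 \<le> r" "r \<le> 1" "0 \<le> s"
  shows "1 - 2 * r * cos s + r\<^sup>2 \<le> (1 - r)\<^sup>2 + s\<^sup>2"
proof -
  have "(sin (s/2))\<^sup>2 \<le> (s/2)\<^sup>2"
    using abs_sin_x_le_abs_x[of "s/2"] by (simp only: abs_le_square_iff)
  then have "r * (4 * (sin (s/2))\<^sup>2) \<le> 1 * s\<^sup>2"
    using assms by (intro mult_mono) (auto simp: power_divide)
  then show ?thesis unfolding poisson_denom by simp
qed

lemma conj_poisson_nonneg: "0 \<le> r \<Longrightarrow> r < 1 \<Longrightarrow> 0 \<le> s \<Longrightarrow> s \<le> pi \<Longrightarrow> 0 \<le> conj_poisson r s"
  unfolding conj_poisson_def using poisson_denom_pos[of r s] by (simp add: sin_ge_zero)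

lemma conj_poisson_le:
  assumes r: "0 \<le> r" "r < 1" and s: "0 < s" "s \<le> pi"
  shows "conj_poisson r s \<le> 1 / s"
proof -
  have "(s/2) * cos (s/2) \<le> sin (s/2)" "0 \<le> sin (s/2)" using mult_cos_le_sin[of "s/2"] sin_ge_zero[of "s/2"] s by auto
  then have "4 * r * sin (s/2) * ((s/2) * cos (s/2)) \<le> 4 * r * sin (s/2) * sin (s/2)"
    using r by (intro mult_left_mono) auto
  then have "s * (r * sin s) \<le> 4 * r * (sin (s/2))\<^sup>2"
    using sin_double[of "s/2"] by (simp add: power2_eq_square mult_ac)
  also have "\<dots> \<le> 1 - 2 * r * cos s + r\<^sup>2" unfolding poisson_denom by simp
  finally show ?thesis unfolding conj_poisson_def using s poisson_denom_pos[OF r, of s] by (simp add: field_simps)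
qed

lemma conj_poisson_mono:
  assumes r: "0 \<le> r" "r \<le> r'" "r' < 1" and s: "0 \<le> s" "s \<le> pi"
  shows "conj_poisson r s \<le> conj_poisson r' s"
proof -
  \<comment> \<open>This product is the cross-multiplied form of the fact that
    \<open>r + 1/r\<close> decreases on \<open>(0, 1)\<close>; for positive \<open>r\<close> the
    kernel is \<open>sin s / (r + 1/r - 2 * cos s)\<close>.\<close>
  have "0 \<le> (r' - r) * (1 - r * r')" using r mult_mono[of r 1 r' 1] by (intro mult_nonneg_nonneg) auto
  then have "r * (1 - 2 * r' * cos s + r'\<^sup>2) \<le> r' * (1 - 2 * r * cos s + r\<^sup>2)"
    by (simp add: algebra_simps power2_eq_square)
  then have "r / (1 - 2 * r * cos s + r\<^sup>2) \<le> r' / (1 - 2 * r' * cos s + r'\<^sup>2)"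
    using poisson_denom_pos[of r s] poisson_denom_pos[of r' s] r by (simp add: divide_simps mult_ac)
  then have "r / (1 - 2 * r * cos s + r\<^sup>2) * sin s \<le> r' / (1 - 2 * r' * cos s + r'\<^sup>2) * sin s"
    using s by (intro mult_right_mono sin_ge_zero)
  then show ?thesis by (simp add: conj_poisson_def)
qed

text \<open>\<open>sin s / (2 - 2 * cos s) = cot (s/2) / 2\<close> is the limit of the kernel as \<open>r\<close> tends to 1.\<close>

lemma conj_poisson_defect:
  assumes r: "0 \<le> r" "r < 1" and s: "0 < s" "s \<le> pi"
  shows "sin s / (2 - 2 * cos s) - conj_poisson r s =
    sin s / (2 - 2 * cos s) * ((1 - r)\<^sup>2 / (1 - 2 * r * cos s + r\<^sup>2))"
proof -
  have "2 - 2 * cos s = 4 * (sin (s/2))\<^sup>2" using cos_double_sin[of "s/2"] by simp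
  moreover have "sin (s/2) > 0" using s by (intro sin_gt_zero) auto
  ultimately have n: "2 - 2 * cos s \<noteq> 0" by simp
  have d: "1 - 2 * r * cos s + r\<^sup>2 \<noteq> 0" using poisson_denom_pos[OF r, of s] by simp
  show ?thesis unfolding conj_poisson_def using n d
    by (simp add: divide_simps) (simp add: algebra_simps power2_eq_square)
qed

lemma cot_kernel_bounds:
  assumes s: "0 < s" "s \<le> pi"
  shows "sin s / (2 - 2 * cos s) \<le> 1 / s" "0 \<le> sin s / (2 - 2 * cos s)"
    "s \<le> 1 \<Longrightarrow> 1 / (2 * s) \<le> sin s / (2 - 2 * cos s)"
proof -
  let ?x = "s/2"
  have c: "2 - 2 * cos s = 4 * (sin ?x)\<^sup>2" using cos_double_sin[of "s/2"] by simp
  have sn: "sin s = 2 * sin ?x * cos ?x" using sin_double[of "s/2"] by simp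
  have p: "sin ?x > 0" using s by (intro sin_gt_zero) auto
  have e: "sin s / (2 - 2 * cos s) = cos ?x / (2 * sin ?x)"
    unfolding c sn using p by (simp add: power2_eq_square)
  have "?x * cos ?x \<le> sin ?x" using s by (intro mult_cos_le_sin) auto
  then show "sin s / (2 - 2 * cos s) \<le> 1 / s" unfolding e using p s by (simp add: field_simps)
  have "cos ?x \<ge> 0" using s by (intro cos_ge_zero) auto
  then show "0 \<le> sin s / (2 - 2 * cos s)" unfolding e using p by simp
  \<comment> \<open>The threshold only serves to keep \<open>s/2\<close> below \<open>pi/3\<close>,
    where the cosine is at least \<open>1/2\<close>.\<close>
  assume "s \<le> 1"
  then have "?x \<le> pi/3" using pi_gt3 by simp
  then have "cos (pi/3) \<le> cos ?x" using s by (intro cos_monotone_0_pi_le) auto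
  then have "1/2 \<le> cos ?x" by (simp add: cos_60)
  moreover have "sin ?x \<le> ?x" using s by (intro sin_x_le_x) auto
  moreover have "s * (1/2) \<le> s * cos ?x" using calculation s by (intro mult_left_mono) auto
  ultimately have "sin ?x \<le> s * cos ?x" by linarith
  then show "1 / (2 * s) \<le> sin s / (2 - 2 * cos s)" unfolding e using p s by (simp add: field_simps)
qed

text \<open>Two upper bounds for two regimes: the cubic one is small when \<open>s\<close> is large
  compared with \<open>1 - r\<close>, while \<open>1 / s\<close> is the better one close to
  zero.\<close>

lemma conj_poisson_defect_le:
  assumes r: "1/2 \<le> r" "r < 1" and s: "0 < s" "s \<le> pi"
  shows "sin s / (2 - 2 * cos s) - conj_poisson r s \<le> pi\<^sup>2 * (1 - r)\<^sup>2 / s ^ 3"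
    and "0 \<le> sin s / (2 - 2 * cos s) - conj_poisson r s"
    and "sin s / (2 - 2 * cos s) - conj_poisson r s \<le> 1 / s"
proof -
  have d: "1 - 2 * r * cos s + r\<^sup>2 > 0" using r by (intro poisson_denom_pos) auto
  have D: "2 * s\<^sup>2 / pi\<^sup>2 \<le> 1 - 2 * r * cos s + r\<^sup>2" using r s by (intro poisson_denom_ge) auto
  have "s\<^sup>2 / pi\<^sup>2 \<le> 2 * s\<^sup>2 / pi\<^sup>2" by (intro divide_right_mono) auto
  then have "(1 - r)\<^sup>2 / (1 - 2 * r * cos s + r\<^sup>2) \<le> (1 - r)\<^sup>2 / (s\<^sup>2 / pi\<^sup>2)"
    using D s d by (intro divide_left_mono mult_pos_pos order_trans[OF _ D]) auto
  also have "\<dots> = pi\<^sup>2 * (1 - r)\<^sup>2 / s\<^sup>2" by (simp add: mult_ac)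
  finally have "(1 - r)\<^sup>2 / (1 - 2 * r * cos s + r\<^sup>2) \<le> pi\<^sup>2 * (1 - r)\<^sup>2 / s\<^sup>2" .
  then have "sin s / (2 - 2 * cos s) * ((1 - r)\<^sup>2 / (1 - 2 * r * cos s + r\<^sup>2)) \<le> 1 / s * (pi\<^sup>2 * (1 - r)\<^sup>2 / s\<^sup>2)"
    using cot_kernel_bounds[OF s] d s by (intro mult_mono) auto
  then show "sin s / (2 - 2 * cos s) - conj_poisson r s \<le> pi\<^sup>2 * (1 - r)\<^sup>2 / s ^ 3"
    using conj_poisson_defect[of r s] r s by (simp add: power2_eq_square power3_eq_cube mult_ac)
  have "0 \<le> sin s / (2 - 2 * cos s) * ((1 - r)\<^sup>2 / (1 - 2 * r * cos s + r\<^sup>2))"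
    by (rule mult_nonneg_nonneg[OF cot_kernel_bounds(2)[OF s]]) (use d in simp)
  then show "0 \<le> sin s / (2 - 2 * cos s) - conj_poisson r s"
    using conj_poisson_defect[of r s] r s by simp
  show "sin s / (2 - 2 * cos s) - conj_poisson r s \<le> 1 / s"
    using cot_kernel_bounds(1)[OF s] conj_poisson_nonneg[of r s] r s by linarith
qed

text \<open>For \<open>s \<le> 1 - r\<close> the denominator is at most
  \<open>2 * (1 - r)\<^sup>2\<close>, so at least half of the limit kernel is still missing at
  radius \<open>r\<close>, and the limit kernel itself is at least
  \<open>1 / (2 * s)\<close>.\<close>

lemma conj_poisson_defect_ge:
  assumes r: "1/2 \<le> r" "r < 1" and s: "0 < s" "s \<le> 1 - r"
  shows "1 / (4 * s) \<le> sin s / (2 - 2 * cos s) - conj_poisson r s"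
proof -
  have s': "s \<le> pi" "s \<le> 1" using r s pi_gt3 by auto
  have d: "1 - 2 * r * cos s + r\<^sup>2 > 0" using r by (intro poisson_denom_pos) auto
  have "1 - 2 * r * cos s + r\<^sup>2 \<le> (1 - r)\<^sup>2 + s\<^sup>2" using r s by (intro poisson_denom_le) auto
  also have "s\<^sup>2 \<le> (1 - r)\<^sup>2" using s by (intro power_mono) auto
  finally have "1/2 \<le> (1 - r)\<^sup>2 / (1 - 2 * r * cos s + r\<^sup>2)" using d by (simp add: field_simps)
  then have "1 / (2 * s) * (1/2) \<le> sin s / (2 - 2 * cos s) * ((1 - r)\<^sup>2 / (1 - 2 * r * cos s + r\<^sup>2))"
    using cot_kernel_bounds(2,3)[OF s(1) s'(1)] s s' by (intro mult_mono) auto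
  then show ?thesis using conj_poisson_defect[of r s] r s s' by simp
qed

lemma conj_poisson_diff_le:
  assumes r: "1/2 \<le> r" "r \<le> r'" "r' < 1" and s: "0 < s" "s \<le> pi"
  shows "conj_poisson r' s - conj_poisson r s \<le> pi\<^sup>2 * (1 - r)\<^sup>2 / s ^ 3"
    "conj_poisson r' s - conj_poisson r s \<le> 1 / s" "0 \<le> conj_poisson r' s - conj_poisson r s"
  using conj_poisson_defect_le[of r s] conj_poisson_defect_le[of r' s] conj_poisson_mono[of r r' s] r s
  by auto

section \<open>Boundary values of holomorphic functions from kernel estimates\<close>

text \<open>The logarithm of the denominator is an antiderivative up to the factor 2. For
  \<open>\<delta>\<close> comparable to \<open>1 - r\<close> the mass is of order
  \<open>- ln \<delta>\<close>, which produces the logarithmic modulus of continuity.\<close>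

lemma integral_conj_poisson:
  assumes r: "0 \<le> r" "r < 1" and s: "\<delta> \<le> pi"
  shows "(conj_poisson r has_integral ln (1 + r) - ln (1 - 2 * r * cos \<delta> + r\<^sup>2) / 2) {\<delta>..pi}"
proof -
  let ?F = "\<lambda>s. ln (1 - 2 * r * cos s + r\<^sup>2) / 2"
  have "(conj_poisson r has_integral ?F pi - ?F \<delta>) {\<delta>..pi}"
  proof (rule fundamental_theorem_of_calculus[OF s])
    fix s show "(?F has_vector_derivative conj_poisson r s) (at s within {\<delta>..pi})"
      unfolding has_real_derivative_iff_has_vector_derivative[symmetric] conj_poisson_def
      using poisson_denom_pos[OF r, of s]
      by (auto intro!: derivative_eq_intros simp: field_simps)
  qed
  moreover have "1 - 2 * r * cos pi + r\<^sup>2 = (1 + r)\<^sup>2" by (simp add: power2_eq_square algebra_simps)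
  then have "?F pi = ln (1 + r)" using r by (simp only: ) (simp add: ln_realpow)
  ultimately show ?thesis by simp
qed

lemma herglotz_Re_difference:
  assumes ch: "continuous_on (cball 0 1) h" and hh: "h holomorphic_on ball 0 1" and r: "0 \<le> r" "r < 1"
  shows "integral {0..pi} (\<lambda>s. conj_poisson r s * (Im (h (cis (x + s))) - Im (h (cis (x - s))))) =
    pi * (Re (h (of_real r * cis x)) - Re (h 0))"
proof -
  have g: "continuous_on (sphere 0 1) (\<lambda>w. Im (h w))"
    by (intro continuous_intros continuous_on_subset[OF ch]) auto
  have "Re (h (of_real r * cis x)) = - Im (schwarz_integral {0..2*pi} (\<lambda>w. Im (h w)) (of_real r * cis x)) + Re (h 0)"
    using r by (subst herglotz_representation[OF ch hh]) (auto simp: norm_mult)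
  then show ?thesis unfolding schwarz_integral_Im[OF g r] by simp
qed

text \<open>The error involves \<open>g\<close> only through a local oscillation \<open>e\<close>
  and a global one \<open>M\<close>. The estimate is therefore uniform over families of boundary
  functions, as is needed when the circle of integration itself varies.\<close>

lemma poisson_approximation:
  assumes g: "continuous_on (sphere 0 1) g" and r: "1/2 \<le> r" "r < 1"
    and M: "\<And>s. \<bar>g (cis (x + s)) - g (cis x)\<bar> \<le> M"
    and \<delta>: "0 < \<delta>" "\<delta> \<le> pi" and e: "\<And>s. \<bar>s\<bar> \<le> \<delta> \<Longrightarrow> \<bar>g (cis (x + s)) - g (cis x)\<bar> \<le> e"
  shows "\<bar>Re (schwarz_integral {0..2*pi} g (of_real r * cis x)) - g (cis x)\<bar> \<le> e + M * (pi\<^sup>2 * (1 - r) / \<delta>\<^sup>2)"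
proof -
  have r0: "0 \<le> r" using r by simp
  have e0: "0 \<le> e" using e[of 0] \<delta> by simp
  have M0: "0 \<le> M" using M[of 0] by simp
  define c where "c = M * (pi\<^sup>2 * (1 - r) / \<delta>\<^sup>2)"
  have c0: "0 \<le> c" using M0 r by (simp add: c_def)
  let ?d = "\<lambda>t. (g (cis (x + t)) - g (cis x)) * poisson r t"
  have pt: "poisson r t \<le> pi\<^sup>2 * (1 - r) / \<delta>\<^sup>2" if t: "\<delta> \<le> t" "t \<le> pi" for t
  proof -
    have "2 * \<delta>\<^sup>2 / pi\<^sup>2 \<le> 2 * t\<^sup>2 / pi\<^sup>2" using t \<delta> by (intro divide_right_mono mult_left_mono power_mono) auto
    also have "\<dots> \<le> 1 - 2 * r * cos t + r\<^sup>2" using r t \<delta> by (intro poisson_denom_ge) auto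
    finally have "poisson r t \<le> (1 - r\<^sup>2) / (2 * \<delta>\<^sup>2 / pi\<^sup>2)" unfolding poisson_def
      using r \<delta> poisson_denom_pos[OF r0 r(2), of t] by (intro divide_left_mono mult_pos_pos) (auto simp: power_le_one)
    also have "\<dots> \<le> (2 * (1 - r)) / (2 * \<delta>\<^sup>2 / pi\<^sup>2)"
    proof (rule divide_right_mono)
      have "1 - r\<^sup>2 = (1 + r) * (1 - r)" by (simp add: power2_eq_square algebra_simps)
      also have "\<dots> \<le> 2 * (1 - r)" using r by (intro mult_right_mono) auto
      finally show "1 - r\<^sup>2 \<le> 2 * (1 - r)" .
    qed simp
    also have "\<dots> = pi\<^sup>2 * (1 - r) / \<delta>\<^sup>2" using \<delta> by (simp add: field_simps)
    finally show ?thesis .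
  qed
  have bound: "norm (?d t) \<le> e * poisson r t + c" if t: "t \<in> {0..2*pi}" for t
  proof -
    have p0: "0 \<le> poisson r t" using poisson_nonneg r by simp
    have n: "norm (?d t) = \<bar>g (cis (x + t)) - g (cis x)\<bar> * poisson r t" using p0 by (simp add: abs_mult)
    \<comment> \<open>The parameter runs from 0 to \<open>2 * pi\<close>, so the neighbourhood of
      angle zero appears at both ends of the interval.\<close>
    consider "t \<le> \<delta>" | "2*pi - \<delta> \<le> t" | "\<delta> \<le> t" "t \<le> 2*pi - \<delta>" by linarith
    then show ?thesis
    proof cases
      case 1
      then show ?thesis unfolding n using e[of t] t p0 c0 by (intro add_increasing2 mult_right_mono) auto
    next
      case 2
      have "cis (x + (t - 2*pi)) = cis (x + t)" by (simp add: cis_divide[symmetric] flip: cis_mult add_diff_eq)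
      then show ?thesis unfolding n using e[of "t - 2*pi"] 2 t p0 c0 by (intro add_increasing2 mult_right_mono) auto
    next
      case 3
      have "poisson r t \<le> pi\<^sup>2 * (1 - r) / \<delta>\<^sup>2"
      proof (cases "t \<le> pi")
        case True then show ?thesis using pt 3 by simp
      next
        case False
        have "poisson r t = poisson r (2*pi - t)" by (simp add: poisson_def cos_diff)
        then show ?thesis using pt[of "2*pi - t"] 3 False by simp
      qed
      then have "\<bar>g (cis (x + t)) - g (cis x)\<bar> * poisson r t \<le> c"
        unfolding c_def using M[of t] p0 M0 by (intro mult_mono) auto
      then show ?thesis unfolding n using p0 e0 by (simp add: add_increasing)
    qed
  qed
  have ip: "poisson r integrable_on {0..2*pi}" "integral {0..2*pi} (poisson r) = 2*pi"
    using integral_poisson[OF r0 r(2)] by (auto simp: has_integral_iff)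
  have i1: "(\<lambda>t. g (cis (x + t)) * poisson r t) integrable_on {0..2*pi}"
    using r by (intro integrable_continuous_real continuous_intros continuous_on_circle_comp g) auto
  have i2: "?d integrable_on {0..2*pi}"
    using r by (intro integrable_continuous_real continuous_intros continuous_on_circle_comp g) auto
  have "integral {0..2*pi} ?d = integral {0..2*pi} (\<lambda>t. g (cis (x + t)) * poisson r t) - integral {0..2*pi} (\<lambda>t. g (cis x) * poisson r t)"
    unfolding integral_diff[symmetric, OF i1 integrable_on_mult_right[OF ip(1)]] by (simp add: left_diff_distrib)
  also have "\<dots> = 2 * pi * (Re (schwarz_integral {0..2*pi} g (of_real r * cis x)) - g (cis x))"
    unfolding schwarz_integral_Re[OF g r0 r(2)] integral_mult_right ip(2) by (simp add: algebra_simps)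
  finally have eq: "integral {0..2*pi} ?d = 2 * pi * (Re (schwarz_integral {0..2*pi} g (of_real r * cis x)) - g (cis x))" .
  have "norm (integral {0..2*pi} ?d) \<le> integral {0..2*pi} (\<lambda>t. e * poisson r t + c)"
    using bound ip i2 by (intro integral_norm_bound_integral integrable_add integrable_on_mult_right) auto
  also have "\<dots> = e * (2*pi) + 2 * pi * c"
    using ip by (subst integral_add) (auto intro: integrable_on_mult_right)
  finally have "2 * pi * \<bar>Re (schwarz_integral {0..2*pi} g (of_real r * cis x)) - g (cis x)\<bar> \<le> 2 * pi * (e + c)"
    unfolding eq real_norm_def abs_mult by (simp add: distrib_left mult_ac)
  then show ?thesis unfolding c_def by (rule mult_left_le_imp_le) simp
qed

text \<open>A jump of \<open>\<theta>\<close> would force a logarithmic singularity of \<open>Re h\<close>.\<close>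

lemma conj_modulus_bound:
  assumes ch: "continuous_on (cball 0 1) h" and hh: "h holomorphic_on ball 0 1"
    and mono: "\<And>x y. x \<le> y \<Longrightarrow> x + Im (h (cis x)) \<le> y + Im (h (cis y))"
    and B: "\<And>z. norm z < 1 \<Longrightarrow> \<bar>Re (h z)\<bar> \<le> B"
    and \<delta>: "0 < \<delta>" "\<delta> \<le> 1/2"
  defines "\<theta> \<equiv> \<lambda>x. x + Im (h (cis x))"
  shows "(\<theta> (x + \<delta>) - \<theta> (x - \<delta>)) * (- ln (2 * \<delta>\<^sup>2) / 2) \<le> 2 * pi * (B + 1)"
proof -
  \<comment> \<open>The radius is matched to \<open>\<delta>\<close>: the denominator at
    \<open>\<delta>\<close> is then at most \<open>2 * \<delta>\<^sup>2\<close>, the argument of the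
    logarithm in the conclusion.\<close>
  define r where "r = 1 - \<delta>"
  have r: "0 \<le> r" "r < 1" using \<delta> by (auto simp: r_def)
  have dpi: "\<delta> \<le> pi" using \<delta> pi_gt3 by simp
  let ?\<Delta> = "\<lambda>s. \<theta> (x + s) - \<theta> (x - s)"
  have c\<theta>: "continuous_on A (\<lambda>t. Im (h (cis (c t))))" if "continuous_on A c" for c and A :: "real set"
    using that by (intro continuous_on_Im continuous_on_compose2[OF ch] continuous_intros) auto
  have cD: "continuous_on A ?\<Delta>" for A unfolding \<theta>_def by (intro continuous_intros c\<theta>)
  have D0: "0 \<le> ?\<Delta> s" if "0 \<le> s" for s using mono[of "x - s" "x + s"] that by (simp add: \<theta>_def)
  have int: "(\<lambda>s. conj_poisson r s * ?\<Delta> s) integrable_on {a..b}" for a b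
    by (intro integrable_continuous_real continuous_intros cD r)
  have int2: "(\<lambda>s. conj_poisson r s * (2 * s)) integrable_on {a..b}" for a b
    by (intro integrable_continuous_real continuous_intros r)
  \<comment> \<open>Passing from \<open>Im h\<close> to \<open>\<theta>\<close> costs the linear
    increment \<open>2 * s\<close>; against the bound \<open>1 / s\<close> for the kernel it
    contributes at most \<open>2 * pi\<close>, the summand 1 in \<open>B + 1\<close>.\<close>
  have rep: "integral {0..pi} (\<lambda>s. conj_poisson r s * (Im (h (cis (x + s))) - Im (h (cis (x - s))))) =
    integral {0..pi} (\<lambda>s. conj_poisson r s * ?\<Delta> s) - integral {0..pi} (\<lambda>s. conj_poisson r s * (2 * s))"
    using int int2 by (subst integral_diff[symmetric]) (auto simp: \<theta>_def algebra_simps)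
  have "integral {0..pi} (\<lambda>s. conj_poisson r s * (2 * s)) \<le> integral {0..pi} (\<lambda>s. 2)"
  proof (rule integral_le[OF int2])
    fix s assume s: "s \<in> {0..pi}"
    show "conj_poisson r s * (2 * s) \<le> 2"
    proof (cases "s = 0")
      case False
      then have "conj_poisson r s * (2 * s) \<le> 1 / s * (2 * s)"
        using s r by (intro mult_right_mono conj_poisson_le) auto
      then show ?thesis using False by simp
    qed auto
  qed auto
  then have u: "integral {0..pi} (\<lambda>s. conj_poisson r s * (2 * s)) \<le> 2 * pi" by simp
  have "\<bar>Re (h (of_real r * cis x))\<bar> \<le> B" "\<bar>Re (h 0)\<bar> \<le> B" using B r by (auto simp: norm_mult)
  then have "pi * (Re (h (of_real r * cis x)) - Re (h 0)) \<le> pi * (2 * B)" by (intro mult_left_mono) auto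
  then have I: "integral {0..pi} (\<lambda>s. conj_poisson r s * ?\<Delta> s) \<le> 2 * pi * (B + 1)"
    using rep u herglotz_Re_difference[OF ch hh r, of x] by (simp add: algebra_simps)
  have "ln (1 + r) - ln (1 - 2 * r * cos \<delta> + r\<^sup>2) / 2 \<ge> - ln (2 * \<delta>\<^sup>2) / 2"
  proof -
    have "1 - 2 * r * cos \<delta> + r\<^sup>2 \<le> (1 - r)\<^sup>2 + \<delta>\<^sup>2" using r \<delta> by (intro poisson_denom_le) auto
    also have "\<dots> = 2 * \<delta>\<^sup>2" by (simp add: r_def)
    finally have "ln (1 - 2 * r * cos \<delta> + r\<^sup>2) \<le> ln (2 * \<delta>\<^sup>2)"
      using poisson_denom_pos[OF r, of \<delta>] by (intro ln_mono) auto
    moreover have "0 \<le> ln (1 + r)" using r by simp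
    ultimately show ?thesis by simp
  qed
  then have "?\<Delta> \<delta> * (- ln (2 * \<delta>\<^sup>2) / 2) \<le> ?\<Delta> \<delta> * integral {\<delta>..pi} (conj_poisson r)"
    using D0[of \<delta>] \<delta> integral_conj_poisson[OF r dpi] by (intro mult_left_mono) (auto simp: integral_unique)
  also have "\<dots> = integral {\<delta>..pi} (\<lambda>s. conj_poisson r s * ?\<Delta> \<delta>)" by simp
  also have "\<dots> \<le> integral {\<delta>..pi} (\<lambda>s. conj_poisson r s * ?\<Delta> s)"
  proof (rule integral_le[OF _ int])
    show "(\<lambda>s. conj_poisson r s * ?\<Delta> \<delta>) integrable_on {\<delta>..pi}"
      by (intro integrable_continuous_real continuous_intros r)
    fix s assume s: "s \<in> {\<delta>..pi}"
    \<comment> \<open>The symmetric increments grow with \<open>s\<close>, so the one at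
      \<open>\<delta>\<close> can be taken out of the integral over \<open>[\<delta>, \<pi>]\<close>
      as a lower bound.\<close>
    have "?\<Delta> \<delta> \<le> ?\<Delta> s" using mono[of "x - s" "x - \<delta>"] mono[of "x + \<delta>" "x + s"] s by (simp add: \<theta>_def)
    then show "conj_poisson r s * ?\<Delta> \<delta> \<le> conj_poisson r s * ?\<Delta> s"
      using r s \<delta> by (intro mult_left_mono conj_poisson_nonneg) auto
  qed
  also have "\<dots> \<le> integral {0..pi} (\<lambda>s. conj_poisson r s * ?\<Delta> s)"
    using \<delta> r D0 by (intro integral_subset_le int) (auto intro!: mult_nonneg_nonneg conj_poisson_nonneg)
  also note I
  finally show ?thesis .
qed

text \<open>The dilates of \<open>Re F\<close> are continuous on the closed disc and harmonic
  inside, so a uniform Cauchy condition on the unit circle spreads to the closed disc by the maximum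
  principle. Their uniform limit is the extension. Only the real part is involved, so
  \<open>Re h\<close> and \<open>Im h\<close> can be treated separately.\<close>

lemma radially_cauchy_extends:
  assumes F: "F holomorphic_on ball 0 1"
    and C: "\<And>e::real. e > 0 \<Longrightarrow> \<exists>r0<1. \<forall>r\<ge>r0. \<forall>r'\<ge>r. r' < 1 \<longrightarrow> (\<forall>x. \<bar>Re (F (of_real r * cis x)) - Re (F (of_real r' * cis x))\<bar> \<le> e)"
  obtains U where "continuous_on (cball 0 1) U" "\<And>z. norm z < 1 \<Longrightarrow> U z = Re (F z)"
proof -
  define \<rho> where "\<rho> n = 1 - 1 / real (n + 2)" for n :: nat
  have \<rho>: "0 \<le> \<rho> n" "\<rho> n < 1" for n by (auto simp: \<rho>_def field_simps)
  have \<rho>m: "\<rho> m \<le> \<rho> n" if "m \<le> n" for m n using that by (auto simp: \<rho>_def frac_le)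
  have \<rho>l: "\<rho> \<longlonglongrightarrow> 1"
  proof -
    have "(\<lambda>n. 1 - 1 / real (n + 2)) \<longlonglongrightarrow> 1 - 0"
      by (intro tendsto_diff tendsto_const LIMSEQ_ignore_initial_segment lim_1_over_n)
    then show ?thesis by (simp add: \<rho>_def[abs_def])
  qed
  have nb: "norm (of_real (\<rho> n) * z) < 1" if "norm z \<le> 1" for n and z :: complex
    using \<rho>[of n] mult_mono[of "\<rho> n" "\<rho> n" "norm z" 1] that by (simp add: norm_mult)
  define G where "G n z = Re (F (of_real (\<rho> n) * z))" for n z
  have Gc: "continuous_on (cball 0 1) (G n)" for n
    unfolding G_def using nb
    by (intro continuous_intros continuous_on_compose2[OF holomorphic_on_imp_continuous_on[OF F]]) auto
  have hol: "(\<lambda>z. F (of_real (\<rho> n) * z)) holomorphic_on ball 0 1" for n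
  proof -
    have "(F \<circ> (\<lambda>z. of_real (\<rho> n) * z)) holomorphic_on ball 0 1"
      using nb by (intro holomorphic_on_compose_gen[OF _ F] holomorphic_intros) auto
    then show ?thesis by (simp add: o_def)
  qed
  have cont: "continuous_on (cball 0 1) (\<lambda>z. F (of_real (\<rho> n) * z))" for n
    using nb by (intro continuous_intros continuous_on_compose2[OF holomorphic_on_imp_continuous_on[OF F]]) auto
  have max: "G m z - G n z \<le> e" if "\<And>x. G m (cis x) - G n (cis x) \<le> e" "norm z \<le> 1" for m n e z
  proof -
    have "Re (F (of_real (\<rho> m) * z) - F (of_real (\<rho> n) * z)) \<le> e"
    proof (rule maximum_real_frontier[where S="cball 0 1" and f="\<lambda>z. F (of_real (\<rho> m) * z) - F (of_real (\<rho> n) * z)"])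
      fix w :: complex assume "w \<in> frontier (cball 0 1)"
      then have "w = cis (Arg2pi w)" using Arg2pi_eq[of w] by (simp add: cis_conv_exp)
      then show "Re (F (of_real (\<rho> m) * w) - F (of_real (\<rho> n) * w)) \<le> e" using that(1)[of "Arg2pi w"] by (simp add: G_def)
    qed (use that in \<open>auto intro!: holomorphic_intros hol continuous_intros cont\<close>)
    then show ?thesis by (simp add: G_def)
  qed
  have "uniformly_Cauchy_on (cball 0 1) G"
    unfolding uniformly_Cauchy_on_def
  proof (intro allI impI)
    fix e :: real assume e: "e > 0"
    then obtain r0 where r0: "r0 < 1" "\<And>r r' x. r0 \<le> r \<Longrightarrow> r \<le> r' \<Longrightarrow> r' < 1 \<Longrightarrow> \<bar>Re (F (of_real r * cis x)) - Re (F (of_real r' * cis x))\<bar> \<le> e/2"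
      using C[of "e/2"] by (meson half_gt_zero)
    have "\<forall>\<^sub>F n in sequentially. r0 < \<rho> n" by (rule order_tendstoD(1)[OF \<rho>l r0(1)])
    then obtain N where N: "\<And>n. n \<ge> N \<Longrightarrow> r0 < \<rho> n" by (auto simp: eventually_sequentially)
    have "\<bar>G m (cis x) - G n (cis x)\<bar> \<le> e/2" if "N \<le> m" "N \<le> n" for m n x
    proof (cases "m \<le> n")
      case True then show ?thesis using r0(2)[of "\<rho> m" "\<rho> n" x] N[OF that(1)] \<rho> \<rho>m by (simp add: G_def)
    next
      case False then show ?thesis using r0(2)[of "\<rho> n" "\<rho> m" x] N[OF that(2)] \<rho> \<rho>m[of n m] by (simp add: G_def abs_minus_commute)
    qed
    then have a: "G m (cis x) - G n (cis x) \<le> e/2" if "N \<le> m" "N \<le> n" for m n x using that abs_le_D1 by blast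
    have "dist (G m z) (G n z) < e" if "z \<in> cball 0 1" "N \<le> m" "N \<le> n" for z m n
      using max[OF a[OF that(2,3)], of z] max[OF a[OF that(3,2)], of z] that(1) e by (simp add: dist_real_def abs_less_iff)
    then show "\<exists>M. \<forall>x\<in>cball 0 1. \<forall>m\<ge>M. \<forall>n\<ge>M. dist (G m x) (G n x) < e" by blast
  qed
  then obtain U where U: "uniform_limit (cball 0 1) G U sequentially"
    by (auto simp: uniformly_convergent_eq_Cauchy[symmetric] uniformly_convergent_on_def)
  show thesis
  proof
    show "continuous_on (cball 0 1) U"
      by (rule uniform_limit_theorem[OF _ U]) (auto simp: Gc)
    fix z :: complex assume z: "norm z < 1"
    have "(\<lambda>n. G n z) \<longlonglongrightarrow> U z" using tendsto_uniform_limitI[OF U] z by simp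
    moreover have "(\<lambda>n. G n z) \<longlonglongrightarrow> Re (F z)"
    proof -
      have "isCont F z" using F z holomorphic_on_imp_continuous_on continuous_on_interior[of "ball 0 1" F z] by simp
      moreover have "(\<lambda>n. of_real (\<rho> n) * z) \<longlonglongrightarrow> of_real 1 * z" by (intro tendsto_intros \<rho>l)
      ultimately show ?thesis unfolding G_def by (intro tendsto_Re isCont_tendsto_compose[of z F]) auto
    qed
    ultimately show "U z = Re (F z)" using LIMSEQ_unique by blast
  qed
qed

lemma radial_limit:
  fixes V :: "complex \<Rightarrow> 'a::topological_space"
  assumes "continuous_on (cball 0 1) V"
  shows "((\<lambda>\<rho>. V (of_real \<rho> * cis t)) \<longlongrightarrow> V (cis t)) (at_left 1)"
proof -
  have "continuous_on {0..1} (\<lambda>\<rho>. V (of_real \<rho> * cis t))"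
    by (intro continuous_on_compose2[OF assms] continuous_intros) (auto simp: norm_mult)
  from bspec[OF this[unfolded continuous_on_def], of 1]
  have "((\<lambda>\<rho>. V (of_real \<rho> * cis t)) \<longlongrightarrow> V (cis t)) (at 1 within {0..1})" by simp
  then show ?thesis by (simp add: at_within_Icc_at_left)
qed

section \<open>Star-shaped domains\<close>

lemma Arg2pi_cis: "0 \<le> t \<Longrightarrow> t < 2*pi \<Longrightarrow> Arg2pi (cis t) = t"
  by (rule Arg2pi_unique[of 1]) (auto simp: cis_conv_exp)

lemma cis_Arg2pi: "norm w = 1 \<Longrightarrow> cis (Arg2pi w) = w"
  using complex_norm_eq_1_exp[of w] by (simp add: cis_conv_exp)

lemma sphere_obtain_angle:
  assumes "norm w = 1"
  obtains t where "0 \<le> t" "t < 2*pi" "w = cis t"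
  using Arg2pi[of w] cis_Arg2pi[OF assms] by metis

text \<open>\<open>Arg2pi\<close> jumps at 1, so composition does not give continuity there. Closed
  sets are used instead: \<open>cis\<close> sends the closed preimage in the compact interval to a
  closed subset of the circle.\<close>

lemma continuous_on_circle_descend:
  fixes R :: "real \<Rightarrow> 'a::topological_space"
  assumes R: "continuous_on {0..2*pi} R" and per: "R 0 = R (2*pi)"
  obtains \<rho> where "continuous_on (sphere 0 1) \<rho>" "\<And>t. t \<in> {0..2*pi} \<Longrightarrow> \<rho> (cis t) = R t"
proof -
  define \<rho> where "\<rho> w = R (Arg2pi w)" for w
  have eq: "\<rho> (cis t) = R t" if "t \<in> {0..2*pi}" for t
  proof (cases "t = 2*pi")
    case True
    then show ?thesis using per Arg2pi_cis[of 0] by (simp add: \<rho>_def)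
  next
    case False
    then show ?thesis using that by (simp add: \<rho>_def Arg2pi_cis)
  qed
  have "\<exists>A. closed A \<and> A \<inter> sphere 0 1 = \<rho> -` B \<inter> sphere 0 1" if B: "closed B" for B
  proof (intro exI conjI)
    let ?A = "cis ` ({0..2*pi} \<inter> R -` B)"
    have "closed ({0..2*pi} \<inter> R -` B)" by (rule continuous_closed_preimage[OF R _ B]) simp
    then have "compact ({0..2*pi} \<inter> R -` B)"
      by (meson bounded_Int bounded_closed_interval compact_eq_bounded_closed)
    then have "compact ?A" by (intro compact_continuous_image continuous_intros)
    then show "closed ?A" by (rule compact_imp_closed)
    show "?A \<inter> sphere 0 1 = \<rho> -` B \<inter> sphere 0 1"
    proof (intro set_eqI iffI)
      fix w assume "w \<in> ?A \<inter> sphere 0 1"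
      then show "w \<in> \<rho> -` B \<inter> sphere 0 1" using eq by auto
    next
      fix w assume w: "w \<in> \<rho> -` B \<inter> sphere 0 1"
      then obtain t where "0 \<le> t" "t < 2*pi" "w = cis t" using sphere_obtain_angle[of w] by auto
      then show "w \<in> ?A \<inter> sphere 0 1" using eq[of t] w by auto
    qed
  qed
  then have "continuous_on (sphere 0 1) \<rho>" by (simp add: continuous_on_closed_invariant)
  then show thesis using eq that by blast
qed

section \<open>Minkowski gauges\<close>

text \<open>For positive \<open>k\<close> this is the Minkowski gauge of the star-shaped domain with
  radius \<open>1 / k u\<close> in direction \<open>u\<close>. At the origin the value of
  \<open>k\<close> at \<open>sgn 0 = 0\<close> is multiplied by zero.\<close>

definition gauge_of :: "(complex \<Rightarrow> real) \<Rightarrow> complex \<Rightarrow> real" where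
  "gauge_of k w = norm w * k (sgn w)"

lemma gauge_of_scale: "0 \<le> s \<Longrightarrow> gauge_of k (of_real s * w) = s * gauge_of k w"
  by (cases "s = 0") (auto simp: gauge_of_def norm_mult sgn_mult sgn_of_real)

lemma gauge_of_cis: "0 < \<rho> \<Longrightarrow> gauge_of k (of_real \<rho> * cis t) = \<rho> * k (cis t)"
  using gauge_of_scale[of \<rho> k "cis t"] by (simp add: gauge_of_def sgn_div_norm)

lemma gauge_of_0 [simp]: "gauge_of k 0 = 0"
  by (simp add: gauge_of_def)

lemma circle_function_bounds:
  assumes "continuous_on (sphere 0 1) k" "\<And>w::complex. norm w = 1 \<Longrightarrow> 0 < k w"
  obtains m M :: real where "0 < m" "\<And>w. norm w = 1 \<Longrightarrow> m \<le> k w" "\<And>w. norm w = 1 \<Longrightarrow> k w \<le> M"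
proof -
  have c: "compact (sphere (0::complex) 1)" "sphere (0::complex) 1 \<noteq> {}" by auto
  obtain a where a: "a \<in> sphere 0 1" "\<And>w. w \<in> sphere 0 1 \<Longrightarrow> k a \<le> k w"
    using continuous_attains_inf[OF c assms(1)] by blast
  obtain b where b: "b \<in> sphere 0 1" "\<And>w. w \<in> sphere 0 1 \<Longrightarrow> k w \<le> k b"
    using continuous_attains_sup[OF c assms(1)] by blast
  show thesis using that[of "k a" "k b"] a b assms(2) by auto
qed

lemma continuous_on_gauge_of:
  assumes k: "continuous_on (sphere 0 1) k" and pos: "\<And>w. norm w = 1 \<Longrightarrow> 0 < k w"
  shows "continuous_on A (gauge_of k)"
proof -
  obtain m M where m: "0 < m" "\<And>w. norm w = 1 \<Longrightarrow> m \<le> k w" "\<And>w. norm w = 1 \<Longrightarrow> k w \<le> M"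
    using circle_function_bounds[OF k pos] by blast
  have "isCont (gauge_of k) w" for w
  proof (cases "w = 0")
    case True
    have "gauge_of k \<midarrow>0\<rightarrow> 0"
    proof (rule Lim_null_comparison)
      have "norm (gauge_of k x) \<le> norm x * M" for x
      proof (cases "x = 0")
        case False
        then have "norm (sgn x) = 1" by (simp add: norm_sgn)
        then show ?thesis using m(1) m(2,3)[of "sgn x"] by (auto simp: gauge_of_def abs_mult intro!: mult_left_mono)
      qed auto
      then show "\<forall>\<^sub>F x in at 0. norm (gauge_of k x) \<le> norm x * M" by simp
      show "(\<lambda>x. norm x * M) \<midarrow>0\<rightarrow> 0" by (auto intro!: tendsto_eq_intros)
    qed
    then show ?thesis using True by (simp add: isCont_def)
  next
    case False
    have "continuous_on (- {0}) (\<lambda>w. k (sgn w))"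
      by (rule continuous_on_compose2[OF k]) (auto simp: norm_sgn intro!: continuous_intros split: if_splits)
    then have "continuous_on (- {0}) (gauge_of k)"
      unfolding gauge_of_def by (intro continuous_intros)
    then show ?thesis using False by (simp add: continuous_on_eq_continuous_at open_Compl)
  qed
  then show ?thesis by (simp add: continuous_at_imp_continuous_on)
qed

lemma star_domain_open_bounded:
  assumes k: "continuous_on (sphere 0 1) k" and pos: "\<And>w. norm w = 1 \<Longrightarrow> 0 < k w"
  shows "open {w. gauge_of k w < 1}" "bounded {w. gauge_of k w < 1}" "compact {w. gauge_of k w \<le> 1}"
    "starlike {w. gauge_of k w < 1}" "{w. gauge_of k w < 1} \<noteq> UNIV"
proof -
  obtain m where m: "0 < m" "\<And>w. norm w = 1 \<Longrightarrow> m \<le> k w"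
    using circle_function_bounds[OF k pos] by metis
  note c = continuous_on_gauge_of[OF k pos, of UNIV]
  show "open {w. gauge_of k w < 1}" by (intro open_Collect_less c continuous_intros)
  have cl: "closed {w. gauge_of k w \<le> 1}" by (intro closed_Collect_le c continuous_intros)
  have nb: "norm w \<le> 1 / m" if "gauge_of k w \<le> 1" for w
  proof (cases "w = 0")
    case False
    then have "m \<le> k (sgn w)" by (intro m) (simp add: norm_sgn)
    then have "norm w * m \<le> gauge_of k w" by (simp add: gauge_of_def mult_left_mono)
    then show ?thesis using that m(1) by (simp add: field_simps)
  qed (use m in auto)
  then have "bounded {w. gauge_of k w \<le> 1}" unfolding bounded_iff by blast
  then show "compact {w. gauge_of k w \<le> 1}" using cl by (simp add: compact_eq_bounded_closed)
  show b: "bounded {w. gauge_of k w < 1}"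
    by (rule bounded_subset[OF \<open>bounded {w. gauge_of k w \<le> 1}\<close>]) auto
  then show "{w. gauge_of k w < 1} \<noteq> UNIV" using not_bounded_UNIV by metis
  show "starlike {w. gauge_of k w < 1}"
    unfolding starlike_def
  proof (intro bexI[of _ 0] ballI subsetI)
    fix x y :: complex assume x: "x \<in> {w. gauge_of k w < 1}" and y: "y \<in> closed_segment 0 x"
    from y obtain u where u: "0 \<le> u" "u \<le> 1" "y = of_real u * x"
      by (auto simp: closed_segment_def scaleR_conv_of_real)
    have "gauge_of k y = u * gauge_of k x" using u gauge_of_scale by simp
    also have "\<dots> < 1"
      using x u mult_left_mono[of "gauge_of k x" 1 u] by (cases "u = 0"; cases "u = 1") (auto simp: less_le_trans intro: le_less_trans[of _ u])
    finally show "y \<in> {w. gauge_of k w < 1}" by simp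
  qed simp
qed

lemma strictly_star_shaped_gauge:
  assumes R: "continuous_on {0..2*pi} R" "\<And>t. t \<in> {0..2*pi} \<Longrightarrow> 0 < R t" "R 0 = R (2*pi)"
  obtains k where "continuous_on (sphere 0 1) k" "\<And>w. norm w = 1 \<Longrightarrow> 0 < k w"
    "\<And>t. t \<in> {0..2*pi} \<Longrightarrow> k (cis t) = 1 / R t"
    "{of_real \<rho> * cis \<theta> | \<rho> \<theta>. 0 \<le> \<rho> \<and> \<rho> < R \<theta> \<and> \<theta> \<in> {0..2*pi}} = {w. gauge_of k w < 1}"
proof -
  have "continuous_on {0..2*pi} (\<lambda>t. 1 / R t)" using R(2) by (force intro!: continuous_intros R(1))
  then obtain k where k: "continuous_on (sphere 0 1) k" "\<And>t. t \<in> {0..2*pi} \<Longrightarrow> k (cis t) = 1 / R t"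
    using continuous_on_circle_descend[of "\<lambda>t. 1 / R t"] R(3) by metis
  have pos: "0 < k w" if "norm w = 1" for w
    using sphere_obtain_angle[OF that] k(2) R(2) by (metis atLeastAtMost_iff less_imp_le zero_less_divide_1_iff)
  have "{of_real \<rho> * cis \<theta> | \<rho> \<theta>. 0 \<le> \<rho> \<and> \<rho> < R \<theta> \<and> \<theta> \<in> {0..2*pi}} = {w. gauge_of k w < 1}" (is "?L = ?R")
  proof (intro set_eqI iffI)
    fix w assume "w \<in> ?L"
    then obtain \<rho> \<theta> where w: "w = of_real \<rho> * cis \<theta>" "0 \<le> \<rho>" "\<rho> < R \<theta>" "\<theta> \<in> {0..2*pi}" by blast
    have "\<rho> * (1 / R \<theta>) < 1" using w R(2)[of \<theta>] by simp
    then show "w \<in> ?R" using w k(2)[of \<theta>] gauge_of_cis[of \<rho> k \<theta>] by (cases "\<rho> = 0") auto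
  next
    fix w assume w: "w \<in> ?R"
    show "w \<in> ?L"
    proof (cases "w = 0")
      case True
      then show ?thesis using R(2)[of 0] by (intro CollectI exI[of _ 0]) auto
    next
      case False
      then obtain t where t: "0 \<le> t" "t < 2*pi" "sgn w = cis t" using sphere_obtain_angle[of "sgn w"] by (metis norm_sgn)
      have e: "w = of_real (norm w) * cis t" unfolding t(3)[symmetric] using False by (simp add: sgn_div_norm scaleR_conv_of_real)
      have "norm w * k (cis t) < 1" using w t by (simp add: gauge_of_def)
      then have "norm w < R t" using k(2)[of t] R(2)[of t] t by (simp add: field_simps)
      then show ?thesis using e t by (intro CollectI exI[of _ "norm w"] exI[of _ t]) auto
    qed
  qed
  then show thesis using that k pos by blast
qed

section \<open>The Riemann map onto a star-shaped domain and its boundary values\<close>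

lemma riemann_map_at_0:
  assumes S: "open S" "simply_connected S" "S \<noteq> UNIV" "0 \<in> S"
  obtains f \<phi> where "f holomorphic_on ball 0 1" "\<phi> holomorphic_on S" "f 0 = 0" "\<phi> 0 = 0"
    "\<And>z. norm z < 1 \<Longrightarrow> f z \<in> S \<and> \<phi> (f z) = z" "\<And>w. w \<in> S \<Longrightarrow> norm (\<phi> w) < 1 \<and> f (\<phi> w) = w"
proof -
  obtain F G where FG: "F holomorphic_on S" "G holomorphic_on ball 0 1"
    "\<And>z. z \<in> S \<Longrightarrow> F z \<in> ball 0 1 \<and> G (F z) = z" "\<And>z. z \<in> ball 0 1 \<Longrightarrow> G z \<in> S \<and> F (G z) = z"
    using S Riemann_mapping_theorem[of S] by blast
  define a where "a = F 0"
  have a: "norm a < 1" using FG(3)[OF S(4)] by (simp add: a_def)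
  let ?M = "Moebius_function 0 a" and ?N = "Moebius_function 0 (-a)"
  have MN: "?N (?M z) = z" "?M (?N z) = z" if "norm z < 1" for z
    using Moebius_function_compose[of "-a" a z] Moebius_function_compose[of a "-a" z] a that by auto
  have nM: "norm (?M z) < 1" "norm (?N z) < 1" if "norm z < 1" for z
    using Moebius_function_norm_lt_1 a that by auto
  show thesis
  proof (rule that[of "G \<circ> ?N" "?M \<circ> F"])
    show "G \<circ> ?N holomorphic_on ball 0 1"
      using nM a by (intro holomorphic_on_compose_gen[OF _ FG(2)] Moebius_function_holomorphic) auto
    show "?M \<circ> F holomorphic_on S"
      using FG(3) by (intro holomorphic_on_compose_gen[OF FG(1) Moebius_function_holomorphic[OF a]]) auto
    show "(?M \<circ> F) 0 = 0" by (simp add: a_def Moebius_function_eq_zero)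
    have "?N 0 = a" by (simp add: Moebius_function_of_zero)
    then show "(G \<circ> ?N) 0 = 0" using FG(3)[OF S(4)] by (simp add: a_def)
    show "(G \<circ> ?N) z \<in> S \<and> (?M \<circ> F) ((G \<circ> ?N) z) = z" if "norm z < 1" for z
      using FG(4)[of "?N z"] nM(2)[OF that] MN(2)[OF that] by simp
    show "norm ((?M \<circ> F) w) < 1 \<and> (G \<circ> ?N) ((?M \<circ> F) w) = w" if "w \<in> S" for w
      using FG(3)[OF that] nM(1)[of "F w"] MN(1)[of "F w"] by simp
  qed
qed

text \<open>Injectivity makes the zero at the origin simple and unique, so \<open>f z / z\<close>
  has a holomorphic logarithm on the disc. Its imaginary part is the difference of the arguments of
  \<open>f z\<close> and \<open>z\<close>.\<close>

lemma injective_factor_exp: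
  assumes f: "f holomorphic_on ball 0 1" "f 0 = 0" "inj_on f (ball 0 1)"
  obtains h where "h holomorphic_on ball 0 1" "\<And>z. norm z < 1 \<Longrightarrow> f z = z * exp (h z)"
proof -
  obtain q where q: "q holomorphic_on ball 0 1" "\<And>z. norm z < 1 \<Longrightarrow> f z = z * q z" "deriv f 0 = q 0"
    using Schwarz3[OF f(1,2)] by blast
  have "deriv f 0 \<noteq> 0" using holomorphic_injective_imp_regular[OF f(1) _ f(3)] by simp
  then have "q z \<noteq> 0" if "z \<in> ball 0 1" for z
    using q(2)[of z] q(3) f(2) inj_onD[OF f(3), of z 0] that by (cases "z = 0") auto
  moreover have "simply_connected (ball (0::complex) 1)" by (simp add: convex_imp_simply_connected)
  ultimately obtain h where "h holomorphic_on ball 0 1" "\<And>z. z \<in> ball 0 1 \<Longrightarrow> q z = exp (h z)"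
    using simply_connected_eq_holomorphic_log[OF open_ball, of "0::complex" 1] q(1) by metis
  then show thesis using that q(2) by auto
qed

text \<open>By the Schwarz lemma applied to \<open>z \<mapsto> \<phi> (s * f z)\<close>, the images of concentric discs are star-shaped,
  so \<open>Re (1 + z * deriv h z)\<close> is nonnegative; it is the angular derivative of the argument of \<open>f\<close>.\<close>

lemma starlike_argument_mono:
  assumes h: "h holomorphic_on ball 0 1" and \<phi>: "\<phi> holomorphic_on S" and S: "open S"
    and star: "\<And>w s. w \<in> S \<Longrightarrow> 0 \<le> s \<Longrightarrow> s \<le> 1 \<Longrightarrow> of_real s * w \<in> S"
    and f\<phi>: "\<And>z. norm z < 1 \<Longrightarrow> z * exp (h z) \<in> S \<and> \<phi> (z * exp (h z)) = z" "\<And>w. w \<in> S \<Longrightarrow> norm (\<phi> w) < 1"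
    and \<rho>: "0 \<le> \<rho>" "\<rho> < 1" and xy: "x \<le> y"
  shows "x + Im (h (of_real \<rho> * cis x)) \<le> y + Im (h (of_real \<rho> * cis y))"
proof -
  define f where "f z = z * exp (h z)" for z
  have f: "f holomorphic_on ball 0 1" unfolding f_def by (intro holomorphic_intros h)
  have hd: "(h has_field_derivative deriv h z) (at z)" if "norm z < 1" for z
    using holomorphic_derivI[OF h] that by simp
  have fd: "(f has_field_derivative exp (h z) * (1 + z * deriv h z)) (at z)" if "norm z < 1" for z
    unfolding f_def using hd[OF that] by (auto intro!: derivative_eq_intros simp: algebra_simps)
  have key: "0 \<le> Re (1 + z * deriv h z)" if z: "norm z < 1" "z \<noteq> 0" for z
  proof -
    define w where "w = f z"
    have w: "w \<in> S" "\<phi> w = z" "w \<noteq> 0" using f\<phi>(1)[OF z(1)] z by (auto simp: w_def f_def)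
    let ?a = "1 + z * deriv h z"
    have \<phi>d: "(\<phi> has_field_derivative deriv \<phi> w) (at w)" by (rule holomorphic_derivI[OF \<phi> S w(1)])
    have "((\<phi> \<circ> f) has_field_derivative deriv \<phi> w * (exp (h z) * ?a)) (at z)"
      using \<phi>d fd[OF z(1)] by (intro DERIV_chain) (auto simp: w_def)
    moreover have "((\<phi> \<circ> f) has_field_derivative 1) (at z)"
    proof (rule has_field_derivative_transform_within_open[of "\<lambda>x. x" 1 z "ball 0 1"])
      show "x = (\<phi> \<circ> f) x" if "x \<in> ball 0 1" for x using f\<phi>(1)[of x] that by (simp add: f_def)
    qed (use z in auto)
    ultimately have 1: "deriv \<phi> w * (exp (h z) * ?a) = 1" by (rule DERIV_unique)
    \<comment> \<open>By the Schwarz lemma \<open>L s\<close> never exceeds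
      \<open>(norm z)\<^sup>2\<close>, its value at \<open>s = 1\<close>, on \<open>[0, 1]\<close>.
      Hence the derivative at 1 cannot be negative.\<close>
    define L where "L s = Re (cnj z * \<phi> (of_real s * w))" for s
    have "((\<lambda>s. cnj z * \<phi> (s * w)) has_field_derivative cnj z * (deriv \<phi> w * w)) (at (of_real 1))"
      using \<phi>d by (auto intro!: derivative_eq_intros DERIV_chain2[of \<phi>] simp: mult_ac)
    then have Ld: "(L has_real_derivative Re (cnj z * (deriv \<phi> w * w))) (at 1)"
      unfolding L_def by (intro has_field_derivative_Re has_vector_derivative_real_field)
    have Lle: "L s \<le> L 1" if s: "0 \<le> s" "s \<le> 1" for s
    proof -
      have "norm (\<phi> (of_real s * f z)) \<le> norm z"
      proof (rule Schwarz_Lemma(1)[of "\<lambda>z. \<phi> (of_real s * f z)"])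
        have "\<phi> \<circ> (\<lambda>z. of_real s * f z) holomorphic_on ball 0 1"
          using star[OF _ s] f\<phi>(1) by (intro holomorphic_on_compose_gen[OF _ \<phi>] holomorphic_intros f) (auto simp: f_def)
        then show "(\<lambda>z. \<phi> (of_real s * f z)) holomorphic_on ball 0 1" by (simp add: o_def)
        show "\<phi> (of_real s * f 0) = 0" using f\<phi>(1)[of 0] by (simp add: f_def)
        show "norm (\<phi> (of_real s * f z)) < 1" if "norm z < 1" for z
          using star[OF _ s] f\<phi>(1)[OF that] f\<phi>(2) by (simp add: f_def)
      qed (use z in auto)
      then have "norm (cnj z * \<phi> (of_real s * w)) \<le> norm z * norm z"
        unfolding norm_mult w_def by (simp add: mult_left_mono)
      moreover have "L 1 = norm z * norm z" using w by (simp add: L_def cmod_power2[unfolded power2_eq_square])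
      ultimately show ?thesis unfolding L_def using complex_Re_le_cmod order_trans by metis
    qed
    have "0 \<le> Re (cnj z * (deriv \<phi> w * w))"
    proof (rule ccontr)
      assume "\<not> 0 \<le> Re (cnj z * (deriv \<phi> w * w))"
      then obtain d where d: "d > 0" "\<And>h. h > 0 \<Longrightarrow> h < d \<Longrightarrow> L 1 < L (1 - h)"
        using DERIV_neg_dec_left[OF Ld] by auto
      define s where "s = min (d/2) 1"
      have "0 < s" "s < d" "s \<le> 1" using d(1) by (auto simp: s_def)
      then show False using d(2)[of s] Lle[of "1 - s"] by auto
    qed
    \<comment> \<open>The derivative of \<open>L\<close> at 1 is \<open>(norm z)\<^sup>2\<close>
      times the real part of \<open>inverse ?a\<close>, and a complex number and its inverse have
      real parts of the same sign.\<close>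
    moreover have "cnj z * (deriv \<phi> w * w) = of_real ((norm z)\<^sup>2) * inverse ?a"
    proof -
      have "deriv \<phi> w * w = z * (deriv \<phi> w * exp (h z))" by (simp add: w_def f_def)
      also have "deriv \<phi> w * exp (h z) = inverse ?a" using 1 inverse_unique[of ?a "deriv \<phi> w * exp (h z)"] by (simp only: mult_ac)
      finally show ?thesis using complex_norm_square[of z] by (simp add: mult_ac)
    qed
    ultimately have "0 \<le> (norm z)\<^sup>2 * Re (inverse ?a)" by (simp only: Re_of_real_mult)
    then have "0 \<le> Re (inverse ?a)"
      using mult_le_cancel_left_pos[of "(norm z)\<^sup>2" 0 "Re (inverse ?a)"] zero_less_power[of "norm z" 2] z(2)
      by (simp only: mult_zero_right zero_less_norm_iff) simp
    then have "0 \<le> Re ?a / ((Re ?a)\<^sup>2 + (Im ?a)\<^sup>2)" by (simp only: inverse_complex.sel)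
    moreover have "?a \<noteq> 0" using 1 by auto
    then have "(Re ?a)\<^sup>2 + (Im ?a)\<^sup>2 > 0" using complex_neq_0 by blast
    ultimately show ?thesis by (simp only: zero_le_divide_iff) linarith
  qed
  show ?thesis
  proof (rule DERIV_nonneg_imp_nondecreasing[OF xy])
    fix t :: real
    let ?z = "of_real \<rho> * cis t"
    have z: "norm ?z < 1" using \<rho> by (simp add: norm_mult)
    have "((\<lambda>w. h (of_real \<rho> * exp (\<i> * w))) has_field_derivative deriv h ?z * (of_real \<rho> * (\<i> * cis t))) (at (of_real t))"
    proof (rule DERIV_chain2[where f=h and g="\<lambda>w. of_real \<rho> * exp (\<i> * w)"])
      show "(h has_field_derivative deriv h ?z) (at (of_real \<rho> * exp (\<i> * of_real t)))"
        using hd[OF z] by (simp add: cis_conv_exp)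
      show "((\<lambda>w. of_real \<rho> * exp (\<i> * w)) has_field_derivative of_real \<rho> * (\<i> * cis t)) (at (of_real t))"
        by (auto intro!: derivative_eq_intros simp: cis_conv_exp)
    qed
    then have "((\<lambda>t. Im (h (of_real \<rho> * exp (\<i> * of_real t)))) has_real_derivative Im (deriv h ?z * (of_real \<rho> * (\<i> * cis t)))) (at t)"
      by (intro has_field_derivative_Im has_vector_derivative_real_field)
    from DERIV_add[OF DERIV_ident this]
    have "((\<lambda>t. t + Im (h (of_real \<rho> * cis t))) has_real_derivative 1 + Im (deriv h ?z * (of_real \<rho> * (\<i> * cis t)))) (at t)"
      by (simp only: cis_conv_exp)
    moreover have "1 + Im (deriv h ?z * (of_real \<rho> * (\<i> * cis t))) = Re (1 + ?z * deriv h ?z)"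
      by (simp add: algebra_simps)
    moreover have "0 \<le> Re (1 + ?z * deriv h ?z)" using key[OF z] by (cases "?z = 0") auto
    ultimately show "\<exists>y. ((\<lambda>t. t + Im (h (of_real \<rho> * cis t))) has_real_derivative y) (at t) \<and> 0 \<le> y" by metis
  qed
qed

text \<open>Over a full turn \<open>v\<close> returns to its value, so the monotone function
  \<open>x + v (cis x)\<close> grows by exactly \<open>2 * pi\<close>. This bounds the oscillation
  of \<open>v\<close> without further information; the constant is not sharp.\<close>

lemma harmonic_Im_circle_variation:
  assumes mono: "\<And>x y. x \<le> y \<Longrightarrow> x + v (cis x) \<le> y + v (cis y)"
  shows "\<bar>v (cis (x + s)) - v (cis x)\<bar> \<le> 4 * pi"
proof -
  define s' where "s' = Arg2pi (cis s)"
  have s': "0 \<le> s'" "s' < 2*pi" "cis s' = cis s"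
    using Arg2pi[of "cis s"] cis_Arg2pi[of "cis s"] by (auto simp: s'_def)
  have e: "cis (x + s) = cis (x + s')" using s'(3) by (simp flip: cis_mult)
  have e2: "cis (x + 2*pi) = cis x" by (simp flip: cis_mult)
  have "x + v (cis x) \<le> (x + s') + v (cis (x + s'))" using mono s' by simp
  moreover have "(x + s') + v (cis (x + s')) \<le> (x + 2*pi) + v (cis (x + 2*pi))" using mono s' by simp
  ultimately show ?thesis unfolding e e2 using s' pi_gt_zero by linarith
qed

text \<open>The modulus bound is applied to every dilate of \<open>h\<close>, which makes the
  restrictions of \<open>Im h\<close> to all circles equicontinuous. The Poisson formula on the
  circle of radius \<open>\<rho>\<close> then compares its points with those at radius
  \<open>\<rho> * r\<close>, and this gives the uniform radial Cauchy condition.\<close>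

lemma star_argument_extends:
  assumes h: "h holomorphic_on ball 0 1"
    and mono: "\<And>\<rho> x y. 0 \<le> \<rho> \<Longrightarrow> \<rho> < 1 \<Longrightarrow> x \<le> y \<Longrightarrow>
        x + Im (h (of_real \<rho> * cis x)) \<le> y + Im (h (of_real \<rho> * cis y))"
    and B: "\<And>z. norm z < 1 \<Longrightarrow> \<bar>Re (h z)\<bar> \<le> B"
  obtains V where "continuous_on (cball 0 1) V" "\<And>z. norm z < 1 \<Longrightarrow> V z = Im (h z)"
proof -
  define H where "H \<rho> z = h (of_real \<rho> * z)" for \<rho> z
  have nb: "norm (of_real \<rho> * z) < 1" if "0 \<le> \<rho>" "\<rho> < 1" "norm z \<le> 1" for \<rho> and z :: complex
    using mult_left_mono[OF that(3,1)] that by (simp add: norm_mult)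
  have Hc: "continuous_on (cball 0 1) (H \<rho>)" and Hh: "H \<rho> holomorphic_on ball 0 1" if \<rho>: "0 \<le> \<rho>" "\<rho> < 1" for \<rho>
  proof -
    show "continuous_on (cball 0 1) (H \<rho>)" unfolding H_def
      using nb[OF \<rho>] by (intro continuous_on_compose2[OF holomorphic_on_imp_continuous_on[OF h]] continuous_intros) auto
    have "h \<circ> (\<lambda>z. of_real \<rho> * z) holomorphic_on ball 0 1"
      using nb[OF \<rho>] by (intro holomorphic_on_compose_gen[OF _ h] holomorphic_intros) auto
    then show "H \<rho> holomorphic_on ball 0 1" by (simp add: o_def H_def[abs_def])
  qed
  have HB: "\<bar>Re (H \<rho> z)\<bar> \<le> B" if "0 \<le> \<rho>" "\<rho> < 1" "norm z < 1" for \<rho> z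
    using B[OF nb[of \<rho> z]] that by (simp add: H_def)
  have B0: "0 \<le> B" using B[of 0] by simp
  have equi: "\<exists>\<delta>>0. \<delta> \<le> pi \<and> (\<forall>\<rho> x s. 0 \<le> \<rho> \<longrightarrow> \<rho> < 1 \<longrightarrow> \<bar>s\<bar> \<le> \<delta> \<longrightarrow> \<bar>Im (H \<rho> (cis (x + s))) - Im (H \<rho> (cis x))\<bar> \<le> e)"
    if e: "e > 0" for e
  proof -
    define C where "C = 2 * pi * (B + 1)"
    have C: "C > 0" using B0 by (simp add: C_def)
    define K where "K = 2 * C / e"
    have K: "K > 0" using C e by (simp add: K_def)
    \<comment> \<open>The exponential forces \<open>- ln (2 * \<delta>\<^sup>2) / 2\<close> to be at
      least \<open>K\<close>, the extra \<open>-1\<close> absorbing \<open>ln 2\<close>, so the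
      increment of the argument is at most \<open>C / K = e/2\<close>. The bound \<open>e/4\<close>
      controls the difference between increments of the argument and of \<open>Im h\<close>.\<close>
    define \<delta> where "\<delta> = min (min (1/2) (e/4)) (exp (- K - 1))"
    have \<delta>: "0 < \<delta>" "\<delta> \<le> 1/2" "\<delta> \<le> e/4" using e by (auto simp: \<delta>_def)
    have "ln \<delta> \<le> ln (exp (- K - 1))" using \<delta>(1) by (subst ln_le_cancel_iff) (auto simp: \<delta>_def)
    then have "ln \<delta> \<le> - K - 1" by simp
    moreover have "ln (2 * \<delta>\<^sup>2) = ln 2 + 2 * ln \<delta>" using \<delta>(1) by (simp add: ln_mult ln_realpow)
    moreover have "ln 2 \<le> (1::real)" using ln_le_minus_one[of "2::real"] by simp
    ultimately have L: "K \<le> - ln (2 * \<delta>\<^sup>2) / 2" by simp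
    have one: "\<bar>Im (H \<rho> (cis (x + s))) - Im (H \<rho> (cis x))\<bar> \<le> e"
      if \<rho>: "0 \<le> \<rho>" "\<rho> < 1" and s: "0 \<le> s" "s \<le> \<delta>" for \<rho> x s
    proof -
      let ?\<theta> = "\<lambda>x. x + Im (H \<rho> (cis x))"
      have m: "?\<theta> a \<le> ?\<theta> b" if "a \<le> b" for a b using mono[OF \<rho> that] by (simp add: H_def)
      have "(?\<theta> (x + \<delta>) - ?\<theta> (x - \<delta>)) * (- ln (2 * \<delta>\<^sup>2) / 2) \<le> C"
        unfolding C_def using \<delta> \<rho> by (intro conj_modulus_bound Hc Hh m HB) auto
      moreover have "?\<theta> (x + \<delta>) - ?\<theta> (x - \<delta>) \<ge> 0" using m[of "x - \<delta>" "x + \<delta>"] \<delta> by simp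
      ultimately have "(?\<theta> (x + \<delta>) - ?\<theta> (x - \<delta>)) * K \<le> C"
        using mult_left_mono[OF L] order_trans by blast
      then have "?\<theta> (x + \<delta>) - ?\<theta> (x - \<delta>) \<le> C / K" using K by (simp only: pos_le_divide_eq)
      also have "C / K = e/2" using C by (simp add: K_def)
      finally have "?\<theta> (x + \<delta>) - ?\<theta> (x - \<delta>) \<le> e/2" .
      moreover have "?\<theta> (x + s) \<le> ?\<theta> (x + \<delta>)" "?\<theta> (x - \<delta>) \<le> ?\<theta> x" "?\<theta> x \<le> ?\<theta> (x + s)" using m s \<delta> by auto
      ultimately show ?thesis using s \<delta> by linarith
    qed
    show ?thesis
    proof (intro exI[of _ \<delta>] conjI allI impI)
      show "0 < \<delta>" "\<delta> \<le> pi" using \<delta> pi_gt3 by auto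
      fix \<rho> x s :: real assume a: "0 \<le> \<rho>" "\<rho> < 1" "\<bar>s\<bar> \<le> \<delta>"
      show "\<bar>Im (H \<rho> (cis (x + s))) - Im (H \<rho> (cis x))\<bar> \<le> e"
        using one[OF a(1,2), of s x] one[OF a(1,2), of "-s" "x + s"] a(3) by (cases "0 \<le> s") auto
    qed
  qed
  have rad: "\<exists>r0. r0 < 1 \<and> 1/2 \<le> r0 \<and> (\<forall>\<rho> r x. 0 \<le> \<rho> \<longrightarrow> \<rho> < 1 \<longrightarrow> r0 \<le> r \<longrightarrow> r < 1 \<longrightarrow>
      \<bar>Im (h (of_real (\<rho> * r) * cis x)) - Im (h (of_real \<rho> * cis x))\<bar> \<le> e)" if e: "e > 0" for e
  proof -
    obtain \<delta> where \<delta>: "\<delta> > 0" "\<delta> \<le> pi"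
      "\<And>\<rho> x s. 0 \<le> \<rho> \<Longrightarrow> \<rho> < 1 \<Longrightarrow> \<bar>s\<bar> \<le> \<delta> \<Longrightarrow> \<bar>Im (H \<rho> (cis (x + s))) - Im (H \<rho> (cis x))\<bar> \<le> e/2"
      using equi[OF half_gt_zero[OF e]] by blast
    define c where "c = 4 * pi * (pi\<^sup>2 / \<delta>\<^sup>2)"
    have c: "c > 0" using \<delta> by (simp add: c_def)
    define r0 where "r0 = max (1/2) (1 - e / (2 * c))"
    have r0: "r0 < 1" "1/2 \<le> r0" "1 - e / (2*c) \<le> r0" using e c by (auto simp: r0_def)
    show ?thesis
    proof (intro exI[of _ r0] conjI allI impI r0)
      fix \<rho> r x :: real assume a: "0 \<le> \<rho>" "\<rho> < 1" "r0 \<le> r" "r < 1"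
      let ?g = "\<lambda>w. Im (H \<rho> w)"
      have gc: "continuous_on (sphere 0 1) ?g"
        by (intro continuous_on_Im continuous_on_subset[OF Hc[OF a(1,2)]]) auto
      have n: "norm (of_real r * cis x) < 1" using a r0 by (simp add: norm_mult)
      have v: "\<bar>?g (cis (x + s)) - ?g (cis x)\<bar> \<le> 4 * pi" for s
        using harmonic_Im_circle_variation[of ?g x s] mono[OF a(1,2)] unfolding H_def by blast
      have "\<bar>Re (schwarz_integral {0..2*pi} ?g (of_real r * cis x)) - ?g (cis x)\<bar> \<le> e/2 + 4 * pi * (pi\<^sup>2 * (1 - r) / \<delta>\<^sup>2)"
        using a r0 \<delta> v by (intro poisson_approximation[OF gc]) auto
      moreover have "Re (schwarz_integral {0..2*pi} ?g (of_real r * cis x)) = Im (H \<rho> (of_real r * cis x))"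
        using arg_cong[OF herglotz_representation[OF Hc[OF a(1,2)] Hh[OF a(1,2)] n], of Im] by simp
      moreover have "4 * pi * (pi\<^sup>2 * (1 - r) / \<delta>\<^sup>2) = c * (1 - r)" by (simp add: c_def)
      moreover have "c * (1 - r) \<le> c * (e / (2*c))" using a r0 c by (intro mult_left_mono) auto
      moreover have "c * (e / (2*c)) = e/2" using c by simp
      ultimately show "\<bar>Im (h (of_real (\<rho> * r) * cis x)) - Im (h (of_real \<rho> * cis x))\<bar> \<le> e"
        by (simp add: H_def mult.assoc)
    qed
  qed
  have "(\<lambda>z. - \<i> * h z) holomorphic_on ball 0 1" by (intro holomorphic_intros h)
  moreover have "\<exists>r0<1. \<forall>r\<ge>r0. \<forall>r'\<ge>r. r' < 1 \<longrightarrow>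
        (\<forall>x. \<bar>Re (- \<i> * h (of_real r * cis x)) - Re (- \<i> * h (of_real r' * cis x))\<bar> \<le> e)"
    if e0: "0 < e" for e :: real
  proof -
    from rad[OF e0] obtain r0 where r0: "r0 < 1" "1/2 \<le> r0"
      "\<And>\<rho> r x. 0 \<le> \<rho> \<Longrightarrow> \<rho> < 1 \<Longrightarrow> r0 \<le> r \<Longrightarrow> r < 1 \<Longrightarrow>
      \<bar>Im (h (of_real (\<rho> * r) * cis x)) - Im (h (of_real \<rho> * cis x))\<bar> \<le> e" by blast
    show ?thesis
    proof (intro exI[of _ r0] conjI allI impI r0(1))
      fix r r' x assume a: "r0 \<le> r" "r \<le> r'" "r' < 1"
      show "\<bar>Re (- \<i> * h (of_real r * cis x)) - Re (- \<i> * h (of_real r' * cis x))\<bar> \<le> e"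
      proof (cases "r = r'")
        case False
        have pos: "r' > 0" using a r0 by linarith
        \<comment> \<open>The inner radius is viewed as a point of the dilate by \<open>r'\<close>;
          since \<open>r' < 1\<close>, the quotient \<open>r / r'\<close> is still at least
          \<open>r0\<close>.\<close>
        then have "r' * (r / r') = r" by simp
        moreover have "r0 \<le> r / r'"
        proof -
          have "r0 * r' \<le> r * 1" using a r0 pos by (intro mult_mono) auto
          then show ?thesis using pos by (simp add: field_simps)
        qed
        moreover have "r / r' < 1" using pos a False by simp
        ultimately show ?thesis using r0(3)[of r' "r / r'" x] a pos by simp
      qed (use e0 in simp)
    qed
  qed
  ultimately show thesis by (rule radially_cauchy_extends) (use that in auto)
qed

text \<open>The gauge of \<open>f z = z * exp (h z)\<close> is
  \<open>norm z * exp (Re (h z))\<close> times the value of \<open>k\<close> at the direction of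
  \<open>f z\<close>. That direction extends continuously because \<open>V\<close> does, and the
  gauge tends to 1 at the boundary because \<open>\<phi>\<close> maps compact subsets into smaller
  discs. Taking logarithms determines \<open>Re h\<close>.\<close>

lemma star_modulus_extends:
  assumes k: "continuous_on (sphere 0 1) k" and pos: "\<And>w. norm w = 1 \<Longrightarrow> 0 < k w"
    and h: "h holomorphic_on ball 0 1" and \<phi>: "continuous_on {w. gauge_of k w < 1} \<phi>"
    and f\<phi>: "\<And>z. norm z < 1 \<Longrightarrow> gauge_of k (z * exp (h z)) < 1 \<and> \<phi> (z * exp (h z)) = z"
      "\<And>w. gauge_of k w < 1 \<Longrightarrow> norm (\<phi> w) < 1"
    and V: "continuous_on (cball 0 1) V" "\<And>z. norm z < 1 \<Longrightarrow> V z = Im (h z)"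
  obtains U where "continuous_on (cball 0 1) U" "\<And>z. norm z < 1 \<Longrightarrow> U z = Re (h z)"
proof -
  define W where "W z = ln (norm z) + ln (k (sgn z * cis (V z)))" for z
  \<comment> \<open>A compact annulus avoids the origin, where \<open>sgn\<close> and the logarithm
    in \<open>W\<close> break down, and makes \<open>W\<close> uniformly continuous.\<close>
  define A where "A = cball (0::complex) 1 - ball 0 (1/2)"
  have A0: "z \<noteq> 0" if "z \<in> A" for z using that by (auto simp: A_def)
  have cA: "compact A" unfolding A_def by (intro compact_diff) auto
  have n1: "norm (sgn z * cis (V z)) = 1" if "z \<in> A" for z using A0[OF that] by (simp add: norm_mult norm_sgn)
  have kc: "continuous_on A (\<lambda>z. k (sgn z * cis (V z)))"
    using n1 A0 by (intro continuous_on_compose2[OF k] continuous_intros continuous_on_subset[OF V(1)]) (auto simp: A_def)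
  have Wc: "continuous_on A W"
    unfolding W_def using n1 A0 pos by (intro continuous_intros kc) (force simp: less_imp_neq[symmetric])+
  have rep: "Re (h z) = ln (gauge_of k (z * exp (h z))) - W z" "0 < gauge_of k (z * exp (h z))"
    if z: "1/2 \<le> norm z" "norm z < 1" for z
  proof -
    have zA: "z \<in> A" using z by (auto simp: A_def)
    have e: "exp (h z) = of_real (exp (Re (h z))) * cis (V z)"
      using V(2)[OF z(2)] by (simp add: exp_eq_polar)
    have sg: "sgn (z * exp (h z)) = sgn z * cis (V z)"
      unfolding e by (simp add: sgn_mult sgn_of_real)
    have g: "gauge_of k (z * exp (h z)) = norm z * exp (Re (h z)) * k (sgn z * cis (V z))"
      unfolding gauge_of_def sg by (simp add: norm_mult)
    have p: "0 < k (sgn z * cis (V z))" "0 < norm z" using pos n1[OF zA] A0[OF zA] by auto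
    show "0 < gauge_of k (z * exp (h z))" unfolding g using p by simp
    show "Re (h z) = ln (gauge_of k (z * exp (h z))) - W z"
      unfolding g W_def using p by (simp add: ln_mult)
  qed
  have C: "\<exists>r0<1. \<forall>r\<ge>r0. \<forall>r'\<ge>r. r' < 1 \<longrightarrow> (\<forall>x. \<bar>Re (h (of_real r * cis x)) - Re (h (of_real r' * cis x))\<bar> \<le> e)"
    if e: "e > 0" for e :: real
  proof -
    have "uniformly_continuous_on A W" by (rule compact_uniformly_continuous[OF Wc cA])
    from uniformly_continuous_onE[OF this half_gt_zero[OF e]]
    obtain d where d: "d > 0" "\<And>x x'. x \<in> A \<Longrightarrow> x' \<in> A \<Longrightarrow> dist x' x < d \<Longrightarrow> dist (W x') (W x) < e/2"
      by blast
    \<comment> \<open>Gauge values above \<open>c\<close> have logarithm above \<open>-e/2\<close>.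
      The maximum of \<open>norm (\<phi> w)\<close> over the compact sublevel set then gives the
      radius beyond which the gauge of the image exceeds \<open>c\<close>.\<close>
    define c where "c = exp (- e/2)"
    have c: "0 < c" "c < 1" using e by (auto simp: c_def)
    let ?C = "{w. gauge_of k w \<le> c}"
    have "?C = {w. gauge_of k w \<le> 1} \<inter> {w. gauge_of k w \<le> c}" using c by auto
    moreover have "closed {w. gauge_of k w \<le> c}"
      by (intro closed_Collect_le continuous_on_gauge_of[OF k pos] continuous_intros)
    ultimately have "compact ?C" using star_domain_open_bounded(3)[OF k pos] by (metis compact_Int_closed)
    moreover have "?C \<subseteq> {w. gauge_of k w < 1}" using c by auto
    then have "continuous_on ?C (\<lambda>w. norm (\<phi> w))" by (intro continuous_intros continuous_on_subset[OF \<phi>])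
    moreover have "?C \<noteq> {}" using c by (auto intro!: exI[of _ 0])
    ultimately obtain w0 where w0: "gauge_of k w0 \<le> c" "\<And>w. gauge_of k w \<le> c \<Longrightarrow> norm (\<phi> w) \<le> norm (\<phi> w0)"
      using continuous_attains_sup[of ?C "\<lambda>w. norm (\<phi> w)"] by blast
    have nw0: "norm (\<phi> w0) < 1" using f\<phi>(2) w0(1) c by simp
    \<comment> \<open>The sign is recorded as well: two logarithms in \<open>[-e/2, 0]\<close>
      differ by at most \<open>e/2\<close>, which leaves the other half of \<open>e\<close> for
      \<open>W\<close>.\<close>
    have G: "\<bar>ln (gauge_of k (z * exp (h z)))\<bar> \<le> e/2 \<and> ln (gauge_of k (z * exp (h z))) \<le> 0"
      if z: "norm (\<phi> w0) < norm z" "1/2 \<le> norm z" "norm z < 1" for z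
    proof -
      have "c < gauge_of k (z * exp (h z))" using w0(2)[of "z * exp (h z)"] f\<phi>(1)[OF z(3)] z(1) by force
      then have "ln c < ln (gauge_of k (z * exp (h z)))" using c by simp
      moreover have "ln (gauge_of k (z * exp (h z))) < 0"
        using rep(2)[OF z(2,3)] f\<phi>(1)[OF z(3)] by simp
      ultimately show ?thesis by (simp add: c_def)
    qed
    define m where "m = Max {1/2, norm (\<phi> w0), 1 - d}"
    define r0 where "r0 = (m + 1) / 2"
    have "m < 1" "1/2 \<le> m" "norm (\<phi> w0) \<le> m" "1 - d \<le> m" using nw0 d by (auto simp: m_def)
    then have r0: "r0 < 1" "1/2 \<le> r0" "norm (\<phi> w0) < r0" "1 - d < r0" by (auto simp: r0_def)
    show ?thesis
    proof (intro exI[of _ r0] conjI allI impI r0(1))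
      fix r r' x assume a: "r0 \<le> r" "r \<le> r'" "r' < 1"
      let ?z = "of_real r * cis x" and ?z' = "of_real r' * cis x"
      have n: "norm ?z = r" "norm ?z' = r'" using a r0 by (auto simp: norm_mult)
      have "dist ?z ?z' = \<bar>r - r'\<bar>"
        unfolding dist_norm left_diff_distrib[symmetric] of_real_diff[symmetric] norm_mult norm_of_real by simp
      then have "dist ?z ?z' < d" using a r0 by simp
      moreover have "?z \<in> A" "?z' \<in> A" using n a r0 by (auto simp: A_def norm_mult)
      ultimately have "\<bar>W ?z - W ?z'\<bar> < e/2" using d(2) by (auto simp: dist_real_def)
      moreover have "Re (h ?z) = ln (gauge_of k (?z * exp (h ?z))) - W ?z" "Re (h ?z') = ln (gauge_of k (?z' * exp (h ?z'))) - W ?z'"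
        using n a r0 by (auto intro!: rep(1))
      moreover have "\<bar>ln (gauge_of k (?z * exp (h ?z)))\<bar> \<le> e/2 \<and> ln (gauge_of k (?z * exp (h ?z))) \<le> 0"
        "\<bar>ln (gauge_of k (?z' * exp (h ?z')))\<bar> \<le> e/2 \<and> ln (gauge_of k (?z' * exp (h ?z'))) \<le> 0"
        by (rule G; use n a r0 in linarith)+
      ultimately show "\<bar>Re (h ?z) - Re (h ?z')\<bar> \<le> e" by linarith
    qed
  qed
  show thesis
    by (rule radially_cauchy_extends[OF h C]) (use that in blast)+
qed

text \<open>If the boundary value lay in \<open>S\<close>, continuity of \<open>\<phi>\<close> along
  the radius would send it to \<open>cis t\<close>, a point of modulus 1.\<close>

lemma boundary_value_in_frontier:
  fixes f \<phi> :: "complex \<Rightarrow> complex"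
  assumes f: "continuous_on (cball 0 1) f" and \<phi>: "continuous_on S \<phi>" and S: "open S"
    and f\<phi>: "\<And>z. norm z < 1 \<Longrightarrow> f z \<in> S \<and> \<phi> (f z) = z" "\<And>w. w \<in> S \<Longrightarrow> norm (\<phi> w) < 1"
  shows "f (cis t) \<in> frontier S"
proof -
  have fl: "((\<lambda>\<rho>. f (of_real \<rho> * cis t)) \<longlongrightarrow> f (cis t)) (at_left 1)" by (rule radial_limit[OF f])
  have zl: "((\<lambda>\<rho>. of_real \<rho> * cis t) \<longlongrightarrow> cis t) (at_left 1)" by (rule radial_limit) simp
  have "\<forall>\<^sub>F \<rho>::real in at_left 1. \<rho> \<in> {0<..<1}" by (rule eventually_at_left_real) simp
  then have ev: "\<forall>\<^sub>F \<rho> in at_left 1. f (of_real \<rho> * cis t) \<in> S \<and> \<phi> (f (of_real \<rho> * cis t)) = of_real \<rho> * cis t"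
    by eventually_elim (rule f\<phi>(1), simp add: norm_mult)
  have "f (cis t) \<notin> S"
  proof
    assume a: "f (cis t) \<in> S"
    then have "isCont \<phi> (f (cis t))" using \<phi> S continuous_on_eq_continuous_at by blast
    from isCont_tendsto_compose[OF this fl]
    have "((\<lambda>\<rho>. of_real \<rho> * cis t) \<longlongrightarrow> \<phi> (f (cis t))) (at_left 1)"
      by (rule Lim_transform_eventually) (use ev in eventually_elim, simp)
    then have "\<phi> (f (cis t)) = cis t" using zl by (intro tendsto_unique[of "at_left 1"]) auto
    then show False using f\<phi>(2)[OF a] by simp
  qed
  moreover have "f (cis t) \<in> closure S"
    by (rule Lim_in_closed_set[OF closed_closure _ _ fl])
      (use ev closure_subset in \<open>auto elim!: eventually_mono\<close>)
  ultimately show ?thesis using S by (simp add: frontier_def interior_open)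
qed

text \<open>The normalisation \<open>Im (H 1) = 0\<close> makes \<open>t + Im (H (cis t))\<close>
  fix both 0 and \<open>2 * pi\<close>, so the boundary argument maps the parameter interval to
  itself.\<close>

theorem star_riemann_map_extends:
  assumes k: "continuous_on (sphere 0 1) k" and pos: "\<And>w. norm w = 1 \<Longrightarrow> 0 < k w"
  defines "S \<equiv> {w. gauge_of k w < 1}"
  obtains H \<phi> where "continuous_on (cball 0 1) H" "H holomorphic_on ball 0 1" "\<phi> holomorphic_on S"
    "\<And>z. norm z < 1 \<Longrightarrow> z * exp (H z) \<in> S \<and> \<phi> (z * exp (H z)) = z"
    "\<And>w. w \<in> S \<Longrightarrow> norm (\<phi> w) < 1 \<and> \<phi> w * exp (H (\<phi> w)) = w"
    "\<And>x y. x \<le> y \<Longrightarrow> x + Im (H (cis x)) \<le> y + Im (H (cis y))" "Im (H 1) = 0"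
proof -
  note sd = star_domain_open_bounded[OF k pos, folded S_def]
  have S0: "0 \<in> S" by (simp add: S_def)
  have sc: "of_real s * w \<in> S" if "w \<in> S" "0 \<le> s" "s \<le> 1" for w s
  proof (cases "s = 1")
    case False
    have "s * gauge_of k w \<le> s * 1" using that by (intro mult_left_mono) (auto simp: S_def)
    then show ?thesis using that False by (simp add: S_def gauge_of_scale)
  qed (use that in simp)
  obtain f \<phi> where f: "f holomorphic_on ball 0 1" "\<phi> holomorphic_on S" "f 0 = 0" "\<phi> 0 = 0"
    "\<And>z. norm z < 1 \<Longrightarrow> f z \<in> S \<and> \<phi> (f z) = z" "\<And>w. w \<in> S \<Longrightarrow> norm (\<phi> w) < 1 \<and> f (\<phi> w) = w"
    using riemann_map_at_0[OF sd(1) starlike_imp_simply_connected[OF sd(4)] sd(5) S0] by blast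
  have "inj_on f (ball 0 1)" using f(5) by (intro inj_on_inverseI[of _ \<phi>]) auto
  then obtain h where h: "h holomorphic_on ball 0 1" "\<And>z. norm z < 1 \<Longrightarrow> f z = z * exp (h z)"
    using injective_factor_exp[OF f(1,3)] by blast
  have hf: "\<And>z. norm z < 1 \<Longrightarrow> z * exp (h z) \<in> S \<and> \<phi> (z * exp (h z)) = z"
    using f(5) h(2) by metis
  have mono: "x + Im (h (of_real \<rho> * cis x)) \<le> y + Im (h (of_real \<rho> * cis y))"
    if "0 \<le> \<rho>" "\<rho> < 1" "x \<le> y" for \<rho> x y
    using starlike_argument_mono[OF h(1) f(2) sd(1) sc hf _ that] f(6) by blast
  obtain B where B: "\<And>z. norm z < 1 \<Longrightarrow> \<bar>Re (h z)\<bar> \<le> B"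
  proof -
    \<comment> \<open>Away from the centre \<open>norm (f z)\<close> is bounded below by continuity
      of \<open>\<phi>\<close> at 0 and above by boundedness of \<open>S\<close>; near the centre
      \<open>h\<close> is bounded by compactness. Together these bound \<open>Re h\<close>.\<close>
    have "isCont \<phi> 0" using f(2) S0 sd(1) holomorphic_on_imp_continuous_on continuous_on_eq_continuous_at by blast
    then have "\<exists>d>0. \<forall>w. dist w 0 < d \<longrightarrow> dist (\<phi> w) (\<phi> 0) < 1/2"
      unfolding continuous_at_eps_delta by (metis half_gt_zero zero_less_one)
    then obtain d where d: "d > 0" "\<And>w. norm w < d \<Longrightarrow> norm (\<phi> w) < 1/2" using f(4) by auto
    obtain M where M: "\<And>w. w \<in> S \<Longrightarrow> norm w \<le> M" using sd(2) by (auto simp: bounded_iff)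
    have "compact (h ` cball 0 (1/2))"
      by (intro compact_continuous_image continuous_on_subset[OF holomorphic_on_imp_continuous_on[OF h(1)]]) auto
    then obtain C where C: "\<And>z. z \<in> cball 0 (1/2) \<Longrightarrow> norm (h z) \<le> C"
      using compact_imp_bounded[of "h ` cball 0 (1/2)"] unfolding bounded_iff by blast
    have "\<bar>Re (h z)\<bar> \<le> max C (max \<bar>ln d\<bar> \<bar>ln (2*M)\<bar>)" if z: "norm z < 1" for z
    proof (cases "norm z \<le> 1/2")
      case True
      then show ?thesis using C[of z] abs_Re_le_cmod[of "h z"] by simp
    next
      case False
      have fz: "norm (f z) = norm z * exp (Re (h z))" using h(2)[OF z] by (simp add: norm_mult)
      have "d \<le> norm (f z)" using d(2)[of "f z"] f(5)[OF z] False by force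
      also have "\<dots> \<le> 1 * exp (Re (h z))" unfolding fz using z by (intro mult_right_mono) auto
      finally have 1: "ln d \<le> Re (h z)" using d(1) ln_mono[of d "exp (Re (h z))"] by simp
      have "1/2 * exp (Re (h z)) \<le> norm (f z)" unfolding fz using False by (intro mult_right_mono) auto
      also have "\<dots> \<le> M" using M f(5)[OF z] by blast
      finally have "exp (Re (h z)) \<le> 2 * M" by simp
      then have "Re (h z) \<le> ln (2 * M)" using ln_mono[of "exp (Re (h z))" "2 * M"] by simp
      then show ?thesis using 1 by linarith
    qed
    then show thesis using that by blast
  qed
  obtain V where V: "continuous_on (cball 0 1) V" "\<And>z. norm z < 1 \<Longrightarrow> V z = Im (h z)"
    using star_argument_extends[OF h(1) mono B] by blast
  obtain U where U: "continuous_on (cball 0 1) U" "\<And>z. norm z < 1 \<Longrightarrow> U z = Re (h z)"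
    using star_modulus_extends[OF k pos h(1) _ _ _ V] holomorphic_on_imp_continuous_on[OF f(2)] hf f(6)
    unfolding S_def by blast
  define \<theta> where "\<theta> t = t + V (cis t)" for t
  have \<theta>c: "continuous_on A \<theta>" for A unfolding \<theta>_def
    by (intro continuous_intros continuous_on_compose2[OF V(1)]) auto
  have \<theta>m: "\<theta> x \<le> \<theta> y" if xy: "x \<le> y" for x y
  proof -
    have lim: "((\<lambda>\<rho>. t + V (of_real \<rho> * cis t)) \<longlongrightarrow> \<theta> t) (at_left 1)" for t
      unfolding \<theta>_def by (intro tendsto_intros radial_limit V)
    have "\<forall>\<^sub>F \<rho>::real in at_left 1. \<rho> \<in> {0<..<1}" by (rule eventually_at_left_real) simp
    then have "\<forall>\<^sub>F \<rho> in at_left 1. x + V (of_real \<rho> * cis x) \<le> y + V (of_real \<rho> * cis y)"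
      by eventually_elim (use mono[OF _ _ xy] V(2) in \<open>auto simp: norm_mult\<close>)
    then show ?thesis using lim[of x] lim[of y] by (intro tendsto_le[of "at_left 1"]) auto
  qed
  obtain K where K: "\<And>z. z \<in> cball 0 1 \<Longrightarrow> norm (V z) \<le> K"
    using compact_imp_bounded[OF compact_continuous_image[OF V(1) compact_cball]] unfolding bounded_iff by blast
  \<comment> \<open>As \<open>\<theta> t\<close> differs from \<open>t\<close> by at most
    \<open>K\<close>, it takes the value 0 in \<open>[-K, K]\<close>.\<close>
  have "\<theta> (-K) \<le> 0" "0 \<le> \<theta> K" "-K \<le> K" using K[of "cis (-K)"] K[of "cis K"] K[of 0] by (auto simp: \<theta>_def)
  then obtain t0 where t0: "\<theta> t0 = 0" using IVT'[of \<theta> "-K" 0 K] \<theta>c by blast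
  let ?c = "cis t0"
  \<comment> \<open>Precomposing with the rotation by \<open>t0\<close> multiplies the factor
    \<open>z\<close> by \<open>cis t0\<close>; adding \<open>\<i> * t0\<close> to the exponent
    absorbs this, so that \<open>z * exp (H z)\<close> is the rotated Riemann map.\<close>
  define H where "H z = of_real (U (?c * z)) + \<i> * of_real (V (?c * z) + t0)" for z
  have Hh: "H z = h (?c * z) + \<i> * of_real t0" if "norm z < 1" for z
    using U(2)[of "?c * z"] V(2)[of "?c * z"] that by (simp add: H_def norm_mult complex_eq_iff)
  have nc: "norm (?c * z) < 1" if "norm z < 1" for z using that by (simp add: norm_mult)
  have He: "z * exp (H z) = f (?c * z)" if "norm z < 1" for z
    using h(2)[OF nc[OF that]] Hh[OF that] by (simp add: exp_add cis_conv_exp mult_ac)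
  show thesis
  proof (rule that[of H "\<lambda>w. cis (-t0) * \<phi> w"])
    show "continuous_on (cball 0 1) H" unfolding H_def
      by (intro continuous_intros continuous_on_compose2[OF U(1)] continuous_on_compose2[OF V(1)]) (auto simp: norm_mult)
    have "h \<circ> (\<lambda>z. ?c * z) holomorphic_on ball 0 1"
      using nc by (intro holomorphic_on_compose_gen[OF _ h(1)] holomorphic_intros) auto
    then have "(\<lambda>z. h (?c * z) + \<i> * of_real t0) holomorphic_on ball 0 1" by (intro holomorphic_intros) (simp add: o_def)
    then show "H holomorphic_on ball 0 1" by (rule holomorphic_transform) (use Hh in simp)
    show "(\<lambda>w. cis (-t0) * \<phi> w) holomorphic_on S" by (intro holomorphic_intros f(2))
    have cc: "cis (-t0) * (?c * z) = z" for z by (simp add: cis_mult flip: mult.assoc)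
    show "z * exp (H z) \<in> S \<and> cis (-t0) * \<phi> (z * exp (H z)) = z" if "norm z < 1" for z
      using f(5)[OF nc[OF that]] cc by (simp add: He[OF that])
    show "norm (cis (-t0) * \<phi> w) < 1 \<and> cis (-t0) * \<phi> w * exp (H (cis (-t0) * \<phi> w)) = w" if "w \<in> S" for w
    proof -
      have 1: "norm (cis (-t0) * \<phi> w) < 1" using f(6)[OF that] by (simp add: norm_mult)
      have "?c * (cis (-t0) * \<phi> w) = \<phi> w" by (simp add: cis_mult flip: mult.assoc)
      then have 2: "f (?c * (cis (-t0) * \<phi> w)) = w" using f(6)[OF that] by metis
      show ?thesis using 1 He[OF 1] unfolding 2 by blast
    qed
    have Im: "x + Im (H (cis x)) = \<theta> (x + t0)" for x by (simp add: H_def \<theta>_def cis_mult add.commute)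
    show "x + Im (H (cis x)) \<le> y + Im (H (cis y))" if "x \<le> y" for x y
      unfolding Im using \<theta>m that by simp
    show "Im (H 1) = 0" using Im[of 0] t0 by simp
  qed
qed

section \<open>The integral condition\<close>

text \<open>Monotone convergence as the lower end tends to 0. It admits integrands with a
  singularity at 0, for which only integrals over \<open>[a, d]\<close> are estimated
  directly.\<close>

lemma nn_integral_open_interval_le:
  fixes \<phi> :: "real \<Rightarrow> real"
  assumes d: "0 < d" and c: "continuous_on {0<..d} \<phi>" and nn: "\<And>s. 0 < s \<Longrightarrow> s \<le> d \<Longrightarrow> 0 \<le> \<phi> s"
    and le: "\<And>a. 0 < a \<Longrightarrow> a < d \<Longrightarrow> integral {a..d} \<phi> \<le> C"
  shows "(\<integral>\<^sup>+s\<in>{0<..<d}. ennreal (\<phi> s) \<partial>lborel) \<le> ennreal C"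
proof -
  define a where "a n = d / real (n + 2)" for n :: nat
  have a: "0 < a n" "a n < d" for n using d by (auto simp: a_def field_simps add_pos_nonneg)
  have am: "a n \<le> a m" if "m \<le> n" for m n using d that by (simp add: a_def frac_le)
  define f where "f n s = ennreal (indicator {a n..d} s * \<phi> s)" for n s
  have mf: "f n \<in> borel_measurable lborel" for n
  proof -
    have "continuous_on {a n..d} \<phi>" using a[of n] by (intro continuous_on_subset[OF c]) auto
    then have "(\<lambda>s. indicator {a n..d} s *\<^sub>R \<phi> s) \<in> borel_measurable borel"
      by (intro borel_measurable_continuous_on_indicator) auto
    then show ?thesis by (simp add: f_def[abs_def])
  qed
  have inc: "incseq f"
    unfolding incseq_def le_fun_def
  proof (intro allI impI)
    fix m n s assume "m \<le> (n::nat)"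
    then have "indicator {a m..d} s * \<phi> s \<le> indicator {a n..d} s * \<phi> s"
      using am[of m n] a[of n] nn[of s] by (auto simp: indicator_def)
    then show "f m s \<le> f n s" unfolding f_def by (rule ennreal_leI)
  qed
  have "(\<integral>\<^sup>+s\<in>{0<..<d}. ennreal (\<phi> s) \<partial>lborel) \<le> (\<integral>\<^sup>+s. (SUP n. f n s) \<partial>lborel)"
  proof (rule nn_integral_mono)
    fix s
    show "ennreal (\<phi> s) * indicator {0<..<d} s \<le> (SUP n. f n s)"
    proof (cases "s \<in> {0<..<d}")
      case True
      then obtain n where "d / s < real n" using reals_Archimedean2 by blast
      then have "a n \<le> s" using True d by (simp add: a_def field_simps)
      then have "f n s = ennreal (\<phi> s)" using True by (simp add: f_def)
      then show ?thesis using True SUP_upper[of n UNIV "\<lambda>n. f n s"] by simp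
    qed simp
  qed
  also have "\<dots> = (SUP n. (\<integral>\<^sup>+s. f n s \<partial>lborel))"
    by (rule nn_integral_monotone_convergence_SUP[OF inc mf])
  also have "\<dots> \<le> ennreal C"
  proof (rule SUP_least)
    fix n
    have "continuous_on {a n..d} \<phi>" using a[of n] by (intro continuous_on_subset[OF c]) auto
    then have "(\<phi> has_integral integral {a n..d} \<phi>) {a n..d}"
      using integrable_continuous_real integrable_integral by blast
    then have "(\<integral>\<^sup>+s. ennreal (indicator {a n..d} s * \<phi> s) \<partial>lborel) = ennreal (integral {a n..d} \<phi>)"
      using nn a[of n] by (intro nn_integral_has_integral_lebesgue) auto
    then show "(\<integral>\<^sup>+s. f n s \<partial>lborel) \<le> ennreal C" using le[OF a] by (simp add: f_def ennreal_leI)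
  qed
  finally show ?thesis .
qed

text \<open>The measure \<open>dt / t\<close> is invariant under scaling, so changing between angles
  and fractions of a turn changes only the range of integration.\<close>

lemma nn_integral_rescale:
  fixes m :: "real \<Rightarrow> real"
  assumes m: "m \<in> borel_measurable borel" and c: "0 < c"
  shows "(\<integral>\<^sup>+s\<in>{0<..<d}. ennreal ((m (y + s / c) - m (y - s / c)) / s) \<partial>lborel) =
    (\<integral>\<^sup>+t\<in>{0<..<d / c}. ennreal ((m (y + t) - m (y - t)) / t) \<partial>lborel)"
proof -
  note [measurable] = m
  let ?f = "\<lambda>s. ennreal ((m (y + s / c) - m (y - s / c)) / s) * indicator {0<..<d} s"
  have "?f \<in> borel_measurable lborel" by measurable
  then have "(\<integral>\<^sup>+s. ?f s \<partial>lborel) = ennreal \<bar>c\<bar> * (\<integral>\<^sup>+t. ?f (0 + c * t) \<partial>lborel)"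
    using c by (intro nn_integral_real_affine) auto
  also have "\<dots> = (\<integral>\<^sup>+t. ennreal \<bar>c\<bar> * ?f (0 + c * t) \<partial>lborel)"
    by (intro nn_integral_cmult[symmetric]) measurable
  also have "\<dots> = (\<integral>\<^sup>+t. ennreal ((m (y + t) - m (y - t)) / t) * indicator {0<..<d / c} t \<partial>lborel)"
  proof (rule nn_integral_cong)
    fix t :: real
    have i: "indicator {0<..<d} (c * t) = (indicator {0<..<d / c} t :: ennreal)"
      using c by (auto simp: indicator_def field_simps zero_less_mult_iff)
    have "ennreal c * ennreal ((m (y + t) - m (y - t)) / (c * t)) = ennreal (c * ((m (y + t) - m (y - t)) / (c * t)))"
      by (rule ennreal_mult'[symmetric]) (use c in simp)
    also have "c * ((m (y + t) - m (y - t)) / (c * t)) = (m (y + t) - m (y - t)) / t" using c by simp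
    finally have e: "ennreal c * ennreal ((m (y + t) - m (y - t)) / (c * t)) = ennreal ((m (y + t) - m (y - t)) / t)" .
    have "(0 + c * t) / c = t" "\<bar>c\<bar> = c" "0 + c * t = c * t" using c by auto
    then show "ennreal \<bar>c\<bar> * ?f (0 + c * t) = ennreal ((m (y + t) - m (y - t)) / t) * indicator {0<..<d / c} t"
      by (simp only: i mult.assoc[symmetric] e)
  qed
  finally show ?thesis .
qed

lemma integral_le_nn_integral:
  fixes f \<phi> :: "real \<Rightarrow> real"
  assumes f: "continuous_on {0..d} f" and le: "\<And>s. 0 < s \<Longrightarrow> s < d \<Longrightarrow> \<bar>f s\<bar> \<le> \<phi> s"
    and I: "(\<integral>\<^sup>+s\<in>{0<..<d}. ennreal (\<phi> s) \<partial>lborel) \<le> ennreal C" and C: "0 \<le> C"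
  shows "\<bar>integral {0..d} f\<bar> \<le> C"
proof -
  have i: "f integrable_on {0..d}" "(\<lambda>s. \<bar>f s\<bar>) integrable_on {0..d}"
    by (intro integrable_continuous_real continuous_intros f)+
  have "((\<lambda>s. \<bar>f s\<bar>) has_integral integral {0..d} (\<lambda>s. \<bar>f s\<bar>)) {0<..<d}"
    using i(2) by (metis has_integral_Icc_iff_Ioo integrable_integral)
  then have "ennreal (integral {0..d} (\<lambda>s. \<bar>f s\<bar>)) = (\<integral>\<^sup>+s. ennreal \<bar>f s\<bar> * indicator {0<..<d} s \<partial>lborel)"
    by (intro nn_integral_has_integral_lebesgue'[symmetric]) auto
  also have "\<dots> \<le> (\<integral>\<^sup>+s. ennreal (\<phi> s) * indicator {0<..<d} s \<partial>lborel)"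
    using le by (intro nn_integral_mono) (auto simp: indicator_def intro!: ennreal_leI)
  also note I
  finally have "integral {0..d} (\<lambda>s. \<bar>f s\<bar>) \<le> C" using C by (simp add: ennreal_le_iff)
  moreover have "norm (integral {0..d} f) \<le> integral {0..d} (\<lambda>s. \<bar>f s\<bar>)"
    by (rule integral_norm_bound_integral[OF i]) auto
  ultimately show ?thesis by simp
qed

text \<open>The integrand is an extended nonnegative number, so the integrals increase with the
  range and one good \<open>d\<close> serves all smaller ones. This turns the limit of suprema into
  a bound uniform in \<open>x\<close>.\<close>

lemma dini_condition_iff:
  fixes m :: "real \<Rightarrow> real"
  shows "((\<lambda>\<delta>. SUP x::real. \<integral>\<^sup>+t\<in>{0<..<\<delta>}. ennreal ((m (x + t) - m (x - t)) / t) \<partial>lborel) \<longlongrightarrow> 0) (at_right 0)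
    \<longleftrightarrow> (\<forall>e>0. \<exists>d>0. \<forall>x. (\<integral>\<^sup>+t\<in>{0<..<d}. ennreal ((m (x + t) - m (x - t)) / t) \<partial>lborel) \<le> ennreal e)"
    (is "(?F \<longlongrightarrow> 0) _ \<longleftrightarrow> ?R")
proof
  assume L: "(?F \<longlongrightarrow> 0) (at_right 0)"
  show ?R
  proof (intro allI impI)
    fix e :: real assume "e > 0"
    then have "\<forall>\<^sub>F \<delta> in at_right 0. ?F \<delta> < ennreal e" using L by (intro order_tendstoD(2)) auto
    then obtain b where b: "b > 0" "\<And>y. 0 < y \<Longrightarrow> y < b \<Longrightarrow> ?F y < ennreal e"
      unfolding eventually_at_right_field by blast
    have "?F (b/2) \<le> ennreal e" using b by (intro less_imp_le) auto
    then show "\<exists>d>0. \<forall>x. (\<integral>\<^sup>+t\<in>{0<..<d}. ennreal ((m (x + t) - m (x - t)) / t) \<partial>lborel) \<le> ennreal e"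
      using b(1) by (intro exI[of _ "b/2"]) (simp add: SUP_le_iff)
  qed
next
  assume R: ?R
  show "(?F \<longlongrightarrow> 0) (at_right 0)"
  proof (rule order_tendstoI)
    fix a :: ennreal assume "0 < a"
    then obtain y where y: "0 < y" "y < a" using dense by blast
    then obtain e where e: "y = ennreal e" "e > 0" by (cases y) (auto simp: top.not_eq_extremum[symmetric] ennreal_less_zero_iff)
    then obtain d where d: "d > 0" "\<And>x. (\<integral>\<^sup>+t\<in>{0<..<d}. ennreal ((m (x + t) - m (x - t)) / t) \<partial>lborel) \<le> ennreal e"
      using R by blast
    have "?F \<delta> < a" if "0 < \<delta>" "\<delta> < d" for \<delta>
    proof -
      have "?F \<delta> \<le> ennreal e"
      proof (rule SUP_least)
        fix x
        have "(\<integral>\<^sup>+t\<in>{0<..<\<delta>}. ennreal ((m (x + t) - m (x - t)) / t) \<partial>lborel) \<le> (\<integral>\<^sup>+t\<in>{0<..<d}. ennreal ((m (x + t) - m (x - t)) / t) \<partial>lborel)"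
          using that by (intro nn_integral_mono) (auto simp: indicator_def)
        then show "(\<integral>\<^sup>+t\<in>{0<..<\<delta>}. ennreal ((m (x + t) - m (x - t)) / t) \<partial>lborel) \<le> ennreal e" using d(2) order_trans by blast
      qed
      then show ?thesis using y e by simp
    qed
    then show "\<forall>\<^sub>F \<delta> in at_right 0. ?F \<delta> < a" using d(1) unfolding eventually_at_right_field by blast
  qed simp
qed

text \<open>For \<open>r \<le> r'\<close> the difference \<open>conj_poisson r' s - conj_poisson r s\<close> is nonnegative, and for \<open>s \<le> 1 - r\<close> it is at
  least \<open>1 / (4 * s)\<close> up to a term vanishing as \<open>r'\<close> tends to 1.  The increments of \<open>\<theta>\<close> being nonnegative, uniform
  continuity of \<open>Re h\<close> along radii bounds the integral near zero.\<close>

lemma dini_condition_of_extension: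
  assumes ch: "continuous_on (cball 0 1) h" and hh: "h holomorphic_on ball 0 1"
    and mono: "\<And>x y. x \<le> y \<Longrightarrow> x + Im (h (cis x)) \<le> y + Im (h (cis y))"
  defines "\<theta> \<equiv> \<lambda>x. x + Im (h (cis x))"
  assumes e: "0 < e" "e \<le> 1"
  shows "\<exists>d>0. \<forall>x. (\<integral>\<^sup>+s\<in>{0<..<d}. ennreal ((\<theta> (x + s) - \<theta> (x - s)) / s) \<partial>lborel) \<le> ennreal (28 * e)"
proof -
  have "uniformly_continuous_on (cball 0 1) (\<lambda>z. Re (h z))"
    by (intro compact_uniformly_continuous continuous_intros ch compact_cball)
  from uniformly_continuous_onE[OF this e(1)]
  obtain d1 where d1: "d1 > 0" "\<And>z z'. z \<in> cball 0 1 \<Longrightarrow> z' \<in> cball 0 1 \<Longrightarrow> dist z' z < d1 \<Longrightarrow> dist (Re (h z')) (Re (h z)) < e"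
    by blast
  \<comment> \<open>The bound \<open>1/2\<close> keeps \<open>r\<close> in the range of the kernel
    estimates, \<open>d1/2\<close> makes any two radii in \<open>[r, 1)\<close> closer than
    \<open>d1\<close>, and the cubic term makes the part of the linear increment away from zero at
    most \<open>e\<close>.\<close>
  define d where "d = min (min (1/2) (d1/2)) (e ^ 3 / (2 * pi ^ 3))"
  have d: "0 < d" "d \<le> 1/2" "d < d1" "d \<le> e ^ 3 / (2 * pi ^ 3)" using e d1 by (auto simp: d_def)
  define r where "r = 1 - d"
  have r: "1/2 \<le> r" "r < 1" "0 \<le> r" using d by (auto simp: r_def)
  have c\<theta>: "continuous_on A (\<lambda>t. Im (h (cis (c t))))" if "continuous_on A c" for c and A :: "real set"
    using that by (intro continuous_on_Im continuous_on_compose2[OF ch] continuous_intros) auto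
  show ?thesis
  proof (intro exI[of _ d] conjI allI d(1))
    fix x :: real
    let ?\<Delta> = "\<lambda>s. \<theta> (x + s) - \<theta> (x - s)"
    have cD: "continuous_on A ?\<Delta>" for A unfolding \<theta>_def by (intro continuous_intros c\<theta>)
    have D0: "0 \<le> ?\<Delta> s" if "0 \<le> s" for s using mono[of "x - s" "x + s"] that by (simp add: \<theta>_def)
    \<comment> \<open>The constant is \<open>4 * pi\<close> for each of the two arguments plus at
      most \<open>2 * pi\<close> from the linear term.\<close>
    have D1: "?\<Delta> s \<le> 10 * pi" if "s \<le> pi" for s
    proof -
      have "\<bar>Im (h (cis (x + s))) - Im (h (cis x))\<bar> \<le> 4 * pi" "\<bar>Im (h (cis (x + - s))) - Im (h (cis x))\<bar> \<le> 4 * pi"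
        using harmonic_Im_circle_variation[of "\<lambda>w. Im (h w)", OF mono] by blast+
      then show ?thesis using that unfolding \<theta>_def by (simp add: abs_le_iff)
    qed
    have key: "integral {a..d} (\<lambda>s. ?\<Delta> s / s) \<le> 28 * e" if a: "0 < a" "a < d" for a
    proof -
      have iD: "(\<lambda>s. ?\<Delta> s / (4 * s)) integrable_on {a..d}"
        using a by (intro integrable_continuous_real continuous_intros cD) auto
      have "integral {a..d} (\<lambda>s. ?\<Delta> s / (4 * s)) \<le> 7 * e"
      proof (rule field_le_epsilon)
        fix c :: real assume c: "0 < c"
        \<comment> \<open>The kernel at \<open>r'\<close> differs from its limit by a term of order
          \<open>(1 - r')\<^sup>2 / s ^ 3\<close>. Since \<open>s\<close> stays above
          \<open>a\<close>, \<open>r'\<close> can be taken so close to 1 that this error times the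
          increment, which is at most \<open>10 * pi\<close>, is at most \<open>c\<close>.\<close>
        define r' where "r' = max r (1 - c * a ^ 3 / (10 * pi ^ 3))"
        have r': "r \<le> r'" "r' < 1" "1 - c * a ^ 3 / (10 * pi ^ 3) \<le> r'" using r c a by (auto simp: r'_def)
        let ?q = "\<lambda>s. conj_poisson r' s - conj_poisson r s"
        have iq: "(\<lambda>s. ?q s * f s) integrable_on {u..v}" if "continuous_on {u..v} f" for f u v
          using r r' by (intro integrable_continuous_real continuous_intros that) auto
        have cDi: "continuous_on A (\<lambda>s. Im (h (cis (x + s))) - Im (h (cis (x - s))))" for A
          by (intro continuous_intros c\<theta>)
        have "integral {0..pi} (\<lambda>s. ?q s * (Im (h (cis (x + s))) - Im (h (cis (x - s))))) =
          pi * (Re (h (of_real r' * cis x)) - Re (h 0)) - pi * (Re (h (of_real r * cis x)) - Re (h 0))"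
          unfolding left_diff_distrib[of "conj_poisson r' _"]
          using r r' by (subst integral_diff) (auto intro!: herglotz_Re_difference[OF ch hh] integrable_continuous_real continuous_intros cDi arg_cong2[of _ _ _ _ minus])
        also have "\<dots> = pi * (Re (h (of_real r' * cis x)) - Re (h (of_real r * cis x)))" by (simp add: algebra_simps)
        also have "\<dots> \<le> pi * e"
        proof (intro mult_left_mono)
          have "dist (of_real r' * cis x) (of_real r * cis x) = \<bar>r' - r\<bar>"
            unfolding dist_norm left_diff_distrib[symmetric] of_real_diff[symmetric] norm_mult norm_of_real by simp
          then have "dist (of_real r' * cis x) (of_real r * cis x) < d1" using r' d by (simp add: r_def)
          then have "dist (Re (h (of_real r' * cis x))) (Re (h (of_real r * cis x))) < e"
            using r r' by (intro d1(2)) (auto simp: norm_mult)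
          then show "Re (h (of_real r' * cis x)) - Re (h (of_real r * cis x)) \<le> e" by (simp add: dist_real_def)
        qed simp
        finally have A: "integral {0..pi} (\<lambda>s. ?q s * (Im (h (cis (x + s))) - Im (h (cis (x - s))))) \<le> pi * e" .
        \<comment> \<open>The linear increment is split at \<open>s = e\<close>: below, the bound
          \<open>1 / s\<close> gives at most \<open>2 * e\<close>; above, the cubic bound and the
          choice of \<open>d\<close> give at most \<open>e\<close>.\<close>
        have B: "integral {0..pi} (\<lambda>s. ?q s * (2 * s)) \<le> 3 * e"
        proof -
          have epi: "e \<le> pi" using e pi_gt3 by simp
          have "integral {0..pi} (\<lambda>s. ?q s * (2 * s)) = integral {0..e} (\<lambda>s. ?q s * (2 * s)) + integral {e..pi} (\<lambda>s. ?q s * (2 * s))"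
            using e epi by (intro Henstock_Kurzweil_Integration.integral_combine[symmetric] iq continuous_intros) auto
          also have "integral {0..e} (\<lambda>s. ?q s * (2 * s)) \<le> integral {0..e} (\<lambda>s. 2)"
          proof (intro integral_le iq continuous_intros)
            fix s assume s: "s \<in> {0..e}"
            show "?q s * (2 * s) \<le> 2"
            proof (cases "s = 0")
              case False
              then have "?q s * (2 * s) \<le> 1 / s * (2 * s)"
                using s r r' epi by (intro mult_right_mono conj_poisson_diff_le) auto
              then show ?thesis using False by simp
            qed simp
          qed auto
          also have "integral {0..e} (\<lambda>s. 2 :: real) = 2 * e" using e by simp
          also have "integral {e..pi} (\<lambda>s. ?q s * (2 * s)) \<le> integral {e..pi} (\<lambda>s. 2 * (pi\<^sup>2 * d\<^sup>2 / e\<^sup>2))"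
          proof (intro integral_le iq continuous_intros)
            fix s assume s: "s \<in> {e..pi}"
            then have s0: "s > 0" using e by auto
            have "?q s * (2 * s) \<le> (pi\<^sup>2 * (1 - r)\<^sup>2 / s ^ 3) * (2 * s)"
              using s s0 r r' by (intro mult_right_mono conj_poisson_diff_le) auto
            also have "\<dots> = 2 * (pi\<^sup>2 * d\<^sup>2 / s\<^sup>2)" using s0 by (simp add: r_def power2_eq_square power3_eq_cube)
            also have "\<dots> \<le> 2 * (pi\<^sup>2 * d\<^sup>2 / e\<^sup>2)" using s e by (intro mult_left_mono divide_left_mono power_mono mult_pos_pos) auto
            finally show "?q s * (2 * s) \<le> 2 * (pi\<^sup>2 * d\<^sup>2 / e\<^sup>2)" .
          qed auto
          also have "integral {e..pi} (\<lambda>s. 2 * (pi\<^sup>2 * d\<^sup>2 / e\<^sup>2)) = (pi - e) * (2 * (pi\<^sup>2 * d\<^sup>2 / e\<^sup>2))" using epi by simp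
          also have "\<dots> \<le> pi * (2 * (pi\<^sup>2 * d\<^sup>2 / e\<^sup>2))" using e by (intro mult_right_mono) auto
          also have "\<dots> = 2 * pi ^ 3 * d\<^sup>2 / e\<^sup>2" by (simp add: power2_eq_square power3_eq_cube)
          also have "\<dots> \<le> e"
          proof -
            have "d\<^sup>2 \<le> 1 * d" unfolding power2_eq_square using d by (intro mult_right_mono) auto
            then have "2 * pi ^ 3 * d\<^sup>2 \<le> 2 * pi ^ 3 * (e ^ 3 / (2 * pi ^ 3))" using d by (intro mult_left_mono) auto
            also have "\<dots> = e * e\<^sup>2" by (simp add: power2_eq_square power3_eq_cube)
            finally show ?thesis using e by (simp add: pos_divide_le_eq)
          qed
          finally show ?thesis by simp
        qed
        have "integral {0..pi} (\<lambda>s. ?q s * ?\<Delta> s) = integral {0..pi} (\<lambda>s. ?q s * (Im (h (cis (x + s))) - Im (h (cis (x - s))))) + integral {0..pi} (\<lambda>s. ?q s * (2 * s))"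
        proof -
          have "?q s * ?\<Delta> s = ?q s * (Im (h (cis (x + s))) - Im (h (cis (x - s)))) + ?q s * (2 * s)" for s
            unfolding distrib_left[symmetric] by (simp add: \<theta>_def)
          then show ?thesis by (simp only:) (intro integral_add iq cDi continuous_intros)
        qed
        \<comment> \<open>Here \<open>pi + 3\<close> is rounded up to 7; the factor 4 from the
          kernel bound \<open>1 / (4 * s)\<close> then gives the 28 of the conclusion.\<close>
        also have "\<dots> \<le> pi * e + 3 * e" using A B by simp
        also have "\<dots> \<le> 7 * e" using e pi_less_4 mult_right_mono[of pi 4 e] by simp
        finally have I: "integral {0..pi} (\<lambda>s. ?q s * ?\<Delta> s) \<le> 7 * e" .
        have "integral {a..d} (\<lambda>s. ?\<Delta> s / (4 * s)) \<le> integral {a..d} (\<lambda>s. ?q s * ?\<Delta> s + c)"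
        proof (intro integral_le iD integrable_add iq cD)
          fix s assume s: "s \<in> {a..d}"
          then have s0: "0 < s" "s \<le> pi" "s \<le> 1 - r" using a d pi_gt3 by (auto simp: r_def)
          have q: "1 / (4 * s) - pi\<^sup>2 * (1 - r')\<^sup>2 / s ^ 3 \<le> ?q s"
            using conj_poisson_defect_ge[OF r(1,2) s0(1,3)] conj_poisson_defect_le(1)[of r' s] r r' s0 by auto
          have "1 / (4 * s) * ?\<Delta> s - pi\<^sup>2 * (1 - r')\<^sup>2 / s ^ 3 * ?\<Delta> s \<le> ?q s * ?\<Delta> s"
            unfolding left_diff_distrib[symmetric] using D0[of s] s0 by (intro mult_right_mono q) auto
          moreover have "pi\<^sup>2 * (1 - r')\<^sup>2 / s ^ 3 * ?\<Delta> s \<le> c"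
          proof -
            have 1: "(1 - r')\<^sup>2 \<le> 1 * (1 - r')" unfolding power2_eq_square using r r' by (intro mult_right_mono) auto
            have "pi\<^sup>2 * (1 - r')\<^sup>2 / s ^ 3 * ?\<Delta> s \<le> pi\<^sup>2 * (c * a ^ 3 / (10 * pi ^ 3)) / a ^ 3 * (10 * pi)"
              using 1 s a s0 r' D0[of s] D1[of s] c
              by (intro mult_mono frac_le mult_left_mono power_mono) auto
            also have "\<dots> = c" using a by (simp add: power2_eq_square power3_eq_cube)
            finally show ?thesis .
          qed
          ultimately show "?\<Delta> s / (4 * s) \<le> ?q s * ?\<Delta> s + c" by simp
        qed auto
        also have "\<dots> = integral {a..d} (\<lambda>s. ?q s * ?\<Delta> s) + integral {a..d} (\<lambda>s. c)"
          by (intro integral_add iq cD) auto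
        also have "integral {a..d} (\<lambda>s. c) \<le> c" using a d c mult_right_mono[of "d - a" 1 c] by simp
        also have "integral {a..d} (\<lambda>s. ?q s * ?\<Delta> s) \<le> integral {0..pi} (\<lambda>s. ?q s * ?\<Delta> s)"
        proof (intro integral_subset_le iq cD ballI)
          show "{a..d} \<subseteq> {0..pi}" using a d pi_gt3 by auto
          fix s assume "s \<in> {0..pi}"
          then show "0 \<le> ?q s * ?\<Delta> s" using D0[of s] conj_poisson_mono[of r r' s] r r' by simp
        qed
        also note I
        finally show "integral {a..d} (\<lambda>s. ?\<Delta> s / (4 * s)) \<le> 7 * e + c" by simp
      qed
      moreover have "integral {a..d} (\<lambda>s. ?\<Delta> s / s) = 4 * integral {a..d} (\<lambda>s. ?\<Delta> s / (4 * s))"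
      proof -
        have "?\<Delta> s / s = 4 * (?\<Delta> s / (4 * s))" for s by (simp only: times_divide_eq_right mult_divide_mult_cancel_left_if) simp
        then show ?thesis by (simp only: integral_mult_right)
      qed
      ultimately show ?thesis by simp
    qed
    show "(\<integral>\<^sup>+s\<in>{0<..<d}. ennreal (?\<Delta> s / s) \<partial>lborel) \<le> ennreal (28 * e)"
      by (rule nn_integral_open_interval_le[OF d(1) _ _ key]) (use D0 in \<open>auto intro!: continuous_intros cD\<close>)
  qed
qed

section \<open>From the integral condition to a continuous extension\<close>

lemma schwarz_integral_radial_uniform:
  assumes g: "continuous_on (sphere 0 1) g" and e: "0 < e"
  obtains r0 where "1/2 \<le> r0" "r0 < 1"
    "\<And>r x. r0 \<le> r \<Longrightarrow> r < 1 \<Longrightarrow> \<bar>Re (schwarz_integral {0..2*pi} g (of_real r * cis x)) - g (cis x)\<bar> \<le> e"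
proof -
  have "uniformly_continuous_on (sphere 0 1) g" by (rule compact_uniformly_continuous[OF g]) simp
  from uniformly_continuous_onE[OF this half_gt_zero[OF e]]
  obtain d1 where d1: "d1 > 0" "\<And>z z'. z \<in> sphere 0 1 \<Longrightarrow> z' \<in> sphere 0 1 \<Longrightarrow> dist z' z < d1 \<Longrightarrow> dist (g z') (g z) < e/2"
    by blast
  have "bounded (g ` sphere 0 1)" by (intro compact_imp_bounded compact_continuous_image g) simp
  then obtain M where M: "\<And>w. w \<in> sphere 0 1 \<Longrightarrow> norm (g w) \<le> M" unfolding bounded_iff by blast
  have M0: "0 \<le> M" using M[of 1] by simp
  define \<delta> where "\<delta> = min 1 (d1/2)"
  have \<delta>: "0 < \<delta>" "\<delta> \<le> pi" "\<delta> < d1" using d1 pi_gt3 by (auto simp: \<delta>_def)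
  have close: "\<bar>g (cis (x + s)) - g (cis x)\<bar> \<le> e/2" if "\<bar>s\<bar> \<le> \<delta>" for x s
  proof -
    have "dist (cis (x + s)) (cis x) = norm (cis x * (cis s - 1))" by (simp add: dist_norm algebra_simps cis_mult)
    also have "\<dots> = 2 * \<bar>sin (s/2)\<bar>" using dist_exp_i_1[of s] by (simp add: norm_mult cis_conv_exp)
    also have "\<dots> \<le> \<bar>s\<bar>" using abs_sin_x_le_abs_x[of "s/2"] by simp
    finally have "dist (cis (x + s)) (cis x) < d1" using that \<delta> by simp
    then show ?thesis using d1(2)[of "cis x" "cis (x + s)"] by (simp add: dist_real_def)
  qed
  define c where "c = (2 * M + 1) * (pi\<^sup>2 / \<delta>\<^sup>2)"
  have c: "c > 0" using \<delta> M0 by (simp add: c_def add_nonneg_pos)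
  define r0 where "r0 = max (1/2) (1 - e / (2 * c))"
  have r0: "1/2 \<le> r0" "r0 < 1" "1 - e / (2 * c) \<le> r0" using e c by (auto simp: r0_def)
  show thesis
  proof (rule that[OF r0(1,2)])
    fix r x assume r: "r0 \<le> r" "r < 1"
    have v: "\<bar>g (cis (x + s)) - g (cis x)\<bar> \<le> 2 * M + 1" for s using M[of "cis (x + s)"] M[of "cis x"] by simp
    have "\<bar>Re (schwarz_integral {0..2*pi} g (of_real r * cis x)) - g (cis x)\<bar> \<le> e/2 + (2 * M + 1) * (pi\<^sup>2 * (1 - r) / \<delta>\<^sup>2)"
      using r r0 \<delta> v close by (intro poisson_approximation[OF g]) auto
    also have "(2 * M + 1) * (pi\<^sup>2 * (1 - r) / \<delta>\<^sup>2) = c * (1 - r)" by (simp add: c_def)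
    also have "c * (1 - r) \<le> c * (e / (2 * c))" using r r0 c by (intro mult_left_mono) auto
    also have "c * (e / (2 * c)) = e/2" using c by simp
    finally show "\<bar>Re (schwarz_integral {0..2*pi} g (of_real r * cis x)) - g (cis x)\<bar> \<le> e" by simp
  qed
qed

text \<open>The real part of the Schwarz integral extends by Poisson approximation for any
  continuous \<open>g\<close>; the integral condition is needed for the conjugate part. There the
  kernel difference between two radii is at most \<open>1 / s\<close>, so the singular part of the
  integral is dominated uniformly in the angle.\<close>

theorem dini_condition_extends:
  assumes g: "continuous_on (sphere 0 1) g"
    and D: "\<And>e. 0 < e \<Longrightarrow> \<exists>d. 0 < d \<and> d \<le> pi \<and>
      (\<forall>x. (\<integral>\<^sup>+s\<in>{0<..<d}. ennreal (\<bar>g (cis (x + s)) - g (cis (x - s))\<bar> / s) \<partial>lborel) \<le> ennreal e)"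
  obtains H where "continuous_on (cball 0 1) H" "H holomorphic_on ball 0 1" "\<And>t. Im (H (cis t)) = g (cis t)"
proof -
  let ?S = "schwarz_integral {0..2*pi} g"
  have S: "?S holomorphic_on ball 0 1" by (intro schwarz_integral_holomorphic g) auto
  have C1: "\<exists>r0<1. \<forall>r\<ge>r0. \<forall>r'\<ge>r. r' < 1 \<longrightarrow> (\<forall>x. \<bar>Re (?S (of_real r * cis x)) - Re (?S (of_real r' * cis x))\<bar> \<le> e)"
    if e: "0 < e" for e
  proof -
    obtain r0 where r0: "1/2 \<le> r0" "r0 < 1" "\<And>r x. r0 \<le> r \<Longrightarrow> r < 1 \<Longrightarrow> \<bar>Re (?S (of_real r * cis x)) - g (cis x)\<bar> \<le> e/2"
      by (rule schwarz_integral_radial_uniform[OF g half_gt_zero[OF e]]) (rule that; assumption)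
    show ?thesis
    proof (intro exI[of _ r0] conjI allI impI r0(2))
      fix r r' x assume "r0 \<le> r" "r \<le> r'" "r' < 1"
      then show "\<bar>Re (?S (of_real r * cis x)) - Re (?S (of_real r' * cis x))\<bar> \<le> e"
        using r0(3)[of r x] r0(3)[of r' x] by linarith
    qed
  qed
  obtain V where V: "continuous_on (cball 0 1) V" "\<And>z. norm z < 1 \<Longrightarrow> V z = Re (?S z)"
    using radially_cauchy_extends[OF S C1] by blast
  have Vg: "V (cis t) = g (cis t)" for t
  proof (rule ccontr)
    assume "V (cis t) \<noteq> g (cis t)"
    then have e: "0 < \<bar>V (cis t) - g (cis t)\<bar>" by simp
    obtain r0 where r0: "1/2 \<le> r0" "r0 < 1" "\<And>r x. r0 \<le> r \<Longrightarrow> r < 1 \<Longrightarrow> \<bar>Re (?S (of_real r * cis x)) - g (cis x)\<bar> \<le> \<bar>V (cis t) - g (cis t)\<bar> / 2"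
      by (rule schwarz_integral_radial_uniform[OF g half_gt_zero[OF e]]) (rule that; assumption)
    have "\<forall>\<^sub>F \<rho>::real in at_left 1. \<rho> \<in> {r0<..<1}" by (rule eventually_at_left_real[OF r0(2)])
    then have "\<forall>\<^sub>F \<rho> in at_left 1. \<bar>V (of_real \<rho> * cis t) - g (cis t)\<bar> \<le> \<bar>V (cis t) - g (cis t)\<bar> / 2"
      by eventually_elim (use r0 V(2) in \<open>auto simp: norm_mult\<close>)
    moreover have "((\<lambda>\<rho>. \<bar>V (of_real \<rho> * cis t) - g (cis t)\<bar>) \<longlongrightarrow> \<bar>V (cis t) - g (cis t)\<bar>) (at_left 1)"
      by (intro tendsto_intros radial_limit V)
    ultimately have "\<bar>V (cis t) - g (cis t)\<bar> \<le> \<bar>V (cis t) - g (cis t)\<bar> / 2"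
      by (intro tendsto_upperbound) auto
    then show False using e by simp
  qed
  let ?h = "\<lambda>z. \<i> * ?S z"
  have h: "?h holomorphic_on ball 0 1" by (intro holomorphic_intros S)
  have "bounded (g ` sphere 0 1)" by (intro compact_imp_bounded compact_continuous_image g) simp
  then obtain M where M: "\<And>w. w \<in> sphere 0 1 \<Longrightarrow> norm (g w) \<le> M" unfolding bounded_iff by blast
  have M0: "0 \<le> M" using M[of 1] by simp
  have C2: "\<exists>r0<1. \<forall>r\<ge>r0. \<forall>r'\<ge>r. r' < 1 \<longrightarrow> (\<forall>x. \<bar>Re (?h (of_real r * cis x)) - Re (?h (of_real r' * cis x))\<bar> \<le> e)"
    if e: "0 < e" for e
  proof -
    obtain d where d: "0 < d" "d \<le> pi"
      "\<And>x. (\<integral>\<^sup>+s\<in>{0<..<d}. ennreal (\<bar>g (cis (x + s)) - g (cis (x - s))\<bar> / s) \<partial>lborel) \<le> ennreal (e/2)"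
      using D[OF half_gt_zero[OF e]] by blast
    define c where "c = pi\<^sup>2 / d ^ 3 * (2 * M + 1)"
    have c: "0 < c" using d M0 by (simp add: c_def add_nonneg_pos)
    define r0 where "r0 = max (1/2) (1 - e / (2 * c))"
    have r0: "1/2 \<le> r0" "r0 < 1" "1 - e / (2 * c) \<le> r0" using e c by (auto simp: r0_def)
    show ?thesis
    proof (intro exI[of _ r0] conjI allI impI r0(2))
      fix r r' x :: real assume a: "r0 \<le> r" "r \<le> r'" "r' < 1"
      let ?G = "\<lambda>s. g (cis (x + s)) - g (cis (x - s))"
      let ?q = "\<lambda>s. conj_poisson r' s - conj_poisson r s"
      have r: "1/2 \<le> r" "r < 1" "0 \<le> r" "0 \<le> r'" using a r0 by auto
      have cG: "continuous_on A ?G" for A by (intro continuous_intros continuous_on_circle_comp g)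
      have cf: "continuous_on A (\<lambda>s. ?q s * ?G s)" for A
        using r a by (intro continuous_intros cG)
      have i: "(\<lambda>s. ?q s * ?G s) integrable_on {u..v}" for u v by (intro integrable_continuous_real cf)
      have G: "\<bar>?G s\<bar> \<le> 2 * M" for s using M[of "cis (x + s)"] M[of "cis (x - s)"] by simp
      have "pi * (Re (?h (of_real r' * cis x)) - Re (?h (of_real r * cis x))) =
          integral {0..pi} (\<lambda>s. conj_poisson r' s * ?G s) - integral {0..pi} (\<lambda>s. conj_poisson r s * ?G s)"
        using schwarz_integral_Im[OF g, of r' x] schwarz_integral_Im[OF g, of r x] r a by (simp add: field_simps)
      also have "\<dots> = integral {0..pi} (\<lambda>s. ?q s * ?G s)"
        unfolding left_diff_distrib[of "conj_poisson r' _"]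
        using r a by (intro integral_diff[symmetric] integrable_continuous_real continuous_intros cG)
      \<comment> \<open>Near zero the hypothesis bounds the integral; beyond \<open>d\<close> the
        kernel difference is at most \<open>pi\<^sup>2 * (1 - r)\<^sup>2 / s ^ 3\<close> and is made
        small by the choice of \<open>r0\<close>.\<close>
      also have "\<dots> = integral {0..d} (\<lambda>s. ?q s * ?G s) + integral {d..pi} (\<lambda>s. ?q s * ?G s)"
        using d i by (intro Henstock_Kurzweil_Integration.integral_combine[symmetric]) auto
      finally have eq: "pi * (Re (?h (of_real r' * cis x)) - Re (?h (of_real r * cis x))) =
         integral {0..d} (\<lambda>s. ?q s * ?G s) + integral {d..pi} (\<lambda>s. ?q s * ?G s)" .
      have I1: "\<bar>integral {0..d} (\<lambda>s. ?q s * ?G s)\<bar> \<le> e/2"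
      proof (rule integral_le_nn_integral[OF cf _ d(3)])
        fix s assume s: "0 < s" "s < d"
        have "\<bar>?q s\<bar> \<le> 1 / s" using conj_poisson_diff_le(2,3)[of r r' s] r a s d by auto
        then have "\<bar>?q s\<bar> * \<bar>?G s\<bar> \<le> 1 / s * \<bar>?G s\<bar>" by (intro mult_right_mono) auto
        then show "\<bar>?q s * ?G s\<bar> \<le> \<bar>?G s\<bar> / s" by (simp add: abs_mult)
      qed (use e in simp)
      have I2: "\<bar>integral {d..pi} (\<lambda>s. ?q s * ?G s)\<bar> \<le> pi * (e/2)"
      proof -
        have "norm (integral {d..pi} (\<lambda>s. ?q s * ?G s)) \<le> integral {d..pi} (\<lambda>s. e/2)"
        proof (rule integral_norm_bound_integral[OF i])
          fix s assume s: "s \<in> {d..pi}"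
          then have s0: "0 < s" using d by auto
          have "\<bar>?q s\<bar> \<le> pi\<^sup>2 * (1 - r)\<^sup>2 / s ^ 3" using conj_poisson_diff_le(1,3)[of r r' s] r a s s0 by auto
          also have "\<dots> \<le> pi\<^sup>2 * (1 * (1 - r)) / d ^ 3"
            unfolding power2_eq_square[of "1 - r"] using r d s by (intro frac_le mult_left_mono mult_right_mono power_mono) auto
          finally have "\<bar>?q s\<bar> * \<bar>?G s\<bar> \<le> pi\<^sup>2 * (1 * (1 - r)) / d ^ 3 * (2 * M + 1)"
            using G[of s] M0 r d by (intro mult_mono) auto
          also have "\<dots> = c * (1 - r)" by (simp add: c_def)
          also have "\<dots> \<le> c * (e / (2 * c))" using a r0 c by (intro mult_left_mono) auto
          also have "\<dots> = e/2" using c by simp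
          finally show "norm (?q s * ?G s) \<le> e/2" by (simp add: abs_mult)
        qed auto
        also have "\<dots> = (pi - d) * (e/2)" using d by simp
        also have "\<dots> \<le> pi * (e/2)" using d e by (intro mult_right_mono) auto
        finally show ?thesis by simp
      qed
      have "pi * \<bar>Re (?h (of_real r' * cis x)) - Re (?h (of_real r * cis x))\<bar> = \<bar>integral {0..d} (\<lambda>s. ?q s * ?G s) + integral {d..pi} (\<lambda>s. ?q s * ?G s)\<bar>"
        unfolding eq[symmetric] abs_mult by simp
      also have "\<dots> \<le> e/2 + pi * (e/2)" using I1 I2 by linarith
      also have "1 * e \<le> pi * e" using e pi_gt3 by (intro mult_right_mono) auto
      then have "e/2 + pi * (e/2) \<le> pi * e" by linarith
      finally have "\<bar>Re (?h (of_real r' * cis x)) - Re (?h (of_real r * cis x))\<bar> \<le> e" by (rule mult_left_le_imp_le) simp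
      then show "\<bar>Re (?h (of_real r * cis x)) - Re (?h (of_real r' * cis x))\<bar> \<le> e" by (simp only: abs_minus_commute)
    qed
  qed
  obtain U where U: "continuous_on (cball 0 1) U" "\<And>z. norm z < 1 \<Longrightarrow> U z = Re (?h z)"
    using radially_cauchy_extends[OF h C2] by blast
  define H where "H z = of_real (U z) + \<i> * of_real (V z)" for z
  have Hh: "H z = ?h z" if "norm z < 1" for z
    using U(2)[OF that] V(2)[OF that] by (simp add: H_def complex_eq_iff)
  show thesis
  proof (rule that[of H])
    show "continuous_on (cball 0 1) H" unfolding H_def by (intro continuous_intros U V)
    show "H holomorphic_on ball 0 1" by (rule holomorphic_transform[OF h]) (use Hh in simp)
    show "Im (H (cis t)) = g (cis t)" for t by (simp add: H_def Vg)
  qed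
qed

section \<open>Harmonic measure of star-shaped domains\<close>

text \<open>A maximum principle for the gauge: an interior maximum of gauge at least 1 could be
  pushed outwards along its ray inside the open image, which increases the gauge.\<close>

lemma star_map_into:
  assumes k: "continuous_on (sphere 0 1) k" and pos: "\<And>w. norm w = 1 \<Longrightarrow> 0 < k w"
    and f: "continuous_on (cball 0 1) f" "f holomorphic_on ball 0 1" "\<not> f constant_on ball 0 1"
    and bd: "\<And>w. norm w = 1 \<Longrightarrow> gauge_of k (f w) = 1"
    and z: "norm z < 1"
  shows "gauge_of k (f z) < 1"
proof (rule ccontr)
  assume "\<not> gauge_of k (f z) < 1"
  then have z1: "1 \<le> gauge_of k (f z)" by simp
  let ?N = "\<lambda>z. gauge_of k (f z)"
  have cN: "continuous_on (cball 0 1) ?N"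
    using continuous_on_compose2[OF continuous_on_gauge_of[OF k pos, of UNIV] f(1)] by simp
  have "compact (cball (0::complex) 1)" "cball (0::complex) 1 \<noteq> {}" by auto
  then obtain z0 where z0: "z0 \<in> cball 0 1" "\<And>w. w \<in> cball 0 1 \<Longrightarrow> ?N w \<le> ?N z0"
    using continuous_attains_sup[OF _ _ cN] by blast
  \<comment> \<open>If the maximum is attained on the circle, it equals 1, and the assumed bad point
    \<open>z\<close> attains it as well.\<close>
  have "\<exists>z2. norm z2 < 1 \<and> ?N z2 = ?N z0"
  proof (cases "norm z0 < 1")
    case False
    then have "?N z0 = 1" using z0(1) bd by auto
    then have "?N z = ?N z0" using z1 z0(2)[of z] z by simp
    then show ?thesis using z by blast
  qed blast
  then obtain z2 where z2: "norm z2 < 1" "?N z2 = ?N z0" by blast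
  have m: "1 \<le> ?N z0" using z1 z0(2)[of z] z by simp
  have "open (f ` ball 0 1)"
    by (rule open_mapping_thm[OF f(2) _ _ _ _ f(3)]) auto
  then obtain d where d: "d > 0" "ball (f z2) d \<subseteq> f ` ball 0 1"
    using z2(1) by (meson imageI mem_ball_0 open_contains_ball)
  define x where "x = norm (f z2) + 1"
  have x: "0 < x" "norm (f z2) \<le> x" by (auto simp: x_def add_nonneg_pos)
  \<comment> \<open>The factor moves \<open>f z2\<close> outwards by at most \<open>d/2\<close>; the
    summand 1 in \<open>x\<close> avoids a division by zero.\<close>
  define s where "s = 1 + d / (2 * x)"
  have s: "s > 1" using d(1) x by (simp add: s_def)
  have "dist (f z2) (of_real s * f z2) = norm ((of_real s - 1) * f z2)" by (simp add: dist_norm left_diff_distrib norm_minus_commute)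
  also have "\<dots> = norm (of_real (s - 1) :: complex) * norm (f z2)" by (simp add: norm_mult)
  also have "\<dots> = (s - 1) * norm (f z2)" using s by (simp only: norm_of_real)
  also have "\<dots> \<le> (s - 1) * x" using s x by (intro mult_left_mono) auto
  also have "\<dots> = d / 2" using x by (simp add: s_def)
  finally have "of_real s * f z2 \<in> ball (f z2) d" using d(1) by simp
  then obtain y where y: "y \<in> ball 0 1" "f y = of_real s * f z2" using d(2) by force
  have "?N y = s * ?N z0" using s z2 y(2) gauge_of_scale[of s k "f z2"] by simp
  moreover have "s * ?N z0 > ?N z0" using s m by simp
  ultimately show False using z0(2)[of y] y(1) by simp
qed

text \<open>Composing with the inverse Riemann map of the domain gives a self-map \<open>F\<close> of the disc whose only zero
  is simple and whose modulus tends to 1 at the boundary; by the Schwarz lemma it is a rotation.\<close>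

theorem star_map_conformal:
  assumes k: "continuous_on (sphere 0 1) k" and pos: "\<And>w. norm w = 1 \<Longrightarrow> 0 < k w"
    and H: "continuous_on (cball 0 1) H" "H holomorphic_on ball 0 1"
    and bd: "\<And>w. norm w = 1 \<Longrightarrow> gauge_of k (w * exp (H w)) = 1"
  defines "S \<equiv> {w. gauge_of k w < 1}"
  obtains \<phi> where "\<phi> holomorphic_on S"
    "\<And>z. norm z < 1 \<Longrightarrow> z * exp (H z) \<in> S \<and> \<phi> (z * exp (H z)) = z"
    "\<And>w. w \<in> S \<Longrightarrow> norm (\<phi> w) < 1 \<and> \<phi> w * exp (H (\<phi> w)) = w"
proof -
  define f where "f z = z * exp (H z)" for z
  have fc: "continuous_on (cball 0 1) f" unfolding f_def by (intro continuous_intros H)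
  have fh: "f holomorphic_on ball 0 1" unfolding f_def by (intro holomorphic_intros H)
  have fnc: "\<not> f constant_on ball 0 1"
  proof
    assume "f constant_on ball 0 1"
    then obtain c where c: "\<And>z. z \<in> ball 0 1 \<Longrightarrow> f z = c" unfolding constant_on_def by blast
    have "f 0 = f (1/2)" using c[of 0] c[of "1/2"] by simp
    then show False by (simp add: f_def)
  qed
  have fS: "f z \<in> S" if "norm z < 1" for z
    using star_map_into[OF k pos fc fh fnc _ that] bd by (simp add: S_def f_def)
  note sd = star_domain_open_bounded[OF k pos, folded S_def]
  have S0: "0 \<in> S" by (simp add: S_def)
  obtain f1 \<psi> where f1: "f1 holomorphic_on ball 0 1" "\<psi> holomorphic_on S" "f1 0 = 0" "\<psi> 0 = 0"
    "\<And>z. norm z < 1 \<Longrightarrow> f1 z \<in> S \<and> \<psi> (f1 z) = z" "\<And>w. w \<in> S \<Longrightarrow> norm (\<psi> w) < 1 \<and> f1 (\<psi> w) = w"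
    using riemann_map_at_0[OF sd(1) starlike_imp_simply_connected[OF sd(4)] sd(5) S0] by blast
  have "inj_on f1 (ball 0 1)" using f1(5) by (intro inj_on_inverseI[of _ \<psi>]) auto
  then obtain h1 where h1: "h1 holomorphic_on ball 0 1" "\<And>z. norm z < 1 \<Longrightarrow> f1 z = z * exp (h1 z)"
    using injective_factor_exp[OF f1(1,3)] by blast
  define F where "F z = \<psi> (f z)" for z
  have Fh: "F holomorphic_on ball 0 1"
  proof -
    have "\<psi> \<circ> f holomorphic_on ball 0 1" using fS by (intro holomorphic_on_compose_gen[OF fh f1(2)]) auto
    then show ?thesis by (simp add: F_def[abs_def] o_def)
  qed
  have F1: "norm (F z) < 1" "f1 (F z) = f z" if "norm z < 1" for z
    using f1(6)[OF fS[OF that]] by (auto simp: F_def)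
  \<comment> \<open>A holomorphic logarithm of \<open>F z / z\<close>: the two exponential factors
    are never zero, so the only zero of \<open>F\<close> is the simple one at the origin.\<close>
  define \<kappa> where "\<kappa> z = H z - h1 (F z)" for z
  have \<kappa>h: "\<kappa> holomorphic_on ball 0 1"
  proof -
    have "h1 \<circ> F holomorphic_on ball 0 1" using F1(1) by (intro holomorphic_on_compose_gen[OF Fh h1(1)]) auto
    then show ?thesis unfolding \<kappa>_def by (intro holomorphic_intros H) (simp add: o_def)
  qed
  have F\<kappa>: "F z = z * exp (\<kappa> z)" if "norm z < 1" for z
  proof -
    have "F z * exp (h1 (F z)) = z * exp (H z)" using F1[OF that] h1(2) by (simp add: f_def)
    then show ?thesis by (simp add: \<kappa>_def exp_diff field_simps)
  qed
  \<comment> \<open>On a circle close to the boundary \<open>norm (F z)\<close> exceeds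
    \<open>c\<close>, so \<open>Re \<kappa>\<close> is at least \<open>ln c\<close> there and, by
    the maximum principle for its negative, also at 0.\<close>
  have lower: "ln c \<le> Re (\<kappa> 0)" if c: "0 < c" "c < 1" for c
  proof -
    have "compact (f1 ` cball 0 c)"
      using c by (intro compact_continuous_image continuous_on_subset[OF holomorphic_on_imp_continuous_on[OF f1(1)]]) auto
    moreover have "f1 ` cball 0 c \<noteq> {}" using c by auto
    ultimately obtain w0 where w0: "w0 \<in> f1 ` cball 0 c" "\<And>w. w \<in> f1 ` cball 0 c \<Longrightarrow> gauge_of k w \<le> gauge_of k w0"
      using continuous_attains_sup[OF _ _ continuous_on_gauge_of[OF k pos, of "f1 ` cball 0 c"]] by blast
    define n where "n = gauge_of k w0"
    have n1: "n < 1" using w0(1) f1(5) c by (auto simp: n_def S_def)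
    have n0: "0 \<le> n" using w0(2)[of "f1 0"] c f1(3) by (simp add: n_def)
    \<comment> \<open>This set contains every \<open>z\<close> with
      \<open>norm (F z) \<le> c\<close>. On the unit circle the gauge is 1, greater than
      \<open>n\<close>, so \<open>C\<close> is a compact subset of the open disc and a circle of
      radius \<open>r < 1\<close> surrounds it.\<close>
    define C where "C = cball 0 1 \<inter> (\<lambda>z. gauge_of k (f z)) -` {..n}"
    have cN: "continuous_on (cball 0 1) (\<lambda>z. gauge_of k (f z))"
      using continuous_on_compose2[OF continuous_on_gauge_of[OF k pos, of UNIV] fc] by simp
    have "closed C" unfolding C_def by (rule continuous_closed_preimage[OF cN]) auto
    then have "compact C" by (auto simp: C_def compact_eq_bounded_closed intro: bounded_subset[OF bounded_cball])
    moreover have "0 \<in> C" using n0 by (simp add: C_def f_def)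
    then have "C \<noteq> {}" by blast
    ultimately obtain z0 where z0: "z0 \<in> C" "\<And>z. z \<in> C \<Longrightarrow> norm z \<le> norm z0"
      using continuous_attains_sup[of C norm] continuous_on_norm_id by blast
    have nz0: "norm z0 < 1" using z0(1) bd[of z0] n1 by (auto simp: C_def f_def less_le)
    define r where "r = (norm z0 + 1) / 2"
    have r: "norm z0 < r" "r < 1" "0 < r" using nz0 norm_ge_zero[of z0] by (auto simp: r_def simp del: norm_ge_zero)
    have Fc: "c < norm (F z)" if z: "norm z = r" for z
    proof (rule ccontr)
      assume a: "\<not> c < norm (F z)"
      have "norm z < 1" using z r by simp
      then have "f z \<in> f1 ` cball 0 c" using a F1(2)[of z] by (intro image_eqI[of _ _ "F z"]) auto
      then have "gauge_of k (f z) \<le> n" using w0(2) by (simp add: n_def)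
      then have "norm z \<le> norm z0" using z r by (intro z0(2)) (auto simp: C_def)
      then show False using z r by simp
    qed
    have "Re (- \<kappa> 0) \<le> - ln c"
    proof (rule maximum_real_frontier[where S="cball 0 r" and f="\<lambda>z. - \<kappa> z"])
      show "(\<lambda>z. - \<kappa> z) holomorphic_on interior (cball 0 r)"
        using r by (intro holomorphic_intros holomorphic_on_subset[OF \<kappa>h]) auto
      show "continuous_on (closure (cball 0 r)) (\<lambda>z. - \<kappa> z)"
        using r by (intro continuous_intros continuous_on_subset[OF holomorphic_on_imp_continuous_on[OF \<kappa>h]]) auto
      fix z assume "z \<in> frontier (cball (0::complex) r)"
      then have z: "norm z = r" using r by simp
      have "c < norm z * exp (Re (\<kappa> z))" using Fc[OF z] F\<kappa>[of z] z r by (simp add: norm_mult)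
      also have "\<dots> \<le> 1 * exp (Re (\<kappa> z))" using z r by (intro mult_right_mono) auto
      finally have "ln c < ln (exp (Re (\<kappa> z)))" using c by (subst ln_less_cancel_iff) auto
      then show "Re (- \<kappa> z) \<le> - ln c" by simp
    qed (use r in auto)
    then show ?thesis by simp
  qed
  have "0 \<le> Re (\<kappa> 0)"
  proof (rule ccontr)
    assume "\<not> 0 \<le> Re (\<kappa> 0)"
    \<comment> \<open>With this \<open>c\<close> the lower bound is half of the negative number
      \<open>Re (\<kappa> 0)\<close>, hence strictly greater than it.\<close>
    then show False using lower[of "exp (Re (\<kappa> 0) / 2)"] by simp
  qed
  moreover have "deriv F 0 = exp (\<kappa> 0)"
  proof (rule DERIV_imp_deriv)
    have "(\<kappa> has_field_derivative deriv \<kappa> 0) (at 0)" by (rule holomorphic_derivI[OF \<kappa>h]) auto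
    then have "((\<lambda>z. z * exp (\<kappa> z)) has_field_derivative exp (\<kappa> 0)) (at 0)"
      by (auto intro!: derivative_eq_intros)
    then show "(F has_field_derivative exp (\<kappa> 0)) (at 0)"
      by (rule has_field_derivative_transform_within_open[of _ _ _ "ball 0 1"]) (use F\<kappa> in auto)
  qed
  ultimately have "1 \<le> norm (deriv F 0)" by simp
  moreover have F0: "F 0 = 0" using f1(4) by (simp add: F_def f_def)
  moreover have "norm (deriv F 0) \<le> 1"
    by (rule Schwarz_Lemma(2)[OF Fh F0 F1(1), of 0]) auto
  ultimately have "norm (deriv F 0) = 1" by simp
  then obtain \<alpha> where \<alpha>: "\<And>z. norm z < 1 \<Longrightarrow> F z = \<alpha> * z" "norm \<alpha> = 1"
    using Schwarz_Lemma(3)[OF Fh F0 F1(1), of 0] by auto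
  then have \<alpha>0: "\<alpha> \<noteq> 0" by auto
  show thesis
  proof (rule that[of "\<lambda>w. \<psi> w / \<alpha>"])
    show "(\<lambda>w. \<psi> w / \<alpha>) holomorphic_on S" using \<alpha>0 by (intro holomorphic_intros f1(2))
    show "z * exp (H z) \<in> S \<and> \<psi> (z * exp (H z)) / \<alpha> = z" if "norm z < 1" for z
      using fS[OF that] \<alpha>(1)[OF that] \<alpha>0 by (simp add: f_def F_def)
    show "norm (\<psi> w / \<alpha>) < 1 \<and> \<psi> w / \<alpha> * exp (H (\<psi> w / \<alpha>)) = w" if w: "w \<in> S" for w
    proof -
      have n: "norm (\<psi> w / \<alpha>) < 1" using f1(6)[OF w] \<alpha>(2) by (simp add: norm_divide)
      have "f (\<psi> w / \<alpha>) = f1 (\<alpha> * (\<psi> w / \<alpha>))" using F1(2)[OF n] \<alpha>(1)[OF n] by simp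
      also have "\<dots> = w" using f1(6)[OF w] \<alpha>0 by simp
      finally show ?thesis using n by (simp add: f_def)
    qed
  qed
qed

text \<open>\<open>\<tau>\<close> is the boundary argument as reported by \<open>Arg2pi\<close>,
  which returns 0 rather than \<open>2 * pi\<close>; hence the case distinction in its
  definition.\<close>

lemma radial_projection_star:
  fixes H :: "complex \<Rightarrow> complex"
  assumes k: "continuous_on (sphere 0 1) k" and pos: "\<And>w. norm w = 1 \<Longrightarrow> 0 < k w"
    and H: "continuous_on (cball 0 1) H" and \<phi>: "\<phi> holomorphic_on {w. gauge_of k w < 1}"
    and f\<phi>: "\<And>z. norm z < 1 \<Longrightarrow> z * exp (H z) \<in> {w. gauge_of k w < 1} \<and> \<phi> (z * exp (H z)) = z"
      "\<And>w. w \<in> {w. gauge_of k w < 1} \<Longrightarrow> norm (\<phi> w) < 1 \<and> \<phi> w * exp (H (\<phi> w)) = w"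
    and \<theta>: "\<And>t. t \<in> {0..2*pi} \<Longrightarrow> t + Im (H (cis t)) \<in> {0..2*pi}"
    and F: "F \<in> sets borel"
  defines "\<tau> \<equiv> \<lambda>t. if t + Im (H (cis t)) = 2*pi then 0 else t + Im (H (cis t))"
  shows "radial_projection {w. gauge_of k w < 1} F = measure lborel ({0..2*pi} \<inter> \<tau> -` F) / (2*pi)"
    and "\<tau> \<in> borel_measurable borel"
proof -
  let ?S = "{w. gauge_of k w < 1}"
  note sd = star_domain_open_bounded[OF k pos]
  define f where "f z = z * exp (H z)" for z
  have fc: "continuous_on (cball 0 1) f" unfolding f_def by (intro continuous_intros H)
  have "continuous_on UNIV (\<lambda>t. t + Im (H (cis t)))"
    by (intro continuous_intros continuous_on_Im continuous_on_compose2[OF H]) auto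
  then have [measurable]: "(\<lambda>t. t + Im (H (cis t))) \<in> borel_measurable borel"
    by (rule borel_measurable_continuous_onI)
  show \<tau>m: "\<tau> \<in> borel_measurable borel" unfolding \<tau>_def by measurable
  have arg: "Arg2pi (f (cis t)) = \<tau> t" if t: "t \<in> {0..2*pi}" for t
  proof -
    have e: "f (cis t) = of_real (exp (Re (H (cis t)))) * cis (t + Im (H (cis t)))"
      by (simp add: f_def exp_eq_polar flip: cis_mult)
    have "Arg2pi (f (cis t)) = Arg2pi (cis (t + Im (H (cis t))))"
      unfolding e by (rule Arg2pi_times_of_real) simp
    also have "\<dots> = \<tau> t"
      using \<theta>[OF t] Arg2pi_cis[of "t + Im (H (cis t))"] Arg2pi_cis[of 0] by (auto simp: \<tau>_def)
    finally show ?thesis .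
  qed
  have fr: "f (cis t) \<in> frontier ?S" for t
    using f\<phi> by (intro boundary_value_in_frontier[OF fc holomorphic_on_imp_continuous_on[OF \<phi>] sd(1)]) (auto simp: f_def)
  let ?E = "{\<zeta> \<in> frontier ?S. Arg2pi \<zeta> \<in> F}"
  have T: "{t \<in> {0..2*pi}. f (cis t) \<in> ?E} = {0..2*pi} \<inter> \<tau> -` F"
    using arg fr by auto
  have Tb: "{0..2*pi} \<inter> \<tau> -` F \<in> sets borel"
    using measurable_sets[OF \<tau>m F] by auto
  have "harmonic_measure (f 0) ?E ?S = measure lebesgue {t \<in> {0..2*pi}. f (cis t) \<in> ?E} / (2*pi)"
  proof (rule harmonic_measure_conformal[OF fc _ _ \<phi> _ sd(1,2)])
    show "f z \<in> ?S" if "norm z < 1" for z using f\<phi>(1)[OF that] by (simp add: f_def)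
    show "norm (\<phi> w) < 1 \<and> f (\<phi> w) = w" if "w \<in> ?S" for w using f\<phi>(2)[OF that] by (simp add: f_def)
    show "\<phi> (f 0) = 0" using f\<phi>(1)[of 0] by (simp add: f_def)
    show "{t \<in> {0..2*pi}. f (cis t) \<in> ?E} \<in> sets lebesgue" unfolding T using Tb by auto
  qed
  then show "radial_projection ?S F = measure lborel ({0..2*pi} \<inter> \<tau> -` F) / (2*pi)"
    unfolding T radial_projection_def using Tb by (simp add: f_def measure_completion)
qed

section \<open>Passing between the measure and the boundary argument\<close>

lemma prob_on_segment_sets:
  assumes "prob_on_segment a b \<nu>"
  shows "prob_space \<nu>" "space \<nu> = {a..b}" "\<And>A. A \<in> sets \<nu> \<longleftrightarrow> A \<in> sets borel \<and> A \<subseteq> {a..b}"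
proof -
  show "prob_space \<nu>" using assms by (simp add: prob_on_segment_def)
  have s: "sets \<nu> = sets (restrict_space borel {a..b})" using assms by (simp add: prob_on_segment_def)
  show "space \<nu> = {a..b}" using sets_eq_imp_space_eq[OF s] by (simp add: space_restrict_space)
  show "A \<in> sets \<nu> \<longleftrightarrow> A \<in> sets borel \<and> A \<subseteq> {a..b}" for A
    unfolding s by (subst sets_restrict_space_iff) auto
qed

text \<open>The distribution function inverts a continuous bijection of a compact interval up to the
  factor \<open>2 * pi\<close>, and so is continuous and strictly increasing. The integral condition
  is then transferred from the boundary argument to its constant continuation.\<close>

lemma conformal_imp_class_A:
  fixes \<nu> :: "real measure"
  assumes \<nu>: "prob_on_segment 0 (2*pi) \<nu>"
    and H: "continuous_on (cball 0 1) H" "H holomorphic_on ball 0 1" "Im (H 1) = 0"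
    and mono: "\<And>x y. x \<le> y \<Longrightarrow> x + Im (H (cis x)) \<le> y + Im (H (cis y))"
    and strict: "strict_mono_on {0..2*pi} (\<lambda>t. t + Im (H (cis t)))"
    and D: "\<And>t. t \<in> {0..2*pi} \<Longrightarrow> distr_fun 0 \<nu> (t + Im (H (cis t))) = t / (2*pi)"
  shows "\<nu> \<in> class_A 0 (2*pi)"
proof -
  define \<theta> where "\<theta> t = t + Im (H (cis t))" for t
  let ?D = "distr_fun 0 \<nu>" and ?I = "{0..2*pi}"
  have \<theta>c: "continuous_on A \<theta>" for A unfolding \<theta>_def
    by (intro continuous_intros continuous_on_Im continuous_on_compose2[OF H(1)]) auto
  have \<theta>0: "\<theta> 0 = 0" using H(3) by (simp add: \<theta>_def)
  have \<theta>1: "\<theta> (2*pi) = 2*pi" using H(3) by (simp add: \<theta>_def)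
  have \<theta>m: "\<theta> x \<le> \<theta> y" if "x \<le> y" for x y using mono[OF that] by (simp add: \<theta>_def)
  have \<theta>s: "strict_mono_on ?I \<theta>" using strict by (simp add: \<theta>_def[abs_def])
  have D\<theta>: "?D (\<theta> t) = t / (2*pi)" if "t \<in> ?I" for t using D[OF that] by (simp add: \<theta>_def)
  have img: "\<theta> ` ?I = ?I"
  proof (intro set_eqI iffI)
    fix y assume "y \<in> \<theta> ` ?I"
    then show "y \<in> ?I" using \<theta>m \<theta>0 \<theta>1 by (metis atLeastAtMost_iff imageE)
  next
    fix y assume "y \<in> ?I"
    then show "y \<in> \<theta> ` ?I" using IVT'[of \<theta> 0 y "2*pi"] \<theta>c \<theta>0 \<theta>1 by (force simp: image_iff)
  qed
  have sD: "strict_mono_on ?I ?D"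
  proof (rule strict_mono_onI)
    fix x y assume xy: "x \<in> ?I" "y \<in> ?I" "x < y"
    then have "x \<in> \<theta> ` ?I" "y \<in> \<theta> ` ?I" by (simp_all only: img)
    then obtain s t where st: "s \<in> ?I" "t \<in> ?I" "x = \<theta> s" "y = \<theta> t" by blast
    then have "s < t" using xy(3) \<theta>m[of t s] by (cases "s < t") auto
    then show "?D x < ?D y" using st D\<theta> by (simp add: divide_strict_right_mono)
  qed
  have cD: "continuous_on ?I ?D"
  proof -
    have "continuous_on (\<theta> ` ?I) (\<lambda>y. 2*pi * ?D y)"
      by (rule continuous_on_inv[OF \<theta>c]) (use D\<theta> in auto)
    then have "continuous_on ?I (\<lambda>y. (2*pi * ?D y) / (2*pi))" unfolding img by (rule continuous_on_divide) auto
    moreover have "(2*pi * ?D y) / (2*pi) = ?D y" for y by simp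
    ultimately show ?thesis by (simp only:)
  qed
  have D0: "?D 0 = 0" using D\<theta>[of 0] \<theta>0 by simp
  let ?m = "inverse_distr 0 (2*pi) \<nu>"
  \<comment> \<open>The constant continuation is the quasi-periodic function clipped to
    \<open>[0, 2\<pi>]\<close>. Clipping is monotone and does not enlarge increments, so the
    integral bound is inherited.\<close>
  have m: "?m s = max 0 (min (2*pi) (\<theta> (2*pi * s)))" for s
  proof -
    consider "s < 0" | "s > 1" | "0 \<le> s" "s \<le> 1" by linarith
    then show ?thesis
    proof cases
      case 1
      then have "\<theta> (2*pi * s) \<le> \<theta> 0" by (intro \<theta>m) (simp add: mult_nonneg_nonpos)
      then have "\<theta> (2*pi * s) \<le> 0" "\<not> 2*pi \<le> \<theta> (2*pi * s)" using \<theta>0 pi_gt_zero by linarith+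
      then show ?thesis using 1 by (simp add: inverse_distr_def max_def min_def)
    next
      case 2
      then have "\<theta> (2*pi) \<le> \<theta> (2*pi * s)" by (intro \<theta>m) simp
      then show ?thesis using 2 \<theta>1 by (simp add: inverse_distr_def max_def min_def)
    next
      case 3
      then have i: "2*pi * s \<in> ?I" by simp
      then have t: "\<theta> (2*pi * s) \<in> ?I" using img by blast
      have "?m s = the_inv_into ?I ?D (?D (\<theta> (2*pi * s)))" using 3 D\<theta>[OF i] by (simp add: inverse_distr_def)
      also have "\<dots> = \<theta> (2*pi * s)"
        by (rule the_inv_into_f_f[OF strict_mono_on_imp_inj_on[OF sD] t])
      finally show ?thesis using t by (simp add: max_def min_def)
    qed
  qed
  have \<theta>meas: "(\<lambda>s. \<theta> (2*pi * s)) \<in> borel_measurable borel"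
    using continuous_on_compose2[OF \<theta>c[of UNIV], of UNIV "\<lambda>s. 2*pi * s"]
    by (intro borel_measurable_continuous_onI) (auto intro!: continuous_intros)
  have lim: "((\<lambda>\<delta>. SUP x::real. \<integral>\<^sup>+t\<in>{0<..<\<delta>}. ennreal ((?m (x + t) - ?m (x - t)) / t) \<partial>lborel) \<longlongrightarrow> 0) (at_right 0)"
    unfolding dini_condition_iff
  proof (intro allI impI)
    fix e :: real assume e: "e > 0"
    define e' where "e' = min 1 (e/28)"
    have e': "0 < e'" "e' \<le> 1" "28 * e' \<le> e" using e by (auto simp: e'_def)
    obtain d where d: "d > 0" "\<And>x. (\<integral>\<^sup>+s\<in>{0<..<d}. ennreal ((\<theta> (x + s) - \<theta> (x - s)) / s) \<partial>lborel) \<le> ennreal (28 * e')"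
      using dini_condition_of_extension[OF H(1,2) mono e'(1,2)] unfolding \<theta>_def by blast
    show "\<exists>d>0. \<forall>x. (\<integral>\<^sup>+t\<in>{0<..<d}. ennreal ((?m (x + t) - ?m (x - t)) / t) \<partial>lborel) \<le> ennreal e"
    proof (intro exI[of _ "d / (2*pi)"] conjI allI)
      show "0 < d / (2*pi)" using d(1) by simp
      fix x
      have "(\<integral>\<^sup>+t\<in>{0<..<d/(2*pi)}. ennreal ((?m (x + t) - ?m (x - t)) / t) \<partial>lborel)
          \<le> (\<integral>\<^sup>+t\<in>{0<..<d/(2*pi)}. ennreal ((\<theta> (2*pi*(x + t)) - \<theta> (2*pi*(x - t))) / t) \<partial>lborel)"
      proof (intro nn_integral_mono)
        fix t :: real
        show "ennreal ((?m (x + t) - ?m (x - t)) / t) * indicator {0<..<d/(2*pi)} t \<le>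
          ennreal ((\<theta> (2*pi*(x + t)) - \<theta> (2*pi*(x - t))) / t) * indicator {0<..<d/(2*pi)} t"
        proof (cases "t \<in> {0<..<d/(2*pi)}")
          case True
          have "\<theta> (2*pi*(x - t)) \<le> \<theta> (2*pi*(x + t))" using True by (intro \<theta>m mult_left_mono) auto
          then have "?m (x + t) - ?m (x - t) \<le> \<theta> (2*pi*(x + t)) - \<theta> (2*pi*(x - t))"
            unfolding m by (simp add: max_def min_def)
          then show ?thesis using True by (auto intro!: ennreal_leI divide_right_mono)
        qed simp
      qed
      also have "\<dots> = (\<integral>\<^sup>+s\<in>{0<..<d}. ennreal ((\<theta> (2*pi*(x + s/(2*pi))) - \<theta> (2*pi*(x - s/(2*pi)))) / s) \<partial>lborel)"
        by (rule nn_integral_rescale[OF \<theta>meas, symmetric]) simp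
      also have "\<dots> = (\<integral>\<^sup>+s\<in>{0<..<d}. ennreal ((\<theta> (2*pi*x + s) - \<theta> (2*pi*x - s)) / s) \<partial>lborel)"
        by (simp add: distrib_left right_diff_distrib)
      also have "\<dots> \<le> ennreal (28 * e')" by (rule d(2))
      also have "\<dots> \<le> ennreal e" using e'(3) by (rule ennreal_leI)
      finally show "(\<integral>\<^sup>+t\<in>{0<..<d/(2*pi)}. ennreal ((?m (x + t) - ?m (x - t)) / t) \<partial>lborel) \<le> ennreal e" .
    qed
  qed
  show ?thesis using \<nu> sD cD D0 lim by (simp add: class_A_def)
qed

lemma radial_projection_imp_class_A:
  fixes \<nu> :: "real measure"
  assumes \<nu>: "prob_on_segment 0 (2*pi) \<nu>" and atomless: "\<forall>t\<in>{0..2*pi}. measure \<nu> {t} = 0"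
    and \<Omega>: "strictly_star_shaped \<Omega>"
    and proj: "\<And>F. F \<in> sets borel \<Longrightarrow> F \<subseteq> {0..2*pi} \<Longrightarrow> measure \<nu> F = radial_projection \<Omega> F"
  shows "\<nu> \<in> class_A 0 (2*pi)"
proof -
  obtain R where R: "continuous_on {0..2*pi} R" "\<And>t. t \<in> {0..2*pi} \<Longrightarrow> 0 < R t" "R 0 = R (2*pi)"
    "\<Omega> = {of_real \<rho> * cis \<theta> | \<rho> \<theta>. 0 \<le> \<rho> \<and> \<rho> < R \<theta> \<and> \<theta> \<in> {0..2*pi}}"
    using \<Omega> unfolding strictly_star_shaped_def by blast
  obtain k where k: "continuous_on (sphere 0 1) k" "\<And>w. norm w = 1 \<Longrightarrow> 0 < k w"
    and k2: "{of_real \<rho> * cis \<theta> | \<rho> \<theta>. 0 \<le> \<rho> \<and> \<rho> < R \<theta> \<and> \<theta> \<in> {0..2*pi}} = {w. gauge_of k w < 1}"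
    by (rule strictly_star_shaped_gauge[OF R(1-3)], assumption) (rule that; assumption)
  have \<Omega>k: "\<Omega> = {w. gauge_of k w < 1}" using R(4) k2 by simp
  obtain H \<phi> where H: "continuous_on (cball 0 1) H" "H holomorphic_on ball 0 1" and \<phi>: "\<phi> holomorphic_on {w. gauge_of k w < 1}"
    and f\<phi>: "\<And>z. norm z < 1 \<Longrightarrow> z * exp (H z) \<in> {w. gauge_of k w < 1} \<and> \<phi> (z * exp (H z)) = z"
      "\<And>w. w \<in> {w. gauge_of k w < 1} \<Longrightarrow> norm (\<phi> w) < 1 \<and> \<phi> w * exp (H (\<phi> w)) = w"
    and mono: "\<And>x y. x \<le> y \<Longrightarrow> x + Im (H (cis x)) \<le> y + Im (H (cis y))" and H1: "Im (H 1) = 0"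
    by (rule star_riemann_map_extends[OF k], assumption) (rule that; assumption)
  define \<theta> where "\<theta> t = t + Im (H (cis t))" for t
  let ?I = "{0..2*pi}"
  have \<theta>m: "\<theta> x \<le> \<theta> y" if "x \<le> y" for x y using mono[OF that] by (simp add: \<theta>_def)
  have \<theta>0: "\<theta> 0 = 0" and \<theta>1: "\<theta> (2*pi) = 2*pi" using H1 by (auto simp: \<theta>_def)
  have \<theta>I: "\<theta> t \<in> ?I" if "t \<in> ?I" for t using \<theta>m[of 0 t] \<theta>m[of t "2*pi"] \<theta>0 \<theta>1 that by simp
  define \<tau> where "\<tau> t = (if \<theta> t = 2*pi then 0 else \<theta> t)" for t
  have rp: "measure \<nu> F = measure lborel (?I \<inter> \<tau> -` F) / (2*pi)" and \<tau>m: "\<tau> \<in> borel_measurable borel"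
    if "F \<in> sets borel" "F \<subseteq> ?I" for F
  proof -
    have "t + Im (H (cis t)) \<in> ?I" if "t \<in> ?I" for t using \<theta>I[OF that] by (simp add: \<theta>_def)
    from radial_projection_star[OF k H(1) \<phi> f\<phi> this that(1)] proj[OF that]
    show "measure \<nu> F = measure lborel (?I \<inter> \<tau> -` F) / (2*pi)" "\<tau> \<in> borel_measurable borel"
      unfolding \<tau>_def[abs_def] \<theta>_def \<Omega>k by simp_all
  qed
  \<comment> \<open>An interval of constancy would send an arc of positive length to a single
    direction and so create an atom of \<nu>.\<close>
  have \<theta>s: "strict_mono_on ?I \<theta>"
  proof (rule strict_mono_onI)
    fix a b assume ab: "a \<in> ?I" "b \<in> ?I" "a < b"
    show "\<theta> a < \<theta> b"
    proof (rule ccontr)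
      assume "\<not> \<theta> a < \<theta> b"
      then have eq: "\<theta> t = \<theta> a" if "t \<in> {a..b}" for t
        using \<theta>m[of a t] \<theta>m[of t b] that by simp
      have \<tau>a: "\<tau> a \<in> ?I" using \<theta>I[OF ab(1)] by (auto simp: \<tau>_def)
      have S: "?I \<inter> \<tau> -` {\<tau> a} \<in> sets borel"
        using measurable_sets[OF \<tau>m, of "{\<tau> a}" "{\<tau> a}"] \<tau>a by auto
      have "{a..b} \<subseteq> ?I \<inter> \<tau> -` {\<tau> a}"
      proof
        fix t assume t: "t \<in> {a..b}"
        then have "\<tau> t = \<tau> a" using eq[OF t] by (simp add: \<tau>_def)
        then show "t \<in> ?I \<inter> \<tau> -` {\<tau> a}" using t ab by simp
      qed
      moreover have "?I \<inter> \<tau> -` {\<tau> a} \<in> fmeasurable lborel"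
        by (rule fmeasurableI2[OF fmeasurable_compact[OF compact_Icc]]) (use S in auto)
      ultimately have "measure lborel {a..b} \<le> measure lborel (?I \<inter> \<tau> -` {\<tau> a})"
        by (intro measure_mono_fmeasurable) auto
      then have "0 < measure lborel (?I \<inter> \<tau> -` {\<tau> a})" using ab(3) by simp
      then have "0 < measure \<nu> {\<tau> a}" using rp[of "{\<tau> a}"] \<tau>a by simp
      then show False using atomless \<tau>a by simp
    qed
  qed
  show ?thesis
  proof (rule conformal_imp_class_A[OF \<nu> H H1 mono])
    show "strict_mono_on ?I (\<lambda>t. t + Im (H (cis t)))" using \<theta>s by (simp add: \<theta>_def[abs_def])
    fix t assume t: "t \<in> ?I"
    have sub: "{0..\<theta> t} \<subseteq> ?I" using \<theta>I[OF t] by auto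
    have "measure lborel (?I \<inter> \<tau> -` {0..\<theta> t}) = t"
    proof (cases "t = 2*pi")
      case True
      then have "?I \<inter> \<tau> -` {0..\<theta> t} = ?I" using \<theta>I \<theta>1 by (auto simp: \<tau>_def)
      then show ?thesis using True by simp
    next
      case False
      have lt: "\<theta> s \<le> \<theta> t \<longleftrightarrow> s \<le> t" if "s \<in> ?I" for s
        using strict_mono_onD[OF \<theta>s t that] \<theta>m[of s t] by (cases "s \<le> t") auto
      have e2: "\<theta> s = 2*pi \<longleftrightarrow> s = 2*pi" if "s \<in> ?I" for s
        using strict_mono_onD[OF \<theta>s that, of "2*pi"] \<theta>1 that by (cases "s = 2*pi") auto
      \<comment> \<open>The isolated point appears because the parameter \<open>2 * pi\<close> is
        reported with argument 0; it has measure zero.\<close>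
      have "?I \<inter> \<tau> -` {0..\<theta> t} = {0..t} \<union> {2*pi}"
        using lt e2 \<theta>I t \<theta>I[OF t] False by (auto simp: \<tau>_def split: if_splits)
      moreover have "measure lborel ({0..t} \<union> {2*pi}) = measure lborel {0..t}"
        by (intro measure_Un_null_set) auto
      ultimately show ?thesis using t by simp
    qed
    then show "distr_fun 0 \<nu> (t + Im (H (cis t))) = t / (2*pi)"
      using rp[of "{0..\<theta> t}"] sub by (simp add: distr_fun_def \<theta>_def)
  qed
qed

lemma inverse_distr_properties:
  fixes \<nu> :: "real measure"
  assumes A: "\<nu> \<in> class_A 0 (2*pi)"
  defines "m \<equiv> inverse_distr 0 (2*pi) \<nu>" and "D \<equiv> distr_fun 0 \<nu>"
  shows "\<And>x. x \<in> {0..2*pi} \<Longrightarrow> m (D x) = x \<and> D x \<in> {0..1}"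
    and "\<And>s. s \<in> {0..1} \<Longrightarrow> D (m s) = s \<and> m s \<in> {0..2*pi}"
    and "\<And>s. s \<le> 0 \<Longrightarrow> m s = 0" and "\<And>s. 1 \<le> s \<Longrightarrow> m s = 2*pi"
    and "mono m" and "continuous_on {0..1} m" and "D 0 = 0" and "D (2*pi) = 1"
proof -
  let ?I = "{0..2*pi}"
  have \<nu>: "prob_on_segment 0 (2*pi) \<nu>" and sD: "strict_mono_on ?I D" and cD: "continuous_on ?I D" and D0: "D 0 = 0"
    using A by (auto simp: class_A_def D_def)
  interpret prob_space \<nu> by (rule prob_on_segment_sets[OF \<nu>])
  show "D 0 = 0" by (rule D0)
  have D1: "D (2*pi) = 1" using prob_space prob_on_segment_sets(2)[OF \<nu>] by (simp add: D_def distr_fun_def)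
  then show "D (2*pi) = 1" .
  have mD: "D x \<le> D y" if "x \<in> ?I" "y \<in> ?I" "x \<le> y" for x y
    using strict_mono_onD[OF sD that(1,2)] that(3) by (cases "x = y") auto
  have DI: "D x \<in> {0..1}" if "x \<in> ?I" for x using mD[of 0 x] mD[of x "2*pi"] D0 D1 that by simp
  have inj: "inj_on D ?I" by (rule strict_mono_on_imp_inj_on[OF sD])
  have mm: "m (D x) = x" if "x \<in> ?I" for x
    using DI[OF that] the_inv_into_f_f[OF inj that] by (simp add: m_def inverse_distr_def D_def[symmetric])
  show P1: "m (D x) = x \<and> D x \<in> {0..1}" if "x \<in> ?I" for x using mm DI that by blast
  have img: "D ` ?I = {0..1}"
  proof (intro set_eqI iffI)
    fix y assume "y \<in> {0..1::real}"
    then have "\<exists>x\<ge>0. x \<le> 2*pi \<and> D x = y" using IVT'[of D 0 y "2*pi"] cD D0 D1 by simp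
    then show "y \<in> D ` ?I" by force
  qed (use DI in blast)
  show P2: "D (m s) = s \<and> m s \<in> ?I" if "s \<in> {0..1}" for s
  proof -
    have "s \<in> D ` ?I" using that img by simp
    then obtain x where "x \<in> ?I" "s = D x" by blast
    then show ?thesis using mm by simp
  qed
  have "m 0 = 0" "m 1 = 2*pi" using mm[of 0] mm[of "2*pi"] D0 D1 by auto
  then show lo: "m s = 0" if "s \<le> 0" for s using that by (cases "s = 0") (auto simp: m_def inverse_distr_def)
  show hi: "m s = 2*pi" if "1 \<le> s" for s using that \<open>m 1 = 2*pi\<close> by (cases "s = 1") (auto simp: m_def inverse_distr_def)
  have mI: "m s \<in> ?I" for s
    using lo[of s] hi[of s] P2[of s] by (cases "s \<le> 0"; cases "1 \<le> s") auto
  show "mono m"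
  proof (rule monoI)
    fix s t :: real assume st: "s \<le> t"
    show "m s \<le> m t"
    proof (cases "s \<le> 0 \<or> 1 \<le> t")
      case True
      then show ?thesis using lo[of s] hi[of t] mI[of s] mI[of t] by auto
    next
      case False
      then have i: "s \<in> {0..1}" "t \<in> {0..1}" using st by auto
      show ?thesis
      proof (rule ccontr)
        assume "\<not> m s \<le> m t"
        then have "D (m t) < D (m s)" using P2[OF i(1)] P2[OF i(2)] by (intro strict_mono_onD[OF sD]) auto
        then show False using P2[OF i(1)] P2[OF i(2)] st by simp
      qed
    qed
  qed
  have "continuous_on (D ` ?I) m" by (rule continuous_on_inv[OF cD]) (use mm in auto)
  then show "continuous_on {0..1} m" by (simp only: img)
qed

text \<open>On \<open>[-2\<pi>, 4\<pi>]\<close> the quasi-periodic extension of the inverse distribution function is a sum of three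
  translates of the constant extension, so the condition for one gives the condition for the other.\<close>

lemma inverse_distr_circle_function:
  fixes \<nu> :: "real measure"
  assumes A: "\<nu> \<in> class_A 0 (2*pi)"
  defines "m \<equiv> inverse_distr 0 (2*pi) \<nu>"
  obtains g where "continuous_on (sphere 0 1) g"
    "\<And>t. t \<in> {0..2*pi} \<Longrightarrow> g (cis t) = m (t / (2*pi)) - t"
    "\<And>e. 0 < e \<Longrightarrow> \<exists>d. 0 < d \<and> d \<le> pi \<and>
      (\<forall>x. (\<integral>\<^sup>+s\<in>{0<..<d}. ennreal (\<bar>g (cis (x + s)) - g (cis (x - s))\<bar> / s) \<partial>lborel) \<le> ennreal e)"
proof -
  note ip = inverse_distr_properties[OF A, folded m_def]
  have "continuous_on {0..2*pi} (\<lambda>t. m (t / (2*pi)) - t)"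
    by (intro continuous_intros continuous_on_compose2[OF ip(6)]) auto
  moreover have "m (0 / (2*pi)) - 0 = m (2*pi / (2*pi)) - 2*pi" using ip(3)[of 0] ip(4)[of 1] by simp
  ultimately obtain g where g: "continuous_on (sphere 0 1) g" "\<And>t. t \<in> {0..2*pi} \<Longrightarrow> g (cis t) = m (t / (2*pi)) - t"
    using continuous_on_circle_descend[of "\<lambda>t. m (t / (2*pi)) - t"] by metis
  define \<mu> where "\<mu> k y = m (y / (2*pi) - k)" for k y :: real
  \<comment> \<open>Later \<open>y\<close> is an angle in \<open>[0, 2\<pi>)\<close> shifted by at
    most \<open>pi\<close>, so this range suffices. On each of its three periods at most one
    translate varies while the others are 0 or \<open>2 * pi\<close>.\<close>
  have rep: "g (cis y) = \<mu> (-1) y + \<mu> 0 y + \<mu> 1 y - 2*pi - y" if y: "-2*pi \<le> y" "y \<le> 4*pi" for y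
  proof -
    consider "y \<le> 0" | "0 \<le> y" "y \<le> 2*pi" | "2*pi \<le> y" using pi_gt_zero by linarith
    then show ?thesis
    proof cases
      case 1
      have "cis (y + 2*pi) = cis y" by (simp flip: cis_mult)
      then have "g (cis y) = m ((y + 2*pi) / (2*pi)) - (y + 2*pi)" using g(2)[of "y + 2*pi"] 1 y by simp
      moreover have "(y + 2*pi) / (2*pi) = y / (2*pi) + 1" by (simp add: field_simps)
      moreover have q: "y / (2*pi) \<le> 0" using 1 by (simp add: divide_nonpos_pos)
      then have "y / (2*pi) - 1 \<le> 0" by linarith
      then have "m (y / (2*pi) - 1) = 0" "m (y / (2*pi)) = 0" using q by (simp_all only: ip(3))
      ultimately show ?thesis by (simp add: \<mu>_def)
    next
      case 2
      then have "0 \<le> y / (2*pi)" "y / (2*pi) \<le> 1" by (auto simp: field_simps)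
      then show ?thesis using g(2)[of y] 2 ip(3,4) by (simp add: \<mu>_def)
    next
      case 3
      have "cis (y - 2*pi) = cis y" by (simp flip: cis_divide)
      then have "g (cis y) = m ((y - 2*pi) / (2*pi)) - (y - 2*pi)" using g(2)[of "y - 2*pi"] 3 y by simp
      moreover have "(y - 2*pi) / (2*pi) = y / (2*pi) - 1" by (simp add: field_simps)
      moreover have q: "1 \<le> y / (2*pi)" using 3 by (simp add: field_simps)
      then have "1 \<le> y / (2*pi) + 1" by linarith
      then have "m (y / (2*pi) + 1) = 2*pi" "m (y / (2*pi)) = 2*pi" using q by (simp_all only: ip(4))
      ultimately show ?thesis by (simp add: \<mu>_def)
    qed
  qed
  have mm[measurable]: "m \<in> borel_measurable borel" by (rule borel_measurable_mono[OF ip(5)])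
  have \<mu>m[measurable]: "\<mu> k \<in> borel_measurable borel" for k unfolding \<mu>_def[abs_def] by measurable
  have \<mu>mono: "\<mu> k x \<le> \<mu> k y" if "x \<le> y" for k x y
    unfolding \<mu>_def using that by (intro monoD[OF ip(5)] diff_right_mono divide_right_mono) auto
  have lim: "\<forall>e>0. \<exists>d>0. \<forall>x. (\<integral>\<^sup>+t\<in>{0<..<d}. ennreal ((m (x + t) - m (x - t)) / t) \<partial>lborel) \<le> ennreal e"
    using A unfolding class_A_def m_def dini_condition_iff by blast
  show thesis
  proof (rule that[OF g])
    fix e :: real assume e: "0 < e"
    then obtain d1 where d1: "d1 > 0" "\<And>x. (\<integral>\<^sup>+t\<in>{0<..<d1}. ennreal ((m (x + t) - m (x - t)) / t) \<partial>lborel) \<le> ennreal (e/6)"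
      using lim[rule_format, of "e/6"] by auto
    \<comment> \<open>Three translates contribute \<open>e/6\<close> each and the linear term at
      most \<open>2 * d \<le> e/2\<close>; the factor \<open>2 * pi\<close> converts fractions of a
      turn into angles.\<close>
    define d where "d = min (2*pi * d1) (min (e/4) 1)"
    have d: "0 < d" "d \<le> 1" "d \<le> e/4" "d \<le> 2*pi * d1" using e d1 by (auto simp: d_def)
    have N: "(\<integral>\<^sup>+s\<in>{0<..<d}. ennreal ((\<mu> k (x + s) - \<mu> k (x - s)) / s) \<partial>lborel) \<le> ennreal (e/6)" for k x
    proof -
      have "\<mu> k (x + s) = m ((x / (2*pi) - k) + s / (2*pi))" "\<mu> k (x - s) = m ((x / (2*pi) - k) - s / (2*pi))" for s
        by (auto simp: \<mu>_def add_divide_distrib diff_divide_distrib algebra_simps)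
      then have "(\<integral>\<^sup>+s\<in>{0<..<d}. ennreal ((\<mu> k (x + s) - \<mu> k (x - s)) / s) \<partial>lborel) =
        (\<integral>\<^sup>+s\<in>{0<..<d}. ennreal ((m ((x / (2*pi) - k) + s / (2*pi)) - m ((x / (2*pi) - k) - s / (2*pi))) / s) \<partial>lborel)"
        by (simp only:)
      also have "\<dots> = (\<integral>\<^sup>+t\<in>{0<..<d / (2*pi)}. ennreal ((m ((x / (2*pi) - k) + t) - m ((x / (2*pi) - k) - t)) / t) \<partial>lborel)"
        by (rule nn_integral_rescale[OF mm]) simp
      also have "\<dots> \<le> (\<integral>\<^sup>+t\<in>{0<..<d1}. ennreal ((m ((x / (2*pi) - k) + t) - m ((x / (2*pi) - k) - t)) / t) \<partial>lborel)"
      proof (rule nn_integral_mono)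
        have "d / (2*pi) \<le> d1" using d by (simp add: field_simps)
        then show "ennreal ((m ((x / (2*pi) - k) + t) - m ((x / (2*pi) - k) - t)) / t) * indicator {0<..<d / (2*pi)} t
          \<le> ennreal ((m ((x / (2*pi) - k) + t) - m ((x / (2*pi) - k) - t)) / t) * indicator {0<..<d1} t" for t
          by (auto simp: indicator_def)
      qed
      also have "\<dots> \<le> ennreal (e/6)" by (rule d1(2))
      finally show ?thesis .
    qed
    have main: "(\<integral>\<^sup>+s\<in>{0<..<d}. ennreal (\<bar>g (cis (x + s)) - g (cis (x - s))\<bar> / s) \<partial>lborel) \<le> ennreal e" for x
    proof -
      define y where "y = Arg2pi (cis x)"
      have y: "0 \<le> y" "y < 2*pi" "cis y = cis x" using Arg2pi[of "cis x"] cis_Arg2pi[of "cis x"] by (auto simp: y_def)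
      have c: "cis (x + s) = cis (y + s)" "cis (x - s) = cis (y - s)" for s
        using y(3) by (simp_all flip: cis_mult cis_divide)
      let ?n = "\<lambda>k s. ennreal ((\<mu> k (y + s) - \<mu> k (y - s)) / s) * indicator {0<..<d} s"
      have "(\<integral>\<^sup>+s\<in>{0<..<d}. ennreal (\<bar>g (cis (x + s)) - g (cis (x - s))\<bar> / s) \<partial>lborel) \<le>
         (\<integral>\<^sup>+s. ?n (-1) s + ?n 0 s + ?n 1 s + ennreal 2 * indicator {0<..<d} s \<partial>lborel)"
      proof (rule nn_integral_mono)
        fix s
        show "ennreal (\<bar>g (cis (x + s)) - g (cis (x - s))\<bar> / s) * indicator {0<..<d} s \<le>
          ?n (-1) s + ?n 0 s + ?n 1 s + ennreal 2 * indicator {0<..<d} s"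
        proof (cases "s \<in> {0<..<d}")
          case True
          then have s: "0 < s" "s \<le> pi" using d pi_gt3 by auto
          have nn: "0 \<le> (\<mu> k (y + s) - \<mu> k (y - s)) / s" for k using \<mu>mono[of "y - s" "y + s" k] s by simp
          have eq: "g (cis (x + s)) - g (cis (x - s)) =
             (\<mu> (-1) (y + s) - \<mu> (-1) (y - s)) + (\<mu> 0 (y + s) - \<mu> 0 (y - s)) + (\<mu> 1 (y + s) - \<mu> 1 (y - s)) - 2 * s"
            unfolding c using y s by (subst (1 2) rep) auto
          have "\<bar>g (cis (x + s)) - g (cis (x - s))\<bar> \<le>
             (\<mu> (-1) (y + s) - \<mu> (-1) (y - s)) + (\<mu> 0 (y + s) - \<mu> 0 (y - s)) + (\<mu> 1 (y + s) - \<mu> 1 (y - s)) + 2 * s"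
            unfolding eq using \<mu>mono[of "y - s" "y + s" "-1"] \<mu>mono[of "y - s" "y + s" 0] \<mu>mono[of "y - s" "y + s" 1] s by linarith
          then have "\<bar>g (cis (x + s)) - g (cis (x - s))\<bar> / s \<le>
             ((\<mu> (-1) (y + s) - \<mu> (-1) (y - s)) + (\<mu> 0 (y + s) - \<mu> 0 (y - s)) + (\<mu> 1 (y + s) - \<mu> 1 (y - s)) + 2 * s) / s"
            using s by (intro divide_right_mono) auto
          also have "\<dots> = (\<mu> (-1) (y + s) - \<mu> (-1) (y - s)) / s + (\<mu> 0 (y + s) - \<mu> 0 (y - s)) / s + (\<mu> 1 (y + s) - \<mu> 1 (y - s)) / s + 2"
            using s by (simp add: add_divide_distrib)
          finally have "ennreal (\<bar>g (cis (x + s)) - g (cis (x - s))\<bar> / s) \<le> ennreal \<dots>" by (rule ennreal_leI)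
          also have "\<dots> = ennreal ((\<mu> (-1) (y + s) - \<mu> (-1) (y - s)) / s) + ennreal ((\<mu> 0 (y + s) - \<mu> 0 (y - s)) / s) + ennreal ((\<mu> 1 (y + s) - \<mu> 1 (y - s)) / s) + ennreal 2"
            using nn by (simp add: ennreal_plus)
          finally show ?thesis using True by simp
        qed simp
      qed
      also have "\<dots> = (\<integral>\<^sup>+s. ?n (-1) s \<partial>lborel) + (\<integral>\<^sup>+s. ?n 0 s \<partial>lborel) + (\<integral>\<^sup>+s. ?n 1 s \<partial>lborel) + (\<integral>\<^sup>+s. ennreal 2 * indicator {0<..<d} s \<partial>lborel)"
        by (simp add: nn_integral_add)
      also have "\<dots> \<le> ennreal (e/6) + ennreal (e/6) + ennreal (e/6) + ennreal (2 * d)"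
      proof (intro add_mono N)
        have "(\<integral>\<^sup>+s. ennreal 2 * indicator {0<..<d} s \<partial>lborel) = ennreal 2 * ennreal d"
          using d by (subst nn_integral_cmult_indicator) auto
        then show "(\<integral>\<^sup>+s. ennreal 2 * indicator {0<..<d} s \<partial>lborel) \<le> ennreal (2 * d)" using d by (simp add: ennreal_mult')
      qed
      also have "\<dots> = ennreal (e/6 + e/6 + e/6 + 2 * d)" using e d by (simp add: ennreal_plus[symmetric] del: ennreal_plus)
      also have "\<dots> \<le> ennreal e" using d by (intro ennreal_leI) simp
      finally show ?thesis .
    qed
    show "\<exists>d. 0 < d \<and> d \<le> pi \<and>
      (\<forall>x. (\<integral>\<^sup>+s\<in>{0<..<d}. ennreal (\<bar>g (cis (x + s)) - g (cis (x - s))\<bar> / s) \<partial>lborel) \<le> ennreal e)"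
      using main d pi_gt3 by (intro exI[of _ d]) auto
  qed
qed

text \<open>Inverse transform sampling: both sides come from probability measures on the line, and
  these agree because their distribution functions do.\<close>

lemma measure_eq_inverse_image:
  fixes \<nu> :: "real measure"
  assumes \<nu>: "prob_on_segment 0 (2*pi) \<nu>"
    and \<theta>: "\<And>t. t \<in> {0..2*pi} \<Longrightarrow> \<theta> t \<in> {0..2*pi} \<and> distr_fun 0 \<nu> (\<theta> t) = t / (2*pi)"
    and D: "strict_mono_on {0..2*pi} (distr_fun 0 \<nu>)"
    and \<tau>: "(\<lambda>t. if \<theta> t = 2*pi then 0 else \<theta> t) \<in> borel_measurable borel"
    and F: "F \<in> sets borel" "F \<subseteq> {0..2*pi}"
  shows "measure \<nu> F = measure lborel ({0..2*pi} \<inter> (\<lambda>t. if \<theta> t = 2*pi then 0 else \<theta> t) -` F) / (2*pi)"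
proof -
  let ?I = "{0..2*pi}" and ?D = "distr_fun 0 \<nu>"
  define \<tau> where "\<tau> t = (if \<theta> t = 2*pi then 0 else \<theta> t)" for t
  have \<tau>m[measurable]: "\<tau> \<in> borel_measurable borel" using \<tau> by (simp add: \<tau>_def[abs_def])
  note ps = prob_on_segment_sets[OF \<nu>]
  interpret prob_space \<nu> by (rule ps(1))
  have idm: "(\<lambda>x. x) \<in> measurable \<nu> borel"
    by (rule measurableI) (auto simp: ps)
  let ?U = "uniform_measure lborel ?I"
  interpret U: prob_space ?U by (rule prob_space_uniform_measure) auto
  have \<tau>U: "\<tau> \<in> measurable ?U borel" by measurable
  let ?M1 = "distr \<nu> borel (\<lambda>x. x)" and ?M2 = "distr ?U borel \<tau>"
  have m1: "measure ?M1 A = measure \<nu> (A \<inter> ?I)" if "A \<in> sets borel" for A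
    using that by (simp add: measure_distr[OF idm] ps vimage_def)
  have m2: "measure ?M2 A = measure lborel (?I \<inter> \<tau> -` A) / (2*pi)" if A: "A \<in> sets borel" for A
  proof -
    have "\<tau> -` A \<in> sets borel" using measurable_sets[OF \<tau>m A] by simp
    then show ?thesis using A by (simp add: measure_distr[OF \<tau>U] measure_uniform_measure)
  qed
  have "cdf ?M1 = cdf ?M2"
  proof
    fix y
    have c: "cdf ?M1 y = measure \<nu> ({..y} \<inter> ?I)" "cdf ?M2 y = measure lborel (?I \<inter> \<tau> -` {..y}) / (2*pi)"
      by (auto simp: cdf_def m1 m2)
    have D1: "?D (2*pi) = 1" using prob_space ps(2) by (simp add: distr_fun_def)
    have \<tau>I: "\<tau> t \<in> ?I" if "t \<in> ?I" for t using \<theta>[OF that] by (auto simp: \<tau>_def)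
    consider "y < 0" | "2*pi \<le> y" | "0 \<le> y" "y < 2*pi" by linarith
    then show "cdf ?M1 y = cdf ?M2 y"
    proof cases
      case 1
      then have "{..y} \<inter> ?I = {}" "?I \<inter> \<tau> -` {..y} = {}" using \<tau>I by fastforce+
      then show ?thesis unfolding c by simp
    next
      case 2
      then have e: "{..y} \<inter> ?I = ?I" "?I \<inter> \<tau> -` {..y} = ?I" using \<tau>I by fastforce+
      show ?thesis unfolding c e using D1 by (simp add: distr_fun_def)
    next
      case 3
      have e1: "{..y} \<inter> ?I = {0..y}" using 3 by auto
      have yI: "y \<in> ?I" using 3 by simp
      have Dy: "0 \<le> ?D y" "?D y < 1" using strict_mono_onD[OF D yI, of "2*pi"] 3 D1 by (auto simp: distr_fun_def)
      define t where "t = 2*pi * ?D y"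
      have t: "0 \<le> t" "t < 2*pi" using Dy by (auto simp: t_def)
      have le: "\<theta> s \<le> y \<longleftrightarrow> s \<le> t" if s: "s \<in> ?I" for s
      proof -
        have "\<theta> s \<le> y \<longleftrightarrow> ?D (\<theta> s) \<le> ?D y"
          by (rule strict_mono_on_less_eq[OF D, symmetric]) (use \<theta>[OF s] yI in auto)
        also have "\<dots> \<longleftrightarrow> s \<le> t" using \<theta>[OF s] by (simp add: t_def pos_divide_le_eq mult.commute)
        finally show ?thesis .
      qed
      have top: "\<theta> s = 2*pi \<longleftrightarrow> s = 2*pi" if s: "s \<in> ?I" for s
      proof
        assume "\<theta> s = 2*pi" then show "s = 2*pi" using \<theta>[OF s] D1 by simp
      next
        assume "s = 2*pi"
        then have "?D (\<theta> s) = ?D (2*pi)" using \<theta>[OF s] D1 by simp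
        then show "\<theta> s = 2*pi" using inj_onD[OF strict_mono_on_imp_inj_on[OF D]] \<theta>[OF s] by auto
      qed
      have "?I \<inter> \<tau> -` {..y} = {0..t} \<union> {2*pi}"
        using le top t 3 by (auto simp: \<tau>_def split: if_splits)
      moreover have "measure lborel ({0..t} \<union> {2*pi}) = measure lborel {0..t}"
        by (intro measure_Un_null_set) auto
      ultimately show ?thesis unfolding c e1 using t by (simp add: t_def distr_fun_def)
    qed
  qed
  moreover have "real_distribution ?M1" "real_distribution ?M2"
    using idm \<tau>U by (auto simp: real_distribution_def real_distribution_axioms_def prob_space_distr U.prob_space_distr)
  ultimately have "?M1 = ?M2" by (intro cdf_unique)
  then have "measure ?M1 F = measure ?M2 F" by simp
  then have "measure \<nu> F = measure lborel (?I \<inter> \<tau> -` F) / (2*pi)"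
    using m1[OF F(1)] m2[OF F(1)] F(2) by (simp add: Int_absorb2)
  then show ?thesis by (simp only: \<tau>_def[abs_def])
qed

lemma class_A_imp_radial_projection:
  fixes \<nu> :: "real measure"
  assumes A: "\<nu> \<in> class_A 0 (2*pi)"
  shows "\<exists>\<Omega>. strictly_star_shaped \<Omega> \<and>
    (\<forall>F. F \<in> sets borel \<and> F \<subseteq> {0..2*pi} \<longrightarrow> measure \<nu> F = radial_projection \<Omega> F)"
proof -
  let ?I = "{0..2*pi}"
  define m where "m = inverse_distr 0 (2*pi) \<nu>"
  define D where "D = distr_fun 0 \<nu>"
  note ip = inverse_distr_properties[OF A, folded m_def D_def]
  have \<nu>: "prob_on_segment 0 (2*pi) \<nu>" and sD: "strict_mono_on ?I D" and cD: "continuous_on ?I D"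
    using A by (auto simp: class_A_def D_def)
  obtain g where g: "continuous_on (sphere 0 1) g" "\<And>t. t \<in> ?I \<Longrightarrow> g (cis t) = m (t / (2*pi)) - t"
    and gd: "\<And>e. 0 < e \<Longrightarrow> \<exists>d. 0 < d \<and> d \<le> pi \<and>
      (\<forall>x. (\<integral>\<^sup>+s\<in>{0<..<d}. ennreal (\<bar>g (cis (x + s)) - g (cis (x - s))\<bar> / s) \<partial>lborel) \<le> ennreal e)"
    by (rule inverse_distr_circle_function[OF A, folded m_def]) (rule that; assumption)
  obtain H where H: "continuous_on (cball 0 1) H" "H holomorphic_on ball 0 1" and HI: "\<And>t. Im (H (cis t)) = g (cis t)"
    by (rule dini_condition_extends[OF g(1) gd], assumption) (rule that; assumption)
  have \<theta>: "t + Im (H (cis t)) = m (t / (2*pi))" if "t \<in> ?I" for t using HI[of t] g(2)[OF that] by simp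
  have tI: "t / (2*pi) \<in> {0..1}" if "t \<in> ?I" for t using that by (simp add: field_simps)
  have m\<theta>: "m (t / (2*pi)) \<in> ?I \<and> D (m (t / (2*pi))) = t / (2*pi)" if "t \<in> ?I" for t
    using ip(2)[OF tI[OF that]] by blast
  \<comment> \<open>The boundary point in direction \<open>\<alpha>\<close> has parameter
    \<open>2 * pi * D \<alpha>\<close>, so this is the modulus that \<open>z * exp (H z)\<close> has
    there. It makes the boundary values of the map have gauge 1.\<close>
  define R where "R \<alpha> = exp (Re (H (cis (2*pi * D \<alpha>))))" for \<alpha>
  have Rc: "continuous_on ?I R" unfolding R_def
    by (intro continuous_intros continuous_on_compose2[OF H(1)] cD) auto
  have R0: "R 0 = R (2*pi)" using ip(7,8) by (simp add: R_def)
  have Rpos: "0 < R t" for t by (simp add: R_def)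
  define \<Omega> where "\<Omega> = {of_real \<rho> * cis \<theta> | \<rho> \<theta>. 0 \<le> \<rho> \<and> \<rho> < R \<theta> \<and> \<theta> \<in> ?I}"
  have star: "strictly_star_shaped \<Omega>"
    unfolding strictly_star_shaped_def \<Omega>_def using Rc R0 Rpos by blast
  obtain k where k: "continuous_on (sphere 0 1) k" "\<And>w. norm w = 1 \<Longrightarrow> 0 < k w"
    and kR: "\<And>t. t \<in> ?I \<Longrightarrow> k (cis t) = 1 / R t" and k\<Omega>: "\<Omega> = {w. gauge_of k w < 1}"
    by (rule strictly_star_shaped_gauge[OF Rc Rpos R0, folded \<Omega>_def]) (rule that; assumption)
  have bd: "gauge_of k (w * exp (H w)) = 1" if w: "norm w = 1" for w
  proof -
    obtain t where t: "0 \<le> t" "t < 2*pi" "w = cis t" by (rule sphere_obtain_angle[OF w])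
    have tI: "t \<in> ?I" using t by simp
    have "w * exp (H w) = of_real (exp (Re (H (cis t)))) * cis (t + Im (H (cis t)))"
      using t(3) by (simp add: exp_eq_polar flip: cis_mult)
    then have "gauge_of k (w * exp (H w)) = exp (Re (H (cis t))) * k (cis (m (t / (2*pi))))"
      using \<theta>[OF tI] gauge_of_cis[of "exp (Re (H (cis t)))" k] by simp
    also have "k (cis (m (t / (2*pi)))) = 1 / exp (Re (H (cis t)))"
      using kR m\<theta>[OF tI] by (simp add: R_def)
    finally show ?thesis by simp
  qed
  obtain \<phi> where \<phi>: "\<phi> holomorphic_on {w. gauge_of k w < 1}"
    "\<And>z. norm z < 1 \<Longrightarrow> z * exp (H z) \<in> {w. gauge_of k w < 1} \<and> \<phi> (z * exp (H z)) = z"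
    "\<And>w. w \<in> {w. gauge_of k w < 1} \<Longrightarrow> norm (\<phi> w) < 1 \<and> \<phi> w * exp (H (\<phi> w)) = w"
    by (rule star_map_conformal[OF k H bd]) (assumption | rule that; assumption)+
  have \<theta>I: "t + Im (H (cis t)) \<in> ?I" if "t \<in> ?I" for t using \<theta>[OF that] m\<theta>[OF that] by simp
  have "measure \<nu> F = radial_projection \<Omega> F" if F: "F \<in> sets borel" "F \<subseteq> ?I" for F
  proof -
    note rp = radial_projection_star[OF k H(1) \<phi> \<theta>I F(1)]
    have "measure \<nu> F = measure lborel (?I \<inter> (\<lambda>t. if t + Im (H (cis t)) = 2*pi then 0 else t + Im (H (cis t))) -` F) / (2*pi)"
    proof (rule measure_eq_inverse_image[OF \<nu> _ _ rp(2) F])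
      show "t + Im (H (cis t)) \<in> ?I \<and> distr_fun 0 \<nu> (t + Im (H (cis t))) = t / (2*pi)" if "t \<in> ?I" for t
        using \<theta>[OF that] m\<theta>[OF that] by (simp add: D_def)
      show "strict_mono_on ?I (distr_fun 0 \<nu>)" using sD by (simp add: D_def)
    qed
    then show ?thesis using rp(1) by (simp only: k\<Omega>)
  qed
  then show ?thesis using star by blast
qed

theorem theorem5:
  fixes \<nu> :: "real measure"
  assumes "prob_on_segment 0 (2*pi) \<nu>"
    and "\<forall>t\<in>{0..2*pi}. measure \<nu> {t} = 0"
  shows "(\<exists>\<Omega>. strictly_star_shaped \<Omega> \<and>
            (\<forall>F. F \<in> sets borel \<and> F \<subseteq> {0..2*pi} \<longrightarrow> measure \<nu> F = radial_projection \<Omega> F))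
         \<longleftrightarrow> \<nu> \<in> class_A 0 (2*pi)"
  using radial_projection_imp_class_A[OF assms] class_A_imp_radial_projection by blast

end
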